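(* Let $P_1,P_2$ be two cameras with distinct centers $p_1,p_2\in\mathbb{P}^3$ and let $X\subset\widetilde{\mathbb{P}^3}$ be a set of points, where $\widetilde{\mathbb{P}^3}$ is the blow-up of $\mathbb{P}^3$ in $p_1,p_2$. The configuration $(P_1,P_2,X)$ is non-trivially critical if and only if there exists a real quadric $S_P\subset\mathbb{P}^3$ containing the camera centers $p_1,p_2$ and whose strict transform in $\widetilde{\mathbb{P}^3}$ contains $X$, and $S_P$ (together with $p_1,p_2$) is one of the following: (1) a smooth ruled quadric, and $p_1,p_2$ do not lie on a common line contained in $S_P$; (2) a smooth ruled quadric, and $p_1,p_2$ lie on a common line contained in $S_P$; (3) a (quadric) cone, neither $p_1$ nor $p_2$ is the vertex, and $p_1,p_2$ do not lie on a common line contained in the cone; (4) a (quadric) cone, one of $p_1,p_2$ is the vertex and the other is not; (5) a union of two distinct planes, $p_1,p_2$ lie in the same plane, and neither lies on the intersection of the planes; (6) a union of two distinct planes, and exactly one of $p_1,p_2$ lies on the intersection line of the planes; (7) a union of two distinct (possibly complex conjugate) planes, and both $p_1,p_2$ lie on the intersection line of the planes; (8) a double plane, with $p_1,p_2$ in the plane.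
   Context: $\mathbb{P}^n$ is projective space over $\mathbb{C}$. A camera is a linear projection $P:\mathbb{P}^3\dashrightarrow\mathbb{P}^2$ given by a real $3\times4$ matrix of rank $3$; its center is the kernel of the matrix. For cameras $(P_1,P_2)$ with distinct centers, $\widetilde{\mathbb{P}^3}$ is the blow-up of $\mathbb{P}^3$ in the two centers, each $P_i$ extends to a morphism $\widetilde{\mathbb{P}^3}\to\mathbb{P}^2$, and the joint camera map is $\widetilde{\phi_P}=P_1\times P_2:\widetilde{\mathbb{P}^3}\to\mathbb{P}^2\times\mathbb{P}^2$. For another pair $(Q_1,Q_2)$ the same notation is used with the blow-up in the centers $q_1,q_2$. The image of $\widetilde{\phi_P}$ is the zero locus of a single real bilinear form of rank $2$, the fundamental form $F_P(\mathbf{x},\mathbf{y})=\det\begin{bmatrix}P_1&\mathbf{x}&0\\P_2&0&\mathbf{y}\end{bmatrix}$. Bilinear forms are considered up to nonzero scaling. Two configurations $(P_1,P_2,X)$, $(Q_1,Q_2,Y)$ with $\widetilde{\phi_P}(X)=\widetilde{\phi_Q}(Y)$ are equivalent if there is $A\in\mathrm{PGL}(4)$ taking the blow-down (image in $\mathbb{P}^3$) of $X$ to the blow-down of $Y$ and with $P_iA^{-1}=Q_i$ (as camera matrices) for $i=1,2$. A conjugate of $(P_1,P_2,X)$ is a non-equivalent configuration $(Q_1,Q_2,Y)$ with $\widetilde{\phi_P}(X)=\widetilde{\phi_Q}(Y)$. The configuration $(P_1,P_2,X)$ is non-trivially critical if it has a conjugate $(Q_1,Q_2,Y)$ with $F_P\neq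 F_Q$. A real quadric is the surface in $\mathbb{P}^3$ (over $\mathbb{C}$) defined by a nonzero real quadratic form. It is ruled if it contains real lines.
   Formalization: The strict transform of S_P is taken as its total transform minus one copy of each exceptional divisor; over a center singular on S_P it contains the whole exceptional divisor, not only the tangent cone. With the usual closure "only if" fails, e.g. X the exceptional divisor over p_1. *)

theory Defs
  imports "HOL-Analysis.Analysis"
begin

text \<open>
  Points, lines and planes of complex projective space are complex linear subspaces of dimension
  1, 2 and 3 of \<^typ>\<open>complex^'n\<close>, so incidence is inclusion.  Note that \<^const>\<open>vec.subspace\<close>,
  \<^const>\<open>vec.span\<close> and \<^const>\<open>vec.dim\<close> refer to the field \<^typ>\<open>complex\<close> here, whereas the
  unqualified constants would refer to the real scalars.
\<close>

definition proj_points :: "(complex^'n) set set" where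
  "proj_points = {W. vec.subspace W \<and> vec.dim W = 1}"

definition proj_lines :: "(complex^'n) set set" where
  "proj_lines = {W. vec.subspace W \<and> vec.dim W = 2}"

definition proj_planes :: "(complex^'n) set set" where
  "proj_planes = {W. vec.subspace W \<and> vec.dim W = 3}"

definition cvec :: "real^'n \<Rightarrow> complex^'n" where
  "cvec v = (\<chi> i. complex_of_real (v $ i))"

definition cmat :: "real^'n^'m \<Rightarrow> complex^'n^'m" where
  "cmat M = map_matrix complex_of_real M"

definition real_subspace :: "(complex^'n) set \<Rightarrow> bool" where
  "real_subspace W \<longleftrightarrow> (\<exists>U :: (real^'n) set. W = vec.span (cvec ` U))"


section \<open>Cameras and the joint camera map\<close>

definition camera :: "real^4^3 \<Rightarrow> bool" where
  "camera P \<longleftrightarrow> rank P = 3"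

definition center :: "real^4^3 \<Rightarrow> (complex^4) set" where
  "center P = {v. cmat P *v v = 0}"

text \<open>
  The blow-up of projective 3-space in two distinct points \<open>p1\<close>, \<open>p2\<close>, as an incidence variety:
  a point of the blow-up in \<open>p\<close> is a pair of a point \<open>x\<close> and a line through \<open>p\<close> and \<open>x\<close>, and the
  blow-up in two distinct points is the fibre product of the two blow-ups.  The line \<open>L1\<close> is
  determined by \<open>x\<close> unless \<open>x = p1\<close>, in which case it is a point of the exceptional divisor.
\<close>

type_synonym blowup_point = "(complex^4) set \<times> (complex^4) set \<times> (complex^4) set"

definition blowup :: "(complex^4) set \<Rightarrow> (complex^4) set \<Rightarrow> blowup_point set" where
  "blowup p1 p2 = {(x, L1, L2). x \<in> proj_points \<and> L1 \<in> proj_lines \<and> L2 \<in> proj_lines \<and>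
     p1 \<subseteq> L1 \<and> x \<subseteq> L1 \<and> p2 \<subseteq> L2 \<and> x \<subseteq> L2}"

definition blow_down :: "blowup_point \<Rightarrow> (complex^4) set" where
  "blow_down = fst"

text \<open>
  A camera contracts every line through its center to a point of the image plane; this gives the
  extension of the camera to the blow-up.
\<close>

definition joint_camera_map ::
  "real^4^3 \<Rightarrow> real^4^3 \<Rightarrow> blowup_point \<Rightarrow> (complex^3) set \<times> (complex^3) set" where
  "joint_camera_map P1 P2 = (\<lambda>(x, L1, L2). ((*v) (cmat P1) ` L1, (*v) (cmat P2) ` L2))"

definition fundamental_form :: "real^4^3 \<Rightarrow> real^4^3 \<Rightarrow> complex^3 \<Rightarrow> complex^3 \<Rightarrow> complex" where
  "fundamental_form P1 P2 x y = (let A = cmat P1; B = cmat P2 in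
     det (vector
       [vector [A$1$1, A$1$2, A$1$3, A$1$4, x$1, 0],
        vector [A$2$1, A$2$2, A$2$3, A$2$4, x$2, 0],
        vector [A$3$1, A$3$2, A$3$3, A$3$4, x$3, 0],
        vector [B$1$1, B$1$2, B$1$3, B$1$4, 0, y$1],
        vector [B$2$1, B$2$2, B$2$3, B$2$4, 0, y$2],
        vector [B$3$1, B$3$2, B$3$3, B$3$4, 0, y$3]] :: complex^6^6))"

definition same_form ::
  "(complex^3 \<Rightarrow> complex^3 \<Rightarrow> complex) \<Rightarrow> (complex^3 \<Rightarrow> complex^3 \<Rightarrow> complex) \<Rightarrow> bool" where
  "same_form F G \<longleftrightarrow> (\<exists>c. c \<noteq> 0 \<and> (\<forall>x y. F x y = c * G x y))"


section \<open>Configurations, conjugates and criticality\<close>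

definition same_camera :: "complex^4^3 \<Rightarrow> complex^4^3 \<Rightarrow> bool" where
  "same_camera M N \<longleftrightarrow> (\<exists>c. c \<noteq> 0 \<and> M = map_matrix ((*) c) N)"

definition configuration :: "real^4^3 \<Rightarrow> real^4^3 \<Rightarrow> blowup_point set \<Rightarrow> bool" where
  "configuration P1 P2 X \<longleftrightarrow> camera P1 \<and> camera P2 \<and> center P1 \<noteq> center P2 \<and>
     X \<subseteq> blowup (center P1) (center P2)"

definition equivalent_configurations ::
  "real^4^3 \<Rightarrow> real^4^3 \<Rightarrow> blowup_point set \<Rightarrow> real^4^3 \<Rightarrow> real^4^3 \<Rightarrow> blowup_point set \<Rightarrow> bool" where
  "equivalent_configurations P1 P2 X Q1 Q2 Y \<longleftrightarrow>
     (\<exists>A :: complex^4^4. invertible A \<and>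
        (\<lambda>x. (*v) A ` x) ` (blow_down ` X) = blow_down ` Y \<and>
        same_camera (cmat P1 ** matrix_inv A) (cmat Q1) \<and>
        same_camera (cmat P2 ** matrix_inv A) (cmat Q2))"

definition conjugate ::
  "real^4^3 \<Rightarrow> real^4^3 \<Rightarrow> blowup_point set \<Rightarrow> real^4^3 \<Rightarrow> real^4^3 \<Rightarrow> blowup_point set \<Rightarrow> bool" where
  "conjugate P1 P2 X Q1 Q2 Y \<longleftrightarrow> configuration Q1 Q2 Y \<and>
     joint_camera_map P1 P2 ` X = joint_camera_map Q1 Q2 ` Y \<and>
     \<not> equivalent_configurations P1 P2 X Q1 Q2 Y"

definition nontrivially_critical :: "real^4^3 \<Rightarrow> real^4^3 \<Rightarrow> blowup_point set \<Rightarrow> bool" where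
  "nontrivially_critical P1 P2 X \<longleftrightarrow> (\<exists>Q1 Q2 Y. conjugate P1 P2 X Q1 Q2 Y \<and>
     \<not> same_form (fundamental_form P1 P2) (fundamental_form Q1 Q2))"


section \<open>Real quadrics\<close>

text \<open>
  A real quadric is given by the symmetric matrix of its quadratic form; \<open>surface\<close> is the complex
  affine cone over it, so a point, line or plane lies on the quadric iff it is a subset of
  \<open>surface\<close>.
\<close>

definition real_quadric :: "real^4^4 \<Rightarrow> bool" where
  "real_quadric S \<longleftrightarrow> S \<noteq> 0 \<and> transpose S = S"

definition polar_form :: "real^4^4 \<Rightarrow> complex^4 \<Rightarrow> complex^4 \<Rightarrow> complex" where
  "polar_form S u v = (\<Sum>i\<in>UNIV. \<Sum>j\<in>UNIV. complex_of_real (S $ i $ j) * u $ i * v $ j)"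

definition surface :: "real^4^4 \<Rightarrow> (complex^4) set" where
  "surface S = {v. polar_form S v v = 0}"

text \<open>The gradient of the quadratic form of \<open>S\<close> at \<open>v\<close> is \<open>2 S v\<close>.\<close>

definition singular_point :: "real^4^4 \<Rightarrow> (complex^4) set \<Rightarrow> bool" where
  "singular_point S x \<longleftrightarrow> x \<in> proj_points \<and> x \<subseteq> surface S \<and> (\<forall>v\<in>x. cmat S *v v = 0)"

definition smooth_quadric :: "real^4^4 \<Rightarrow> bool" where
  "smooth_quadric S \<longleftrightarrow> (\<forall>x. \<not> singular_point S x)"

definition ruled :: "real^4^4 \<Rightarrow> bool" where
  "ruled S \<longleftrightarrow> (\<exists>L\<in>proj_lines. real_subspace L \<and> L \<subseteq> surface S)"

text \<open>
  A quadric cone (over a smooth conic) is a quadric with exactly one singular point, its vertex;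
  the other singular quadrics are singular along a line (two planes) or a plane (double plane).
\<close>

definition quadric_cone :: "real^4^4 \<Rightarrow> bool" where
  "quadric_cone S \<longleftrightarrow> (\<exists>!x. singular_point S x)"

definition vertex :: "real^4^4 \<Rightarrow> (complex^4) set" where
  "vertex S = (THE x. singular_point S x)"

definition union_of_planes :: "real^4^4 \<Rightarrow> (complex^4) set \<Rightarrow> (complex^4) set \<Rightarrow> bool" where
  "union_of_planes S H K \<longleftrightarrow>
     H \<in> proj_planes \<and> K \<in> proj_planes \<and> H \<noteq> K \<and> surface S = H \<union> K"

text \<open>A quadric whose zero set is a single plane is that plane counted twice.\<close>

definition double_plane :: "real^4^4 \<Rightarrow> bool" where
  "double_plane S \<longleftrightarrow> surface S \<in> proj_planes"

definition on_common_line :: "real^4^4 \<Rightarrow> (complex^4) set \<Rightarrow> (complex^4) set \<Rightarrow> bool" where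
  "on_common_line S p q \<longleftrightarrow> (\<exists>L\<in>proj_lines. L \<subseteq> surface S \<and> p \<subseteq> L \<and> q \<subseteq> L)"

definition tangent_line_at :: "real^4^4 \<Rightarrow> (complex^4) set \<Rightarrow> (complex^4) set \<Rightarrow> bool" where
  "tangent_line_at S p L \<longleftrightarrow> (\<forall>u\<in>p. \<forall>v\<in>L. polar_form S u v = 0)"

text \<open>
  The strict transform of a quadric through \<open>p1\<close> and \<open>p2\<close>, where \<open>p1\<close> and \<open>p2\<close> are regarded as
  simple base points: the total transform minus one copy of each exceptional divisor, that is, the
  member of the linear system \<open>|2H - E1 - E2|\<close> given by the quadric.  Over \<open>p1\<close> it consists of the
  lines meeting the quadric in \<open>p1\<close> at least twice.

  Pitfall: if the quadric is smooth at \<open>p1\<close> and \<open>p2\<close>, this is the closure of the preimage of its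
  complement of \<open>{p1, p2}\<close>.  If it is singular at \<open>p1\<close>, every line through \<open>p1\<close> is tangent, so the
  exceptional divisor over \<open>p1\<close> is included, whereas the closure contains only the tangent cone.
  The pullback of a bilinear form along the joint camera map is always a member of
  \<open>|2H - E1 - E2|\<close>, and with the closure instead the characterisation of critical configurations
  would fail: let \<open>P1\<close> and \<open>P2\<close> have rows \<open>e1, e2, e3\<close> and \<open>e2, e3, e4\<close>, let \<open>Q1\<close> and \<open>Q2\<close> have
  rows \<open>e1, e2, e3\<close> and \<open>e3, -e1, e4\<close>.  The pullback of the fundamental form of \<open>(Q1, Q2)\<close> is
  the union of the closure for the cone \<open>x1 x2 + x3^2 = 0\<close>, whose vertex is \<open>p1\<close>, and the whole
  exceptional divisor over \<open>p1\<close>.  This union is non-trivially critical, but it is not contained in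
  the closure for any quadric.
\<close>

definition strict_transform ::
  "(complex^4) set \<Rightarrow> (complex^4) set \<Rightarrow> real^4^4 \<Rightarrow> blowup_point set" where
  "strict_transform p1 p2 S = {(x, L1, L2) \<in> blowup p1 p2. x \<subseteq> surface S \<and>
     (x = p1 \<longrightarrow> tangent_line_at S p1 L1) \<and> (x = p2 \<longrightarrow> tangent_line_at S p2 L2)}"

end

theory Submission
  imports Defs
begin

text \<open>
  Every real bilinear form of rank 2 is, up to scale, the fundamental form of some pair of cameras
  with distinct centers, and the joint camera map of such a pair is onto the zero locus of its
  fundamental form.  So \<open>(P1, P2, X)\<close> is non-trivially critical iff the joint image of \<open>X\<close> lies in
  the zero locus of a rank 2 form \<open>G\<close> not proportional to the fundamental form of \<open>(P1, P2)\<close>.  The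
  pullback of \<open>G\<close> is a quadric through both centers, and it vanishes identically only if \<open>G\<close> is
  proportional to that fundamental form.

  Writing \<open>G = c1 d1 + c2 d2\<close>, a quadric arises in this way iff its quadratic form is
  \<open>l1 m1 + l2 m2\<close> with \<open>l1, l2\<close> independent linear forms vanishing at the first center and
  \<open>m1, m2\<close> independent linear forms vanishing at the second one.  If the four forms are independent,
  the quadric is smooth and contains the real line \<open>l1 = l2 = 0\<close>.  Otherwise a common element \<open>w\<close>
  of the two pencils brings the quadratic form into the shape \<open>c w\<^sup>2 + l m\<close> or \<open>w n\<close>, which gives
  exactly the singular cases of the list.
\<close>

section \<open>Dual bases and linear forms\<close>

text \<open>The quadric sees only the symmetric part of the pullback \<open>G (P1 v) (P2 w)\<close>.
  Two bilinear forms with the same quadric differ by one whose pullback is alternating with both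
  centers in its kernel, hence by a multiple of the fundamental form \<open>F\<close> of
  \<open>(P1, P2)\<close>. A splitting of a given quadric is therefore not canonical: the task is to
  find a form of rank exactly 2 on the real line \<open>G + t F\<close>. For a product
  \<open>w n\<close>, read naively as a form of rank 1, this needs a rewriting; for quadrics
  singular at a center it needs a choice of the parameter. On a smooth quadric,
  \<open>l1 = l2 = 0\<close> and \<open>m1 = m2 = 0\<close> are lines of one ruling through the two
  centers, and they have to be disjoint. A ruling that contains the line joining the centers fails,
  and the other one then works; both cannot fail, since the centers are distinct. Two further points
  cost little. Non-equivalence is automatic, because equivalent configurations have proportional
  fundamental forms.\<close>

definition dual_bases :: "('n::finite \<Rightarrow> real^'n) \<Rightarrow> ('n \<Rightarrow> real^'n) \<Rightarrow> bool" where
  "dual_bases b f \<longleftrightarrow> (\<forall>i j. f i \<bullet> b j = (if i = j then 1 else 0))"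

text \<open>Spelled out with coefficients because the set \<open>{a, b}\<close> collapses when
  \<open>a = b\<close>, so independence of that set would not exclude equal vectors.\<close>

definition indep2 :: "'a::real_vector \<Rightarrow> 'a \<Rightarrow> bool" where
  "indep2 a b \<longleftrightarrow> (\<forall>s t. s *\<^sub>R a + t *\<^sub>R b = 0 \<longrightarrow> s = 0 \<and> t = 0)"

text \<open>The complex-linear extension of the real form \<open>l\<close>; there is no conjugation,
  unlike in a Hermitian product.\<close>

definition dotc :: "real^'n \<Rightarrow> complex^'n \<Rightarrow> complex" where
  "dotc l v = (\<Sum>i\<in>UNIV. complex_of_real (l $ i) * v $ i)"

lemma indep2D:
  assumes "indep2 a b" and "s *\<^sub>R a + t *\<^sub>R b = 0"
  shows "s = 0" and "t = 0"
  using assms by (auto simp: indep2_def)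

lemma indep2_nonzero:
  assumes "indep2 a b"
  shows "a \<noteq> 0" and "b \<noteq> 0"
  using indep2D(1)[OF assms, of 1 0] indep2D(2)[OF assms, of 0 1] by auto

lemma indep2_commute: "indep2 a b \<longleftrightarrow> indep2 b a"
  unfolding indep2_def by (metis add.commute)

lemma not_indep2E:
  assumes "\<not> indep2 a b" and "a \<noteq> 0"
  obtains k where "b = k *\<^sub>R a"
proof -
  obtain s t where st: "s *\<^sub>R a + t *\<^sub>R b = 0" "s \<noteq> 0 \<or> t \<noteq> 0"
    using assms(1) by (auto simp: indep2_def)
  then have t: "t \<noteq> 0" using assms(2) by auto
  have "t *\<^sub>R b = (- s) *\<^sub>R a" using st(1) by (simp add: add_eq_0_iff)
  then have "(1/t) *\<^sub>R (t *\<^sub>R b) = (1/t) *\<^sub>R ((- s) *\<^sub>R a)" by simp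
  then have "b = (- s / t) *\<^sub>R a" using t by simp
  then show ?thesis using that by blast
qed

lemma indep2_by_dots:
  fixes a b :: "real^'n"
  assumes "a \<bullet> x = 0" "b \<bullet> x \<noteq> 0" "a \<noteq> 0"
  shows "indep2 a b"
  unfolding indep2_def
proof (intro allI impI)
  fix s t assume e: "s *\<^sub>R a + t *\<^sub>R b = 0"
  then have "(s *\<^sub>R a + t *\<^sub>R b) \<bullet> x = 0" by simp
  then have "t = 0" using assms by (simp add: inner_add_left)
  then show "s = 0 \<and> t = 0" using e assms by simp
qed

lemma dual_basesD: "dual_bases b f \<Longrightarrow> f i \<bullet> b j = (if i = j then 1 else 0)"
  by (simp add: dual_bases_def)

lemma dual_bases_commute: "dual_bases b f \<Longrightarrow> dual_bases f b"
  by (auto simp: dual_bases_def inner_commute)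

lemma dual_bases_iff_matrix:
  "dual_bases b f \<longleftrightarrow> (\<chi> i. f i) ** transpose (\<chi> i. b i) = mat 1"
  by (auto simp: dual_bases_def vec_eq_iff matrix_matrix_mult_def transpose_def mat_def inner_vec_def)

text \<open>Independence says that the square matrix with columns \<open>b i\<close> has trivial
  kernel; the rows of a left inverse are the dual forms.\<close>

lemma dual_bases_exists:
  fixes b :: "'n::finite \<Rightarrow> real^'n"
  assumes "\<And>c. (\<Sum>i\<in>UNIV. c i *\<^sub>R b i) = 0 \<Longrightarrow> c = (\<lambda>_. 0)"
  shows "\<exists>f. dual_bases b f"
proof -
  let ?B = "transpose (\<chi> i. b i)"
  have "\<exists>C. C ** ?B = mat 1"
    unfolding matrix_left_invertible_ker
  proof (intro allI impI)
    fix x assume "?B *v x = 0"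
    then have "(\<Sum>i\<in>UNIV. x $ i *\<^sub>R b i) = 0"
      by (simp add: vec_eq_iff matrix_vector_mult_def transpose_def mult.commute)
    from assms[OF this] show "x = 0" by (simp add: vec_eq_iff fun_eq_iff)
  qed
  then obtain C where "C ** ?B = mat 1" by blast
  then have "dual_bases b (\<lambda>i. C $ i)" by (simp add: dual_bases_iff_matrix)
  then show ?thesis by blast
qed

text \<open>Here the forms are given and only known to have no common zero. A left inverse of the
  matrix with rows \<open>f i\<close> is also a right inverse, and its columns are the dual
  vectors.\<close>

lemma dual_bases_exists_kernel:
  fixes f :: "'n::finite \<Rightarrow> real^'n"
  assumes "\<And>x. (\<And>i. f i \<bullet> x = 0) \<Longrightarrow> x = 0"
  shows "\<exists>b. dual_bases b f"
proof -
  let ?F = "(\<chi> i. f i)"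
  have "\<exists>C. C ** ?F = mat 1"
    unfolding matrix_left_invertible_ker
  proof (intro allI impI)
    fix x assume "?F *v x = 0"
    then show "x = 0"
      by (intro assms) (simp add: vec_eq_iff matrix_vector_mult_def inner_vec_def)
  qed
  then obtain C where "C ** ?F = mat 1" by blast
  then have "?F ** C = mat 1" using matrix_left_right_inverse by blast
  then have "dual_bases (\<lambda>i. transpose C $ i) f" by (simp add: dual_bases_iff_matrix)
  then show ?thesis by blast
qed

lemma dual_bases_expand:
  assumes "dual_bases b f"
  shows "x = (\<Sum>i\<in>UNIV. (f i \<bullet> x) *\<^sub>R b i)"
proof -
  have "transpose (\<chi> i. b i) ** (\<chi> i. f i) = mat 1"
    using assms by (simp add: dual_bases_iff_matrix matrix_left_right_inverse)
  then have "transpose (\<chi> i. b i) *v ((\<chi> i. f i) *v x) = x"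
    by (simp add: matrix_vector_mul_assoc)
  moreover have "transpose (\<chi> i. b i) *v ((\<chi> i. f i) *v x) = (\<Sum>i\<in>UNIV. (f i \<bullet> x) *\<^sub>R b i)"
    by (simp add: vec_eq_iff matrix_vector_mult_def transpose_def inner_vec_def mult.commute)
  ultimately show ?thesis by simp
qed

lemma dual_bases_expand_functional:
  assumes "dual_bases b f"
  shows "x = (\<Sum>i\<in>UNIV. (b i \<bullet> x) *\<^sub>R f i)"
  using dual_bases_expand[OF dual_bases_commute[OF assms]] .

text \<open>The expansion survives complexification: it is an identity between products of real
  matrices, which also holds over the complex numbers.\<close>

lemma dual_bases_expand_dotc:
  assumes "dual_bases b f"
  shows "v = (\<Sum>i\<in>UNIV. dotc (f i) v *s cvec (b i))"
proof -
  have "(\<Sum>i\<in>UNIV. f i $ k * b i $ j) = (if j = k then 1 else 0)" for j k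
  proof -
    have "transpose (\<chi> i. b i) ** (\<chi> i. f i) = mat 1"
      using assms by (simp add: dual_bases_iff_matrix matrix_left_right_inverse)
    then have "(transpose (\<chi> i. b i) ** (\<chi> i. f i)) $ j $ k = mat 1 $ j $ k" by simp
    then show ?thesis
      by (simp add: matrix_matrix_mult_def transpose_def mat_def mult.commute)
  qed
  then have *: "(\<Sum>i\<in>UNIV. complex_of_real (f i $ k) * complex_of_real (b i $ j)) = (if j = k then 1 else 0)" for j k
    by (metis (mono_tags, lifting) of_real_0 of_real_1 of_real_mult of_real_sum sum.cong)
  have "(\<Sum>i\<in>UNIV. dotc (f i) v *s cvec (b i)) $ j = v $ j" for j
  proof -
    have "(\<Sum>i\<in>UNIV. dotc (f i) v *s cvec (b i)) $ j
        = (\<Sum>i\<in>UNIV. \<Sum>k\<in>UNIV. (complex_of_real (f i $ k) * complex_of_real (b i $ j)) * v $ k)"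
      by (simp add: dotc_def cvec_def sum_distrib_right sum_distrib_left mult_ac)
    also have "\<dots> = (\<Sum>k\<in>UNIV. (\<Sum>i\<in>UNIV. complex_of_real (f i $ k) * complex_of_real (b i $ j)) * v $ k)"
      by (subst sum.swap) (simp add: sum_distrib_right)
    also have "\<dots> = v $ j" by (simp add: * if_distrib[of "\<lambda>x. x * _"] cong: if_cong)
    finally show ?thesis .
  qed
  then show ?thesis by (simp add: vec_eq_iff)
qed

lemma coefficient_zero_if_not_in_span:
  fixes c :: "'a::real_vector"
  assumes "c \<notin> span A" and "x \<in> span A" and "x + r *\<^sub>R c = 0"
  shows "r = 0"
proof (rule ccontr)
  assume r: "r \<noteq> 0"
  have "r *\<^sub>R c = - x" by (rule minus_unique[OF assms(3), symmetric])
  then have "r *\<^sub>R c \<in> span A" using span_neg[OF assms(2)] by simp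
  then have "(1 / r) *\<^sub>R (r *\<^sub>R c) \<in> span A" by (rule span_scale)
  then show False using assms(1) r by simp
qed

lemma dual_bases_extend_three:
  fixes a b c :: "real^4"
  assumes ind: "\<And>s t r. s *\<^sub>R a + t *\<^sub>R b + r *\<^sub>R c = 0 \<Longrightarrow> s = 0 \<and> t = 0 \<and> r = 0"
  obtains u f where "dual_bases u f" "u 1 = a" "u 2 = b" "u 3 = c"
proof -
  have "dim {a, b, c} \<le> card {a, b, c}" by (rule dim_le_card') simp
  also have "\<dots> \<le> 3" by (metis card.empty card_insert_le_m1 numeral_3_eq_3 diff_Suc_1 zero_less_Suc order_refl)
  finally have "dim (span {a, b, c}) < dim (UNIV :: (real^4) set)" by simp
  then obtain d where d: "d \<notin> span {a, b, c}" by (metis UNIV_eq_I less_irrefl)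
  let ?u = "(\<lambda>i::4. if i = 1 then a else if i = 2 then b else if i = 3 then c else d)"
  have "\<exists>f. dual_bases ?u f"
  proof (rule dual_bases_exists)
    fix k :: "4 \<Rightarrow> real"
    assume "(\<Sum>i\<in>UNIV. k i *\<^sub>R ?u i) = 0"
    then have e: "k 1 *\<^sub>R a + k 2 *\<^sub>R b + k 3 *\<^sub>R c + k 4 *\<^sub>R d = 0"
      by (simp add: sum_4)
    have "k 1 *\<^sub>R a + k 2 *\<^sub>R b + k 3 *\<^sub>R c \<in> span {a, b, c}"
      by (intro span_scale span_add) (auto intro: span_base)
    from coefficient_zero_if_not_in_span[OF d this e] have "k 4 = 0" .
    moreover from this ind[of "k 1" "k 2" "k 3"] e have "k 1 = 0 \<and> k 2 = 0 \<and> k 3 = 0" by simp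
    ultimately have "\<forall>i. k i = 0" by (simp add: forall_4)
    then show "k = (\<lambda>_. 0)" by auto
  qed
  then show ?thesis using that[of ?u] by auto
qed

lemma dual_bases_extend_two:
  fixes a b :: "real^4"
  assumes ind: "indep2 a b"
  obtains u f where "dual_bases u f" "u 1 = a" "u 2 = b"
proof -
  have "dim {a, b} \<le> card {a, b}" by (rule dim_le_card') simp
  also have "\<dots> \<le> 2" by (simp add: card_insert_if)
  finally have "dim (span {a, b}) < dim (UNIV :: (real^4) set)" by simp
  then obtain c where c: "c \<notin> span {a, b}" by (metis UNIV_eq_I less_irrefl)
  have "s = 0 \<and> t = 0 \<and> r = 0" if e: "s *\<^sub>R a + t *\<^sub>R b + r *\<^sub>R c = 0" for s t r
  proof -
    have "s *\<^sub>R a + t *\<^sub>R b \<in> span {a, b}"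
      by (intro span_scale span_add) (auto intro: span_base)
    from coefficient_zero_if_not_in_span[OF c this e] have "r = 0" .
    then show ?thesis using indep2D[OF ind, of s t] e by simp
  qed
  then show ?thesis using dual_bases_extend_three[of a b c] that by metis
qed

lemma dual_bases_extend_two_3:
  fixes a b :: "real^3"
  assumes ind: "indep2 a b"
  obtains u f where "dual_bases u f" "u 1 = a" "u 2 = b"
proof -
  have "dim {a, b} \<le> card {a, b}" by (rule dim_le_card') simp
  also have "\<dots> \<le> 2" by (simp add: card_insert_if)
  finally have "dim (span {a, b}) < dim (UNIV :: (real^3) set)" by simp
  then have "span {a, b} \<noteq> UNIV" by (metis less_irrefl)
  then obtain c where c: "c \<notin> span {a, b}" by blast
  let ?u = "(\<lambda>i::3. if i = 1 then a else if i = 2 then b else c)"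
  have "\<exists>f. dual_bases ?u f"
  proof (rule dual_bases_exists)
    fix k :: "3 \<Rightarrow> real"
    assume "(\<Sum>i\<in>UNIV. k i *\<^sub>R ?u i) = 0"
    then have e: "k 1 *\<^sub>R a + k 2 *\<^sub>R b + k 3 *\<^sub>R c = 0" by (simp add: sum_3)
    have "k 1 *\<^sub>R a + k 2 *\<^sub>R b \<in> span {a, b}"
      by (intro span_scale span_add) (auto intro: span_base)
    from coefficient_zero_if_not_in_span[OF c this e] have r: "k 3 = 0" .
    then have "k 1 = 0" "k 2 = 0" using indep2D[OF ind, of "k 1" "k 2"] e by simp_all
    then have "\<forall>i. k i = 0" using r by (simp add: forall_3)
    then show "k = (\<lambda>_. 0)" by auto
  qed
  then show ?thesis using that[of ?u] by auto
qed

section \<open>Real and imaginary parts, and real linear forms on complex vectors\<close>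

definition re_vec :: "complex^'n \<Rightarrow> real^'n" where "re_vec v = (\<chi> i. Re (v $ i))"
definition im_vec :: "complex^'n \<Rightarrow> real^'n" where "im_vec v = (\<chi> i. Im (v $ i))"

lemma complex_vec_split: "v = cvec (re_vec v) + \<i> *s cvec (im_vec v)"
  by (simp add: vec_eq_iff cvec_def re_vec_def im_vec_def complex_eq)

lemma re_im_vec_eq_0: "re_vec v = 0 \<Longrightarrow> im_vec v = 0 \<Longrightarrow> v = 0"
  by (simp add: vec_eq_iff re_vec_def im_vec_def complex_eq_iff)

lemma cvec_eq_0 [simp]: "cvec u = 0 \<longleftrightarrow> u = 0"
  by (simp add: vec_eq_iff cvec_def)

lemma cvec_0 [simp]: "cvec 0 = 0"
  by simp

lemma cvec_add: "cvec (u + v) = cvec u + cvec v"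
  by (simp add: vec_eq_iff cvec_def)

lemma cvec_scale: "cvec (k *\<^sub>R u) = complex_of_real k *s cvec u"
  by (simp add: vec_eq_iff cvec_def)

lemma dotc_add [simp]: "dotc l (u + v) = dotc l u + dotc l v"
  by (simp add: dotc_def algebra_simps sum.distrib)

lemma dotc_diff [simp]: "dotc l (u - v) = dotc l u - dotc l v"
  by (simp add: dotc_def algebra_simps sum_subtractf)

lemma dotc_scale [simp]: "dotc l (k *s u) = k * dotc l u"
  by (simp add: dotc_def algebra_simps sum_distrib_left)

lemma dotc_0 [simp]: "dotc l 0 = 0" "dotc 0 v = 0"
  by (simp_all add: dotc_def)

lemma dotc_add_left: "dotc (l + m) v = dotc l v + dotc m v"
  by (simp add: dotc_def algebra_simps sum.distrib)

lemma dotc_diff_left: "dotc (l - m) v = dotc l v - dotc m v"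
  by (simp add: dotc_def algebra_simps sum_subtractf)

lemma dotc_scale_left: "dotc (k *\<^sub>R l) v = complex_of_real k * dotc l v"
  by (simp add: dotc_def algebra_simps sum_distrib_left)

lemma dotc_cvec [simp]: "dotc l (cvec u) = complex_of_real (l \<bullet> u)"
  by (simp add: dotc_def cvec_def inner_vec_def)

lemma dotc_eq_0_iff: "dotc l v = 0 \<longleftrightarrow> l \<bullet> re_vec v = 0 \<and> l \<bullet> im_vec v = 0"
proof -
  have "dotc l v = complex_of_real (l \<bullet> re_vec v) + \<i> * complex_of_real (l \<bullet> im_vec v)"
    by (subst complex_vec_split) (simp only: dotc_add dotc_scale dotc_cvec)
  then show ?thesis by (simp add: complex_eq_iff)
qed

lemma dotc_axis [simp]: "dotc (axis i 1) v = v $ i"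
  by (simp add: dotc_def axis_def if_distrib[of complex_of_real] if_distrib[of "\<lambda>x. x * _"] cong: if_cong)

lemma cmat_mult_component: "(cmat M *v v) $ i = dotc (M $ i) v"
  by (simp add: cmat_def map_matrix_def matrix_vector_mult_def dotc_def)

lemma cmat_cvec: "cmat M *v cvec u = cvec (M *v u)"
  by (simp add: vec_eq_iff cmat_mult_component) (simp add: cvec_def matrix_vector_mult_def inner_vec_def)

text \<open>The kernel of a real matrix is closed under taking real and imaginary parts. Through
  this, singular points and centers can be treated over the reals.\<close>

lemma cmat_eq_0_iff: "cmat M *v v = 0 \<longleftrightarrow> M *v re_vec v = 0 \<and> M *v im_vec v = 0"
  by (auto simp: vec_eq_iff cmat_mult_component dotc_eq_0_iff)
     (simp_all add: matrix_vector_mult_def inner_vec_def)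

text \<open>The form \<open>c\<close> on the image plane pulls back along the camera
  \<open>M\<close> to the form \<open>transpose M *v c\<close>; the passage between bilinear forms
  and quadrics rests on this.\<close>

lemma dotc_transpose: "dotc (transpose M *v c) v = dotc c (cmat M *v v)"
proof -
  have "dotc (transpose M *v c) v
      = (\<Sum>j\<in>UNIV. \<Sum>i\<in>UNIV. complex_of_real (c $ i) * complex_of_real (M $ i $ j) * v $ j)"
    by (simp add: dotc_def matrix_vector_mult_def transpose_def sum_distrib_left sum_distrib_right mult_ac)
  also have "\<dots> = dotc c (cmat M *v v)"
    by (subst sum.swap)
       (simp add: dotc_def cmat_def map_matrix_def matrix_vector_mult_def sum_distrib_left sum_distrib_right mult_ac)
  finally show ?thesis .
qed

section \<open>The fundamental form\<close>

lemma exhaust_6: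
  fixes x :: 6
  shows "x = 1 \<or> x = 2 \<or> x = 3 \<or> x = 4 \<or> x = 5 \<or> x = 6"
proof (induct x)
  case (of_int z)
  then have "z = 0 \<or> z = 1 \<or> z = 2 \<or> z = 3 \<or> z = 4 \<or> z = 5" by fastforce
  then show ?case by auto
qed

lemma forall_6: "(\<forall>i::6. P i) \<longleftrightarrow> P 1 \<and> P 2 \<and> P 3 \<and> P 4 \<and> P 5 \<and> P 6"
  by (metis exhaust_6)

lemma UNIV_6: "UNIV = {1, 2, 3, 4, 5, 6::6}"
  using exhaust_6 by auto

lemma sum_6: "sum f (UNIV::6 set) = f 1 + f 2 + f 3 + f 4 + f 5 + f 6"
  unfolding UNIV_6 by (simp add: ac_simps)

lemma vector_6 [simp]:
  fixes x :: "'a::zero"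
  shows "(vector [x, y, z, w, u, v] :: 'a^6) $ 1 = x"
    and "(vector [x, y, z, w, u, v] :: 'a^6) $ 2 = y"
    and "(vector [x, y, z, w, u, v] :: 'a^6) $ 3 = z"
    and "(vector [x, y, z, w, u, v] :: 'a^6) $ 4 = w"
    and "(vector [x, y, z, w, u, v] :: 'a^6) $ 5 = u"
    and "(vector [x, y, z, w, u, v] :: 'a^6) $ 6 = v"
  by (simp_all add: vector_def)

lemma vector_4 [simp]:
  fixes x :: "'a::zero"
  shows "(vector [x, y, z, w] :: 'a^4) $ 1 = x"
    and "(vector [x, y, z, w] :: 'a^4) $ 2 = y"
    and "(vector [x, y, z, w] :: 'a^4) $ 3 = z"
    and "(vector [x, y, z, w] :: 'a^4) $ 4 = w"
  by (simp_all add: vector_def)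

definition bilin :: "(complex^3 \<Rightarrow> complex^3 \<Rightarrow> complex) \<Rightarrow> bool" where
  "bilin F \<longleftrightarrow> (\<forall>x x' y. F (x + x') y = F x y + F x' y) \<and> (\<forall>k x y. F (k *s x) y = k * F x y) \<and>
     (\<forall>x y y'. F x (y + y') = F x y + F x y') \<and> (\<forall>k x y. F x (k *s y) = k * F x y)"

lemma bilinD:
  assumes "bilin F"
  shows "F (x + x') y = F x y + F x' y" "F (k *s x) y = k * F x y"
    "F x (y + y') = F x y + F x y'" "F x (k *s y) = k * F x y"
    "F 0 y = 0" "F x 0 = 0"
proof -
  show "F (x + x') y = F x y + F x' y" "F (k *s x) y = k * F x y"
    "F x (y + y') = F x y + F x y'" "F x (k *s y) = k * F x y"
    using assms by (simp_all add: bilin_def)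
  have "F (0 *s 0) y = 0 * F 0 y" "F x (0 *s 0) = 0 * F x 0"
    using assms unfolding bilin_def by blast+
  then show "F 0 y = 0" "F x 0 = 0" by simp_all
qed

lemma bilin_expand_left:
  assumes "bilin F"
  shows "F x y = x $ 1 * F (axis 1 1) y + x $ 2 * F (axis 2 1) y + x $ 3 * F (axis 3 1) y"
proof -
  have "x = x $ 1 *s axis 1 1 + x $ 2 *s axis 2 1 + x $ 3 *s axis 3 1"
    using basis_expansion[of x] by (simp add: sum_3)
  then show ?thesis using bilinD(1,2)[OF assms] by metis
qed

lemma bilin_expand_right:
  assumes "bilin F"
  shows "F x y = y $ 1 * F x (axis 1 1) + y $ 2 * F x (axis 2 1) + y $ 3 * F x (axis 3 1)"
proof -
  have "y = y $ 1 *s axis 1 1 + y $ 2 *s axis 2 1 + y $ 3 *s axis 3 1"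
    using basis_expansion[of y] by (simp add: sum_3)
  then show ?thesis using bilinD(3,4)[OF assms] by metis
qed

abbreviation fform_matrix :: "complex^4^3 \<Rightarrow> complex^4^3 \<Rightarrow> complex^3 \<Rightarrow> complex^3 \<Rightarrow> complex^6^6" where
  "fform_matrix A B x y \<equiv> vector
       [vector [A$1$1, A$1$2, A$1$3, A$1$4, x$1, 0],
        vector [A$2$1, A$2$2, A$2$3, A$2$4, x$2, 0],
        vector [A$3$1, A$3$2, A$3$3, A$3$4, x$3, 0],
        vector [B$1$1, B$1$2, B$1$3, B$1$4, 0, y$1],
        vector [B$2$1, B$2$2, B$2$3, B$2$4, 0, y$2],
        vector [B$3$1, B$3$2, B$3$3, B$3$4, 0, y$3]]"

lemma fundamental_form_det: "fundamental_form P1 P2 x y = det (fform_matrix (cmat P1) (cmat P2) x y)"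
  by (simp add: fundamental_form_def Let_def)

text \<open>In the transposed matrix \<open>x\<close> and \<open>y\<close> fill one row each, and
  the determinant is linear in each row.\<close>

lemma bilin_fundamental_form: "bilin (fundamental_form P1 P2)"
proof -
  let ?A = "cmat P1" and ?B = "cmat P2"
  let ?C = "\<lambda>j::6. column j (fform_matrix ?A ?B 0 0)"
  let ?X = "\<lambda>x::complex^3. vector [x$1, x$2, x$3, 0, 0, 0] :: complex^6"
  let ?Y = "\<lambda>y::complex^3. vector [0, 0, 0, y$1, y$2, y$3] :: complex^6"
  \<comment> \<open>Two displays of the same matrix: the row rules for determinants need the varying
    row in the outermost \<open>if\<close>.\<close>
  have T5: "transpose (fform_matrix ?A ?B x y) = (\<chi> j. if j = 5 then ?X x else if j = 6 then ?Y y else ?C j)" for x y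
    by (simp add: vec_eq_iff forall_6 transpose_def column_def)
  have T6: "transpose (fform_matrix ?A ?B x y) = (\<chi> j. if j = 6 then ?Y y else if j = 5 then ?X x else ?C j)" for x y
    by (simp add: vec_eq_iff forall_6 transpose_def column_def)
  have D5: "fundamental_form P1 P2 x y = det (\<chi> j. if j = 5 then ?X x else if j = 6 then ?Y y else ?C j)" for x y
    unfolding fundamental_form_det T5[symmetric] det_transpose ..
  have D6: "fundamental_form P1 P2 x y = det (\<chi> j. if j = 6 then ?Y y else if j = 5 then ?X x else ?C j)" for x y
    unfolding fundamental_form_det T6[symmetric] det_transpose ..
  have X: "?X (x + x') = ?X x + ?X x'" "?X (k *s x) = k *s ?X x" for x x' k
    by (simp_all add: vec_eq_iff forall_6)
  have Y: "?Y (x + x') = ?Y x + ?Y x'" "?Y (k *s x) = k *s ?Y x" for x x' k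
    by (simp_all add: vec_eq_iff forall_6)
  show ?thesis
    unfolding bilin_def
  proof (intro conjI allI)
    show "fundamental_form P1 P2 (x + x') y = fundamental_form P1 P2 x y + fundamental_form P1 P2 x' y" for x x' y
      unfolding D5 X by (rule det_row_add)
    show "fundamental_form P1 P2 (k *s x) y = k * fundamental_form P1 P2 x y" for k x y
      unfolding D5 X by (rule det_row_mul)
    show "fundamental_form P1 P2 x (y + y') = fundamental_form P1 P2 x y + fundamental_form P1 P2 x y'" for x y y'
      unfolding D6 Y by (rule det_row_add)
    show "fundamental_form P1 P2 x (k *s y) = k * fundamental_form P1 P2 x y" for k x y
      unfolding D6 Y by (rule det_row_mul)
  qed
qed

lemma det_in_Reals:
  fixes A :: "complex^'n^'n"
  assumes "\<And>i j. A $ i $ j \<in> \<real>"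
  shows "det A \<in> \<real>"
  unfolding det_def by (intro sum_in_Reals prod_in_Reals Reals_mult assms) auto

lemma fundamental_form_axis_real: "fundamental_form P1 P2 (axis i 1) (axis j 1) \<in> \<real>"
  unfolding fundamental_form_det
proof (rule det_in_Reals)
  fix k l
  have "\<forall>k l. fform_matrix (cmat P1) (cmat P2) (axis i 1) (axis j 1) $ k $ l \<in> \<real>"
    by (simp add: forall_6 cmat_def map_matrix_def axis_def)
  then show "fform_matrix (cmat P1) (cmat P2) (axis i 1) (axis j 1) $ k $ l \<in> \<real>" by blast
qed

lemma fundamental_form_rows:
  obtains G :: "real^3^3" where
    "\<And>x y. fundamental_form P1 P2 x y = (\<Sum>i\<in>UNIV. x $ i * dotc (G $ i) y)"
proof -
  let ?G = "(\<chi> i j. Re (fundamental_form P1 P2 (axis i 1) (axis j 1))) :: real^3^3"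
  have "complex_of_real (?G $ i $ j) = fundamental_form P1 P2 (axis i 1) (axis j 1)" for i j
    using fundamental_form_axis_real[of P1 P2 i j] by simp
  then have "fundamental_form P1 P2 x y = (\<Sum>i\<in>UNIV. x $ i * dotc (?G $ i) y)" for x y
    unfolding dotc_def sum_3
    by (subst bilin_expand_left[OF bilin_fundamental_form])
       (simp add: bilin_expand_right[OF bilin_fundamental_form, of P1 P2 _ y] algebra_simps)
  then show ?thesis using that by blast
qed

text \<open>The right-hand side describes a kernel vector \<open>(v, - s, - t)\<close> of the
  matrix. For nonzero \<open>x\<close> and \<open>y\<close> it says that the rays back-projected
  from them share the point \<open>v\<close>; a scalar is zero when \<open>v\<close> is the
  corresponding center.\<close>

lemma fundamental_form_eq_0_iff:
  "fundamental_form P1 P2 x y = 0 \<longleftrightarrow>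
     (\<exists>v s t. (v \<noteq> 0 \<or> s \<noteq> 0 \<or> t \<noteq> 0) \<and> cmat P1 *v v = s *s x \<and> cmat P2 *v v = t *s y)"
proof -
  let ?M = "fform_matrix (cmat P1) (cmat P2) x y"
  have mult: "?M *v w = 0 \<longleftrightarrow>
      cmat P1 *v vector [w$1, w$2, w$3, w$4] = (- (w $ 5)) *s x \<and>
      cmat P2 *v vector [w$1, w$2, w$3, w$4] = (- (w $ 6)) *s y" for w :: "complex^6"
    by (simp add: vec_eq_iff forall_6 forall_3 matrix_vector_mult_def sum_6 sum_4 eq_neg_iff_add_eq_0 ac_simps)
  have "fundamental_form P1 P2 x y = 0 \<longleftrightarrow> (\<exists>w. w \<noteq> 0 \<and> ?M *v w = 0)"
    unfolding fundamental_form_det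
    using invertible_det_nz[of ?M] matrix_left_invertible_ker[of ?M] invertible_left_inverse[of ?M] by blast
  also have "\<dots> \<longleftrightarrow> (\<exists>v s t. (v \<noteq> 0 \<or> s \<noteq> 0 \<or> t \<noteq> 0) \<and> cmat P1 *v v = s *s x \<and> cmat P2 *v v = t *s y)"
  proof
    assume "\<exists>w. w \<noteq> 0 \<and> ?M *v w = 0"
    then obtain w where w: "w \<noteq> 0" "?M *v w = 0" by blast
    have "(vector [w$1, w$2, w$3, w$4] :: complex^4) \<noteq> 0 \<or> - (w $ 5) \<noteq> 0 \<or> - (w $ 6) \<noteq> 0"
      using w(1) by (auto simp: vec_eq_iff forall_6 forall_4)
    then show "\<exists>v s t. (v \<noteq> 0 \<or> s \<noteq> 0 \<or> t \<noteq> 0) \<and> cmat P1 *v v = s *s x \<and> cmat P2 *v v = t *s y"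
      using w(2) unfolding mult by blast
  next
    assume "\<exists>v s t. (v \<noteq> 0 \<or> s \<noteq> 0 \<or> t \<noteq> 0) \<and> cmat P1 *v v = s *s x \<and> cmat P2 *v v = t *s y"
    then obtain v s t where h: "v \<noteq> 0 \<or> s \<noteq> 0 \<or> t \<noteq> 0" "cmat P1 *v v = s *s x" "cmat P2 *v v = t *s y"
      by blast
    let ?w = "vector [v$1, v$2, v$3, v$4, -s, -t] :: complex^6"
    have v: "(vector [v$1, v$2, v$3, v$4] :: complex^4) = v" by (simp add: vec_eq_iff forall_4)
    have "?w \<noteq> 0" using h(1) by (auto simp: vec_eq_iff forall_6 forall_4)
    moreover have "?M *v ?w = 0" unfolding mult using h by (simp add: v)
    ultimately show "\<exists>w. w \<noteq> 0 \<and> ?M *v w = 0" by blast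
  qed
  finally show ?thesis .
qed

section \<open>Cameras and their centers\<close>

lemma other_two_indices:
  fixes k :: 3
  obtains i j where "i \<noteq> k" "j \<noteq> k" "i \<noteq> j" "UNIV = {i, j, k}"
proof -
  consider "k = 1" | "k = 2" | "k = 3" using exhaust_3[of k] by blast
  then show ?thesis
  proof cases
    case 1
    have "UNIV = {2, 3, k}" unfolding 1 UNIV_3 by blast
    moreover have "2 \<noteq> k" "3 \<noteq> k" "2 \<noteq> (3 :: 3)" unfolding 1 by simp_all
    ultimately show ?thesis using that by blast
  next
    case 2
    have "UNIV = {1, 3, k}" unfolding 2 UNIV_3 by blast
    moreover have "1 \<noteq> k" "3 \<noteq> k" "1 \<noteq> (3 :: 3)" unfolding 2 by simp_all
    ultimately show ?thesis using that by blast
  next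
    case 3
    have "UNIV = {1, 2, k}" unfolding 3 UNIV_3 by blast
    moreover have "1 \<noteq> k" "2 \<noteq> k" "1 \<noteq> (2 :: 3)" unfolding 3 by simp_all
    ultimately show ?thesis using that by blast
  qed
qed

text \<open>A real representative of the center, which itself is a complex subspace. It lets
  conditions on the centers be expressed over the reals.\<close>

definition kernel_vector :: "real^4^3 \<Rightarrow> real^4 \<Rightarrow> bool" where
  "kernel_vector P u \<longleftrightarrow> u \<noteq> 0 \<and> P *v u = 0"

lemma camera_surj: "camera P \<longleftrightarrow> surj ((*v) P)"
  unfolding camera_def using full_rank_surjective[of P] by simp

lemma kernel_vector_exists:
  assumes "camera P"
  obtains u where "kernel_vector P u"
  using matrix_nonfull_linear_equations_eq[of P] assms
  by (auto simp: camera_def kernel_vector_def)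

text \<open>The row space of the camera lies in the hyperplane orthogonal to \<open>u\<close>, and
  both have dimension 3. So every form vanishing at the center is a pullback from the image
  plane.\<close>

lemma camera_functional:
  assumes "camera P" and "kernel_vector P u" and "l \<bullet> u = 0"
  obtains c where "l = transpose P *v c"
proof -
  let ?R = "range ((*v) (transpose P))"
  have lin: "linear ((*v) (transpose P))" by simp
  have sub: "?R \<subseteq> {x. u \<bullet> x = 0}"
  proof clarify
    fix c
    have "u \<bullet> (transpose P *v c) = (P *v u) \<bullet> c" by (metis dot_lmul_matrix inner_commute transpose_matrix_vector)
    then show "u \<bullet> (transpose P *v c) = 0" using assms(2) by (simp add: kernel_vector_def)
  qed
  have "rank (transpose P) = 3" using assms(1) by (simp add: camera_def rank_transpose)
  then have "dim ?R = 3" by (simp add: rank_dim_range)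
  moreover have "dim {x. u \<bullet> x = 0} = 3"
    using dim_hyperplane[of u] assms(2) by (simp add: kernel_vector_def)
  moreover have "subspace ?R" by (rule linear_subspace_image[OF lin subspace_UNIV])
  moreover have "subspace {x. u \<bullet> x = 0}" by (rule subspace_hyperplane)
  ultimately have "?R = {x. u \<bullet> x = 0}"
    using sub by (intro subspace_dim_equal) auto
  then have "l \<in> ?R" using assms(3) by (simp add: inner_commute)
  then show ?thesis using that by blast
qed

text \<open>After removal of its component along \<open>u\<close>, the vector lies in the row space
  as well as in the kernel, so it is orthogonal to itself.\<close>

lemma camera_kernel:
  assumes "camera P" and "kernel_vector P u" and "P *v v = 0"
  obtains k where "v = k *\<^sub>R u"
proof -
  have u: "u \<noteq> 0" using assms(2) by (simp add: kernel_vector_def)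
  define l where "l = v - ((v \<bullet> u) / (u \<bullet> u)) *\<^sub>R u"
  have "l \<bullet> u = 0" using u by (simp add: l_def inner_diff_left)
  then obtain c where c: "l = transpose P *v c"
    using camera_functional[OF assms(1,2)] by blast
  have "P *v l = 0"
    using assms(2,3) by (simp add: l_def matrix_vector_mult_diff_distrib matrix_vector_mult_scaleR kernel_vector_def)
  then have "l \<bullet> l = 0"
    by (metis c dot_lmul_matrix inner_commute inner_zero_left transpose_transpose vector_transpose_matrix)
  then have "v = ((v \<bullet> u) / (u \<bullet> u)) *\<^sub>R u" by (simp add: l_def)
  then show ?thesis using that by blast
qed

lemma camera_kernel_complex:
  assumes "camera P" and "kernel_vector P u" and "cmat P *v v = 0"
  obtains k where "v = k *s cvec u"
proof -
  obtain a b where "re_vec v = a *\<^sub>R u" "im_vec v = b *\<^sub>R u"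
    using camera_kernel[OF assms(1,2)] assms(3) unfolding cmat_eq_0_iff by metis
  then have "v = (complex_of_real a + \<i> * complex_of_real b) *s cvec u"
    by (subst complex_vec_split) (simp add: cvec_scale vec.scale_left_distrib)
  then show ?thesis using that by blast
qed

lemma center_kernel_vector:
  assumes "camera P" and "kernel_vector P u"
  shows "center P = range (\<lambda>k. k *s cvec u)"
proof (rule set_eqI)
  fix v
  show "v \<in> center P \<longleftrightarrow> v \<in> range (\<lambda>k. k *s cvec u)"
    using camera_kernel_complex[OF assms, of v] assms(2)
    by (auto simp: center_def kernel_vector_def matrix_vector_mult_scaleR cmat_cvec vec.scale)
qed

lemma camera_surj_complex:
  assumes "camera P"
  obtains v where "cmat P *v v = a"
proof -
  obtain x y where "P *v x = re_vec a" "P *v y = im_vec a"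
    using assms unfolding camera_surj by (metis surjD)
  then have "cmat P *v (cvec x + \<i> *s cvec y) = a"
    by (subst (3) complex_vec_split) (simp add: vec.add vec.scale cmat_cvec)
  then show ?thesis using that by blast
qed

lemma kernel_vectors_indep:
  assumes "camera P1" "camera P2" "kernel_vector P1 u1" "kernel_vector P2 u2" "center P1 \<noteq> center P2"
  shows "indep2 u1 u2"
proof (rule ccontr)
  assume "\<not> indep2 u1 u2"
  then obtain k where k: "u2 = k *\<^sub>R u1"
    using not_indep2E assms(3) unfolding kernel_vector_def by metis
  then have "k \<noteq> 0" using assms(4) by (auto simp: kernel_vector_def)
  have "range (\<lambda>a. a *s cvec u2) = range (\<lambda>a. a *s cvec u1)"
  proof safe
    fix a
    have "a *s cvec u2 = (a * complex_of_real k) *s cvec u1" by (simp add: k cvec_scale)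
    then show "a *s cvec u2 \<in> range (\<lambda>a. a *s cvec u1)" by blast
    have "a *s cvec u1 = (a / complex_of_real k) *s cvec u2" using \<open>k \<noteq> 0\<close> by (simp add: k cvec_scale)
    then show "a *s cvec u1 \<in> range (\<lambda>a. a *s cvec u2)" by blast
  qed
  then show False using assms by (simp add: center_kernel_vector)
qed

text \<open>The kernel vectors are parameters so that distinctness of the centers becomes the real
  condition \<open>indep\<close>.\<close>

locale camera_pair =
  fixes P1 P2 :: "real^4^3" and u1 u2 :: "real^4"
  assumes camera1: "camera P1" and camera2: "camera P2"
    and kernel1: "kernel_vector P1 u1" and kernel2: "kernel_vector P2 u2"
    and indep: "indep2 u1 u2"
begin

lemma u1_nonzero: "u1 \<noteq> 0" and u2_nonzero: "u2 \<noteq> 0"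
  using indep2_nonzero[OF indep] by auto

lemma P1_u1: "P1 *v u1 = 0" and P2_u2: "P2 *v u2 = 0"
  using kernel1 kernel2 by (simp_all add: kernel_vector_def)

lemma cP1_u1: "cmat P1 *v cvec u1 = 0" and cP2_u2: "cmat P2 *v cvec u2 = 0"
  by (simp_all add: cmat_cvec P1_u1 P2_u2)

lemma P1_u2: "P1 *v u2 \<noteq> 0"
proof
  assume "P1 *v u2 = 0"
  then obtain k where "u2 = k *\<^sub>R u1" by (rule camera_kernel[OF camera1 kernel1])
  then have "k *\<^sub>R u1 + (-1) *\<^sub>R u2 = 0" by simp
  then show False using indep2D(2)[OF indep] by fastforce
qed

lemma joint_kernel_trivial:
  assumes "cmat P1 *v v = 0" "cmat P2 *v v = 0"
  shows "v = 0"
proof -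
  obtain k where k: "v = k *s cvec u1" using camera_kernel_complex[OF camera1 kernel1 assms(1)] .
  obtain m where m: "v = m *s cvec u2" using camera_kernel_complex[OF camera2 kernel2 assms(2)] .
  obtain b f where b: "dual_bases b f" "b 1 = u1" "b 2 = u2"
    using dual_bases_extend_two[OF indep] .
  have "dotc (f 1) v = k" using dual_basesD[OF b(1), of 1 1] b(2) by (simp add: k)
  moreover have "dotc (f 1) v = 0" using dual_basesD[OF b(1), of 1 2] b(3) by (simp add: m)
  ultimately have "k = 0" by simp
  then show ?thesis by (simp add: k)
qed

text \<open>The left kernel is the epipole, the image of the second center in the first picture. For
  nonzero \<open>x\<close> the second camera maps the ray over \<open>x\<close> into a span of
  dimension at most 2; a \<open>y\<close> outside it forces the common point of the rays to be the
  second center.\<close>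

lemma fundamental_form_left_kernel:
  "(\<forall>y. fundamental_form P1 P2 x y = 0) \<longleftrightarrow> (\<exists>k. x = k *s cvec (P1 *v u2))"
proof
  assume "\<exists>k. x = k *s cvec (P1 *v u2)"
  then obtain k where k: "x = k *s cvec (P1 *v u2)" by blast
  have "fundamental_form P1 P2 (cvec (P1 *v u2)) y = 0" for y
    unfolding fundamental_form_eq_0_iff
    by (rule exI[of _ "cvec u2"], rule exI[of _ 1], rule exI[of _ 0])
       (simp add: cmat_cvec P2_u2)
  then show "\<forall>y. fundamental_form P1 P2 x y = 0"
    by (simp add: k bilinD(2)[OF bilin_fundamental_form])
next
  assume F: "\<forall>y. fundamental_form P1 P2 x y = 0"
  show "\<exists>k. x = k *s cvec (P1 *v u2)"
  proof (cases "x = 0")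
    case True
    then show ?thesis by (intro exI[of _ 0]) simp
  next
    case False
    obtain v0 where v0: "cmat P1 *v v0 = x" using camera_surj_complex[OF camera1] .
    let ?B = "{cmat P2 *v cvec u1, cmat P2 *v v0}"
    have "vec.dim ?B \<le> card ?B" by (rule vec.dim_le_card') simp
    also have "\<dots> \<le> 2" by (simp add: card_insert_if)
    finally have "vec.dim (vec.span ?B) < vec.dim (UNIV :: (complex^3) set)"
      unfolding vec_dim_card vec.dim_span by simp
    then have "vec.span ?B \<noteq> UNIV" by (metis less_irrefl)
    then obtain y where y: "y \<notin> vec.span ?B" by blast
    have "fundamental_form P1 P2 x y = 0" using F ..
    then obtain v s t where h: "v \<noteq> 0 \<or> s \<noteq> 0 \<or> t \<noteq> 0"
        "cmat P1 *v v = s *s x" "cmat P2 *v v = t *s y"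
      unfolding fundamental_form_eq_0_iff by blast
    have "cmat P1 *v (v - s *s v0) = 0" 
      unfolding matrix_vector_mult_diff_distrib vector_scalar_commute h(2) v0 by simp
    then obtain k where k: "v - s *s v0 = k *s cvec u1"
      by (rule camera_kernel_complex[OF camera1 kernel1])
    then have "v = k *s cvec u1 + s *s v0" by (metis diff_add_cancel)
    then have "t *s y = k *s (cmat P2 *v cvec u1) + s *s (cmat P2 *v v0)"
      using h(3) by (simp add: vec.add vec.scale)
    also have "\<dots> \<in> vec.span ?B"
      by (intro vec.span_add vec.span_scale) (auto intro: vec.span_base)
    finally have ty: "t *s y \<in> vec.span ?B" .
    have t: "t = 0"
    proof (rule ccontr)
      assume "t \<noteq> 0"
      moreover have "(1/t) *s (t *s y) \<in> vec.span ?B" using ty by (rule vec.span_scale)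
      ultimately show False using y by simp
    qed
    then have P2v: "cmat P2 *v v = 0" using h(3) by simp
    then obtain m where m: "v = m *s cvec u2" by (rule camera_kernel_complex[OF camera2 kernel2])
    have s: "s \<noteq> 0"
    proof
      assume "s = 0"
      then have "v = 0" using h(2) P2v by (intro joint_kernel_trivial) simp_all
      then show False using h(1) t \<open>s = 0\<close> by simp
    qed
    have "s *s x = m *s cvec (P1 *v u2)" using h(2) by (simp add: m vec.scale cmat_cvec)
    then have "(1/s) *s (s *s x) = (1/s) *s (m *s cvec (P1 *v u2))" by simp
    then have "x = (m / s) *s cvec (P1 *v u2)" using s by simp
    then show ?thesis by blast
  qed
qed

lemma fundamental_form_vanishes: "fundamental_form P1 P2 (cmat P1 *v v) (cmat P2 *v v) = 0"
proof (cases "v = 0")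
  case True
  then show ?thesis using bilinD(5)[OF bilin_fundamental_form] by simp
next
  case False
  then show ?thesis unfolding fundamental_form_eq_0_iff by (metis vec.scale_one)
qed

text \<open>Otherwise every \<open>x\<close> would lie in the left kernel, which is at most
  one-dimensional.\<close>

lemma fundamental_form_nonzero: "\<exists>x y. fundamental_form P1 P2 x y \<noteq> 0"
proof (rule ccontr)
  assume "\<not> ?thesis"
  then have F: "\<exists>k. x = k *s cvec (P1 *v u2)" for x
    using fundamental_form_left_kernel by blast
  have "UNIV \<subseteq> vec.span {cvec (P1 *v u2)}"
    using F by (auto simp: vec.span_singleton)
  then have "vec.dim (UNIV :: (complex^3) set) \<le> card {cvec (P1 *v u2)}"
    by (intro vec.dim_le_card) simp_all
  then show False unfolding vec_dim_card by simp
qed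

text \<open>The epipole \<open>a\<close> is a linear relation between the rows of the matrix of the
  form. Solving it for a row \<open>k\<close> with \<open>a $ k\<close> nonzero leaves two terms,
  and the left kernel has no room for a second relation.\<close>

lemma fundamental_form_rank2:
  obtains c1 c2 d1 d2 where "indep2 c1 c2" "indep2 d1 d2"
    "\<And>x y. fundamental_form P1 P2 x y = dotc c1 x * dotc d1 y + dotc c2 x * dotc d2 y"
proof -
  obtain G :: "real^3^3" where G: "\<And>x y. fundamental_form P1 P2 x y = (\<Sum>i\<in>UNIV. x $ i * dotc (G $ i) y)"
    using fundamental_form_rows by blast
  define a where "a = P1 *v u2"
  obtain k where k: "a $ k \<noteq> 0" using P1_u2 by (auto simp: a_def vec_eq_iff)
  obtain i j where ij: "i \<noteq> k" "j \<noteq> k" "i \<noteq> j" and U: "(UNIV :: 3 set) = {i, j, k}"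
    by (rule other_two_indices)
  have sum: "sum g UNIV = g i + g j + g k" for g :: "3 \<Rightarrow> complex" using ij by (simp add: U)
  \<comment> \<open>The coefficient of \<open>G $ m\<close> once \<open>G $ k\<close> has been
    eliminated by means of the relation \<open>aG\<close>.\<close>
  define c where "c = (\<lambda>m. axis m 1 - (a $ m / a $ k) *\<^sub>R axis k (1::real))"
  have aG: "complex_of_real (a $ i) * dotc (G $ i) y + complex_of_real (a $ j) * dotc (G $ j) y
      + complex_of_real (a $ k) * dotc (G $ k) y = 0" for y
  proof -
    have "fundamental_form P1 P2 (cvec a) y = 0"
      using fundamental_form_left_kernel[of "cvec a"] unfolding a_def by (metis vec.scale_one)
    then show ?thesis unfolding G sum by (simp add: cvec_def)
  qed
  have form: "fundamental_form P1 P2 x y = dotc (c i) x * dotc (G $ i) y + dotc (c j) x * dotc (G $ j) y" for x y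
  proof -
    have gk: "dotc (G $ k) y = - (complex_of_real (a $ i) * dotc (G $ i) y + complex_of_real (a $ j) * dotc (G $ j) y)
        / complex_of_real (a $ k)"
    proof -
      have "complex_of_real (a $ k) * dotc (G $ k) y
          = - (complex_of_real (a $ i) * dotc (G $ i) y + complex_of_real (a $ j) * dotc (G $ j) y)"
        by (rule minus_unique[OF aG, symmetric])
      then show ?thesis using k by (metis nonzero_mult_div_cancel_left of_real_eq_0_iff)
    qed
    show ?thesis
      unfolding G sum gk c_def dotc_diff_left dotc_scale_left dotc_axis of_real_divide
      by (simp add: diff_divide_distrib add_divide_distrib algebra_simps)
  qed
  have "indep2 (c i) (c j)"
    unfolding indep2_def
  proof (intro allI impI)
    fix s t assume "s *\<^sub>R c i + t *\<^sub>R c j = 0"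
    then have "(s *\<^sub>R c i + t *\<^sub>R c j) $ i = 0" "(s *\<^sub>R c i + t *\<^sub>R c j) $ j = 0" by simp_all
    then show "s = 0 \<and> t = 0" using ij by (simp add: c_def axis_def)
  qed
  moreover have "indep2 (G $ i) (G $ j)"
    unfolding indep2_def
  proof (intro allI impI)
    fix s t assume e: "s *\<^sub>R G $ i + t *\<^sub>R G $ j = 0"
    \<comment> \<open>A relation between the two rows gives a left kernel vector whose entry
      \<open>k\<close> is zero; being a multiple of \<open>a\<close>, it vanishes.\<close>
    let ?x = "cvec (s *\<^sub>R axis i 1 + t *\<^sub>R axis j 1)"
    have x: "?x $ i = s" "?x $ j = t" "?x $ k = 0" using ij by (simp_all add: cvec_def axis_def)
    have "fundamental_form P1 P2 ?x y = dotc (s *\<^sub>R G $ i + t *\<^sub>R G $ j) y" for y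
      unfolding G sum x by (simp add: dotc_add_left dotc_scale_left)
    then have "\<forall>y. fundamental_form P1 P2 ?x y = 0" by (simp add: e)
    then obtain r where r: "?x = r *s cvec a" using fundamental_form_left_kernel a_def by blast
    then have "?x $ k = (r *s cvec a) $ k" by simp
    then have "r = 0" unfolding x using k by (simp add: cvec_def)
    then have "?x = 0" using r by simp
    then show "s = 0 \<and> t = 0" using x by simp
  qed
  ultimately show ?thesis using that form by blast
qed

text \<open>Such a form pulls back to an alternating form with \<open>u1\<close> and \<open>u2\<close> in its kernel, and these make up
  a one-dimensional space.\<close>

lemma vanishing_form_unique:
  assumes F: "bilin F" and G: "bilin G"
    and vF: "\<And>v. F (cmat P1 *v v) (cmat P2 *v v) = 0"
    and vG: "\<And>v. G (cmat P1 *v v) (cmat P2 *v v) = 0"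
    and nG: "\<exists>x y. G x y \<noteq> 0"
  obtains k where "\<And>x y. F x y = k * G x y"
proof -
  obtain b f where b: "dual_bases b f" "b 1 = u1" "b 2 = u2"
    using dual_bases_extend_two[OF indep] .
  let ?e = "\<lambda>i. cvec (b i)"
  have key: "H (cmat P1 *v v) (cmat P2 *v w) = (dotc (f 3) v * dotc (f 4) w - dotc (f 4) v * dotc (f 3) w)
      * H (cmat P1 *v ?e 3) (cmat P2 *v ?e 4)"
    if H: "bilin H" and vH: "\<And>v. H (cmat P1 *v v) (cmat P2 *v v) = 0" for H v w
  proof -
    define h where "h v w = H (cmat P1 *v v) (cmat P2 *v w)" for v w
    have h: "h (v + v') w = h v w + h v' w" "h v (w + w') = h v w + h v w'"
      "h (k *s v) w = k * h v w" "h v (k *s w) = k * h v w" for v v' w w' k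
      by (simp_all add: h_def vec.add vec.scale bilinD[OF H])
    have alt: "h v w = - h w v" for v w
    proof -
      have "h (v + w) (v + w) = 0" "h v v = 0" "h w w = 0" unfolding h_def by (rule vH)+
      then show ?thesis by (simp add: h eq_neg_iff_add_eq_0 add.commute)
    qed
    have z1: "h (?e 1) w = 0" for w by (simp add: h_def b cP1_u1 bilinD(5)[OF H])
    have z2: "h w (?e 2) = 0" for w by (simp add: h_def b cP2_u2 bilinD(6)[OF H])
    have z3: "h w (?e 1) = 0" "h (?e 2) w = 0" for w using alt[of w "?e 1"] alt[of "?e 2" w] z1 z2 by simp_all
    have z4: "h (?e 3) (?e 3) = 0" "h (?e 4) (?e 4) = 0" unfolding h_def by (rule vH)+
    have "h v w = h (\<Sum>i\<in>UNIV. dotc (f i) v *s ?e i) (\<Sum>i\<in>UNIV. dotc (f i) w *s ?e i)"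
      using dual_bases_expand_dotc[OF b(1)] by metis
    also have "\<dots> = (dotc (f 3) v * dotc (f 4) w - dotc (f 4) v * dotc (f 3) w) * h (?e 3) (?e 4)"
      by (simp add: sum_4 h z1 z2 z3 z4 alt[of "?e 4" "?e 3"] algebra_simps)
    finally show ?thesis by (simp add: h_def)
  qed
  let ?g = "G (cmat P1 *v ?e 3) (cmat P2 *v ?e 4)"
  have "?g \<noteq> 0"
  proof
    assume g: "?g = 0"
    obtain x y where xy: "G x y \<noteq> 0" using nG by blast
    obtain v w where "cmat P1 *v v = x" "cmat P2 *v w = y"
      using camera_surj_complex camera1 camera2 by metis
    then have "G x y = 0" using key[OF G vG, of v w] g by simp
    then show False using xy by simp
  qed
  have "F x y = (F (cmat P1 *v ?e 3) (cmat P2 *v ?e 4) / ?g) * G x y" for x y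
  proof -
    obtain v w where vw: "cmat P1 *v v = x" "cmat P2 *v w = y"
      using camera_surj_complex camera1 camera2 by metis
    show ?thesis using key[OF F vF, of v w] key[OF G vG, of v w] \<open>?g \<noteq> 0\<close> unfolding vw by simp
  qed
  then show ?thesis using that by blast
qed

end

section \<open>The joint camera map on the blow-up\<close>

lemma vec_axis_inner: "axis i 1 \<bullet> (x :: real^'n) = x $ i"
  by (simp add: inner_axis inner_commute)

text \<open>\<open>Q\<close> is assembled from columns \<open>f i\<close> and rows
  \<open>a1, a2, a3\<close>, so that the basis \<open>u\<close> of forms on the image plane pulls
  back to these rows. The hypothesis \<open>surj\<close> expresses their independence.\<close>

lemma camera_with_rows:
  fixes u f :: "3 \<Rightarrow> real^3" and a1 a2 a3 :: "real^4"
  assumes dual: "dual_bases u f"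
    and surj: "\<And>r s t. \<exists>x. a1 \<bullet> x = r \<and> a2 \<bullet> x = s \<and> a3 \<bullet> x = t"
  obtains Q where "camera Q" "\<And>v. dotc (u 1) (cmat Q *v v) = dotc a1 v"
    "\<And>v. dotc (u 2) (cmat Q *v v) = dotc a2 v" "\<And>v. dotc (u 3) (cmat Q *v v) = dotc a3 v"
    "\<And>x. Q *v x = (a1 \<bullet> x) *\<^sub>R f 1 + (a2 \<bullet> x) *\<^sub>R f 2 + (a3 \<bullet> x) *\<^sub>R f 3"
proof -
  define Q :: "real^4^3" where "Q = (\<chi> i. f 1 $ i *\<^sub>R a1 + f 2 $ i *\<^sub>R a2 + f 3 $ i *\<^sub>R a3)"
  have Q: "Q *v x = (a1 \<bullet> x) *\<^sub>R f 1 + (a2 \<bullet> x) *\<^sub>R f 2 + (a3 \<bullet> x) *\<^sub>R f 3" for x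
    by (simp add: vec_eq_iff Q_def matrix_vector_mult_def inner_vec_def sum_4 algebra_simps)
  have tQ: "transpose Q *v c = (f 1 \<bullet> c) *\<^sub>R a1 + (f 2 \<bullet> c) *\<^sub>R a2 + (f 3 \<bullet> c) *\<^sub>R a3" for c
    by (simp add: vec_eq_iff Q_def matrix_vector_mult_def transpose_def inner_vec_def sum_3 algebra_simps)
  have "surj ((*v) Q)"
  proof (rule surjI)
    fix y
    let ?x = "SOME x. a1 \<bullet> x = u 1 \<bullet> y \<and> a2 \<bullet> x = u 2 \<bullet> y \<and> a3 \<bullet> x = u 3 \<bullet> y"
    have "a1 \<bullet> ?x = u 1 \<bullet> y \<and> a2 \<bullet> ?x = u 2 \<bullet> y \<and> a3 \<bullet> ?x = u 3 \<bullet> y"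
      using someI_ex[OF surj] .
    then show "Q *v ?x = y"
      using dual_bases_expand_functional[OF dual, of y] by (simp add: Q sum_3)
  qed
  then have "camera Q" by (simp add: camera_surj)
  moreover have "dotc (u 1) (cmat Q *v v) = dotc a1 v" "dotc (u 2) (cmat Q *v v) = dotc a2 v"
    "dotc (u 3) (cmat Q *v v) = dotc a3 v" for v
    unfolding dotc_transpose[symmetric] tQ by (simp_all add: dual_basesD[OF dual])
  ultimately show ?thesis using that Q by blast
qed

text \<open>In coordinates of space, \<open>c1, c2\<close> are made to pull back to
  \<open>x2, x3\<close> and \<open>d1, d2\<close> to \<open>x3, - x2\<close>, so the form becomes
  \<open>x2 x3 - x3 x2\<close>. The remaining rows \<open>x1\<close> and \<open>x4\<close> complete
  the cameras and put the centers at \<open>e4\<close> and \<open>e1\<close>.\<close>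

lemma cameras_with_form:
  assumes "indep2 c1 c2" and "indep2 d1 d2"
  obtains Q1 Q2 where "camera Q1" "camera Q2" "center Q1 \<noteq> center Q2"
    "\<And>v. dotc c1 (cmat Q1 *v v) * dotc d1 (cmat Q2 *v v)
        + dotc c2 (cmat Q1 *v v) * dotc d2 (cmat Q2 *v v) = 0"
proof -
  obtain u f where u: "dual_bases u f" "u 1 = c1" "u 2 = c2"
    using dual_bases_extend_two_3[OF assms(1)] .
  obtain w g where w: "dual_bases w g" "w 1 = d1" "w 2 = d2"
    using dual_bases_extend_two_3[OF assms(2)] .
  let ?e = "\<lambda>i::4. axis i (1::real)"
  have "\<exists>x::real^4. ?e 2 \<bullet> x = r \<and> ?e 3 \<bullet> x = s \<and> ?e 1 \<bullet> x = t" for r s t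
    by (rule exI[of _ "vector [t, r, s, 0]"]) (simp add: vec_axis_inner)
  from camera_with_rows[OF u(1) this]
  obtain Q1 where Q1: "camera Q1" "\<And>v. dotc (u 1) (cmat Q1 *v v) = dotc (?e 2) v"
    "\<And>v. dotc (u 2) (cmat Q1 *v v) = dotc (?e 3) v"
    "\<And>x. Q1 *v x = (?e 2 \<bullet> x) *\<^sub>R f 1 + (?e 3 \<bullet> x) *\<^sub>R f 2 + (?e 1 \<bullet> x) *\<^sub>R f 3" by metis
  have "\<exists>x::real^4. ?e 3 \<bullet> x = r \<and> (- ?e 2) \<bullet> x = s \<and> ?e 4 \<bullet> x = t" for r s t
    by (rule exI[of _ "vector [0, - s, r, t]"]) (simp add: vec_axis_inner inner_minus_left)
  from camera_with_rows[OF w(1) this]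
  obtain Q2 where Q2: "camera Q2" "\<And>v. dotc (w 1) (cmat Q2 *v v) = dotc (?e 3) v"
    "\<And>v. dotc (w 2) (cmat Q2 *v v) = dotc (- ?e 2) v"
    "\<And>v. dotc (w 3) (cmat Q2 *v v) = dotc (?e 4) v" by metis
  have "cvec (?e 4) \<in> center Q1"
    by (simp add: center_def cmat_cvec Q1(4) vec_axis_inner) (simp add: axis_def)
  moreover have "cvec (?e 4) \<notin> center Q2"
  proof
    assume "cvec (?e 4) \<in> center Q2"
    then have "cmat Q2 *v cvec (?e 4) = 0" by (simp add: center_def)
    then have "dotc (?e 4) (cvec (?e 4)) = 0" unfolding Q2(4)[symmetric] by simp
    then show False by (simp add: inner_axis_axis)
  qed
  ultimately have "center Q1 \<noteq> center Q2" by blast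
  moreover have "dotc c1 (cmat Q1 *v v) * dotc d1 (cmat Q2 *v v)
        + dotc c2 (cmat Q1 *v v) * dotc d2 (cmat Q2 *v v) = 0" for v
  proof -
    have "dotc (- ?e 2) v = - dotc (?e 2) v"
      using dotc_scale_left[of "-1" "?e 2" v] by simp
    then show ?thesis using Q1(2,3)[of v] Q2(2,3)[of v] by (simp add: u w)
  qed
  ultimately show ?thesis using that Q1(1) Q2(1) by blast
qed

section \<open>Projective points and lines in terms of spanning vectors, and their images under a
  camera\<close>

lemma span_pair_iff: "x \<in> vec.span {a, b} \<longleftrightarrow> (\<exists>s t. x = s *s a + t *s b)"
proof
  assume "x \<in> vec.span {a, b}"
  then obtain s where "x - s *s a \<in> vec.span {b}" by (auto simp: vec.span_breakdown_eq)
  then obtain t where "x - s *s a = t *s b" by (auto simp: vec.span_singleton)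
  then have "x = s *s a + t *s b" by (simp add: algebra_simps)
  then show "\<exists>s t. x = s *s a + t *s b" by blast
next
  assume "\<exists>s t. x = s *s a + t *s b"
  then show "x \<in> vec.span {a, b}"
    by (auto intro!: vec.span_add vec.span_scale intro: vec.span_base)
qed

lemma dim_span_pair:
  assumes "a \<noteq> 0" and "b \<notin> range (\<lambda>k. k *s a)"
  shows "vec.dim {b, a} = 2"
  using assms by (simp add: vec.dim_insert vec.span_singleton)

lemma span_pair_proj_line:
  assumes "a \<noteq> 0" and "b \<notin> range (\<lambda>k. k *s a)"
  shows "vec.span {a, b} \<in> proj_lines"
  using dim_span_pair[OF assms] by (simp add: proj_lines_def insert_commute)

lemma proj_line_coords:
  assumes L: "L \<in> proj_lines" and ab: "a \<in> L" "b \<in> L" "a \<noteq> 0" "b \<notin> range (\<lambda>k. k *s a)" and x: "x \<in> L"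
  obtains s t where "x = s *s a + t *s b"
proof -
  have "vec.span {a, b} \<subseteq> L"
    using L ab by (intro vec.span_minimal) (auto simp: proj_lines_def)
  then have "vec.span {a, b} = L"
    using L dim_span_pair[OF ab(3,4)]
    by (intro vec.subspace_dim_equal) (auto simp: proj_lines_def insert_commute)
  then show ?thesis using x that span_pair_iff by blast
qed

lemma proj_line_other_point:
  assumes L: "L \<in> proj_lines"
  obtains b where "b \<in> L" "b \<notin> range (\<lambda>k. k *s a)"
proof -
  have "\<not> L \<subseteq> range (\<lambda>k. k *s a)"
  proof
    assume "L \<subseteq> range (\<lambda>k. k *s a)"
    then have "vec.dim L \<le> card {a}"
      by (intro vec.dim_le_card) (auto simp: vec.span_singleton)
    then show False using L by (simp add: proj_lines_def)
  qed
  then show ?thesis using that by blast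
qed

lemma proj_line_scale: "L \<in> proj_lines \<Longrightarrow> v \<in> L \<Longrightarrow> k *s v \<in> L"
  by (auto simp: proj_lines_def intro: vec.subspace_scale)

lemma proj_line_add: "L \<in> proj_lines \<Longrightarrow> v \<in> L \<Longrightarrow> w \<in> L \<Longrightarrow> v + w \<in> L"
  by (auto simp: proj_lines_def intro: vec.subspace_add)

lemma proj_point_iff: "x \<in> proj_points \<longleftrightarrow> (\<exists>a. a \<noteq> 0 \<and> x = range (\<lambda>k. k *s a))"
proof
  assume x: "x \<in> proj_points"
  then have "\<not> x \<subseteq> {0}" using vec.dim_eq_0[of x] by (simp add: proj_points_def)
  then obtain a where a: "a \<in> x" "a \<noteq> 0" by blast
  have "vec.span {a} = x"
    using x a by (intro vec.subspace_dim_equal vec.span_minimal) (auto simp: proj_points_def)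
  then show "\<exists>a. a \<noteq> 0 \<and> x = range (\<lambda>k. k *s a)" using a by (auto simp: vec.span_singleton)
next
  assume "\<exists>a. a \<noteq> 0 \<and> x = range (\<lambda>k. k *s a)"
  then obtain a where a: "a \<noteq> 0" "x = vec.span {a}" by (auto simp: vec.span_singleton)
  then show "x \<in> proj_points" by (simp add: proj_points_def)
qed

lemma range_scale_self: "a \<in> range (\<lambda>k. k *s a)" for a :: "complex^'n"
  by (metis rangeI vec.scale_one)

lemma range_scale_eq:
  assumes "k \<noteq> (0 :: complex)"
  shows "range (\<lambda>m. m *s (k *s a)) = range (\<lambda>m. m *s a)"
proof safe
  fix m
  have "m *s (k *s a) = (m * k) *s a" by simp
  then show "m *s (k *s a) \<in> range (\<lambda>m. m *s a)" by blast
  have "m *s a = (m / k) *s (k *s a)" using assms by simp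
  then show "m *s a \<in> range (\<lambda>m. m *s (k *s a))" by blast
qed

text \<open>The center contributes nothing to the image, so the line becomes the point spanned by
  the image of any second point \<open>v\<close> on it.\<close>

lemma camera_line_image:
  assumes P: "camera P" "kernel_vector P u" and L: "L \<in> proj_lines" "center P \<subseteq> L"
  obtains v where "v \<in> L" "cmat P *v v \<noteq> 0" "(*v) (cmat P) ` L = range (\<lambda>k. k *s (cmat P *v v))"
    "\<And>x. x \<in> L \<Longrightarrow> \<exists>k. cmat P *v x = k *s (cmat P *v v)"
proof -
  have u: "cvec u \<in> L" "cvec u \<noteq> 0" "cmat P *v cvec u = 0"
    using L P by (auto simp: center_def cmat_cvec kernel_vector_def)
  obtain v where v: "v \<in> L" "v \<notin> range (\<lambda>k. k *s cvec u)"
    by (rule proj_line_other_point[OF L(1)])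
  have Pv: "cmat P *v v \<noteq> 0"
    using camera_kernel_complex[OF P, of v] v(2) by blast
  have coords: "\<exists>s t. x = s *s cvec u + t *s v" if "x \<in> L" for x
    using proj_line_coords[OF L(1) u(1) v(1) u(2) v(2) that] by blast
  have mult: "\<exists>k. cmat P *v x = k *s (cmat P *v v)" if x: "x \<in> L" for x
  proof -
    obtain s t where "x = s *s cvec u + t *s v" using coords[OF x] by blast
    then have "cmat P *v x = t *s (cmat P *v v)" by (simp add: vec.add vec.scale u)
    then show ?thesis by blast
  qed
  have "(*v) (cmat P) ` L = range (\<lambda>k. k *s (cmat P *v v))"
  proof
    show "(*v) (cmat P) ` L \<subseteq> range (\<lambda>k. k *s (cmat P *v v))"
      using mult by (auto simp: image_iff)
    have "k *s (cmat P *v v) \<in> (*v) (cmat P) ` L" for k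
    proof -
      have "k *s (cmat P *v v) = cmat P *v (k *s v)" by (simp add: vec.scale)
      then show ?thesis using proj_line_scale[OF L(1) v(1)] by blast
    qed
    then show "range (\<lambda>k. k *s (cmat P *v v)) \<subseteq> (*v) (cmat P) ` L" by blast
  qed
  then show ?thesis using that[OF v(1) Pv] mult by blast
qed

text \<open>This is the ray back-projected from the image point \<open>a\<close>, spanned by the
  center and any preimage of \<open>a\<close>.\<close>

lemma camera_line_preimage:
  assumes P: "camera P" "kernel_vector P u" and a: "a \<noteq> 0"
  defines "L \<equiv> {v. \<exists>k. cmat P *v v = k *s a}"
  shows "L \<in> proj_lines" "center P \<subseteq> L" "(*v) (cmat P) ` L = range (\<lambda>k. k *s a)"
proof -
  have u: "cvec u \<noteq> 0" "cmat P *v cvec u = 0"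
    using P by (auto simp: cmat_cvec kernel_vector_def)
  obtain v where v: "cmat P *v v = a" using camera_surj_complex[OF P(1)] .
  have "v \<notin> range (\<lambda>k. k *s cvec u)" using v a u(2) by (auto simp: vec.scale)
  moreover have "L = vec.span {cvec u, v}"
  proof (rule set_eqI)
    fix x
    show "x \<in> L \<longleftrightarrow> x \<in> vec.span {cvec u, v}"
      unfolding span_pair_iff
    proof
      assume "x \<in> L"
      then obtain k where "cmat P *v x = k *s a" by (auto simp: L_def)
      then have "cmat P *v (x - k *s v) = 0" by (simp add: vec.diff vec.scale v)
      then obtain m where "x - k *s v = m *s cvec u" by (rule camera_kernel_complex[OF P])
      then have "x = m *s cvec u + k *s v" by (metis diff_add_cancel)
      then show "\<exists>s t. x = s *s cvec u + t *s v" by blast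
    next
      assume "\<exists>s t. x = s *s cvec u + t *s v"
      then show "x \<in> L" by (auto simp: L_def vec.add vec.scale u v)
    qed
  qed
  ultimately show "L \<in> proj_lines" using span_pair_proj_line[OF u(1)] by simp
  show "center P \<subseteq> L"
  proof
    fix x assume "x \<in> center P"
    then have "cmat P *v x = 0 *s a" by (simp add: center_def)
    then show "x \<in> L" unfolding L_def by blast
  qed
  show "(*v) (cmat P) ` L = range (\<lambda>k. k *s a)"
  proof safe
    fix x assume "x \<in> L"
    then show "cmat P *v x \<in> range (\<lambda>k. k *s a)" by (auto simp: L_def)
  next
    fix k
    have "k *s a = cmat P *v (k *s v)" by (simp add: vec.scale v)
    moreover from this have "k *s v \<in> L" unfolding L_def by (intro CollectI exI[of _ k]) simp
    ultimately show "k *s a \<in> (*v) (cmat P) ` L" by blast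
  qed
qed

context camera_pair
begin

text \<open>The base point lies on both lines, so a nonzero vector in it serves as the common point
  of the two rays. At a center this still works, with one scalar equal to zero.\<close>

lemma joint_map_on_fundamental_form:
  assumes "(x, L1, L2) \<in> blowup (center P1) (center P2)"
    and "a \<in> (*v) (cmat P1) ` L1" and "b \<in> (*v) (cmat P2) ` L2"
  shows "fundamental_form P1 P2 a b = 0"
proof -
  have x: "x \<in> proj_points" "x \<subseteq> L1" "x \<subseteq> L2"
    and L1: "L1 \<in> proj_lines" "center P1 \<subseteq> L1" and L2: "L2 \<in> proj_lines" "center P2 \<subseteq> L2"
    using assms(1) by (auto simp: blowup_def)
  obtain v where v: "v \<noteq> 0" "v \<in> x"
    using x(1) range_scale_self unfolding proj_point_iff by blast
  obtain v1 where v1: "(*v) (cmat P1) ` L1 = range (\<lambda>k. k *s (cmat P1 *v v1))"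
    and m1: "\<And>x. x \<in> L1 \<Longrightarrow> \<exists>k. cmat P1 *v x = k *s (cmat P1 *v v1)"
    by (rule camera_line_image[OF camera1 kernel1 L1]) blast
  obtain v2 where v2: "(*v) (cmat P2) ` L2 = range (\<lambda>k. k *s (cmat P2 *v v2))"
    and m2: "\<And>x. x \<in> L2 \<Longrightarrow> \<exists>k. cmat P2 *v x = k *s (cmat P2 *v v2)"
    by (rule camera_line_image[OF camera2 kernel2 L2]) blast
  let ?a = "cmat P1 *v v1" and ?b = "cmat P2 *v v2"
  obtain s where s: "cmat P1 *v v = s *s ?a" using m1[of v] v x by blast
  obtain t where t: "cmat P2 *v v = t *s ?b" using m2[of v] v x by blast
  have F: "fundamental_form P1 P2 ?a ?b = 0"
    unfolding fundamental_form_eq_0_iff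
    by (intro exI[of _ v] exI[of _ s] exI[of _ t] conjI disjI1 v(1) s t)
  obtain k where "a = k *s ?a" using assms(2) unfolding v1 by blast
  moreover obtain m where "b = m *s ?b" using assms(3) unfolding v2 by blast
  ultimately show ?thesis using F by (simp add: bilinD(2,4)[OF bilin_fundamental_form])
qed

text \<open>A common point \<open>v\<close> of the two rays gives the base point, and the rays
  themselves are the two lines. If \<open>v\<close> is a center, the result lies on the exceptional
  divisor.\<close>

lemma joint_map_surj:
  assumes "a \<noteq> 0" "b \<noteq> 0" "fundamental_form P1 P2 a b = 0"
  obtains \<xi> where "\<xi> \<in> blowup (center P1) (center P2)"
    "joint_camera_map P1 P2 \<xi> = (range (\<lambda>k. k *s a), range (\<lambda>k. k *s b))"
proof -
  obtain v s t where h: "v \<noteq> 0 \<or> s \<noteq> 0 \<or> t \<noteq> 0" "cmat P1 *v v = s *s a" "cmat P2 *v v = t *s b"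
    using assms(3) unfolding fundamental_form_eq_0_iff by blast
  have v: "v \<noteq> 0"
  proof
    assume "v = 0"
    then have "s *s a = 0" "t *s b = 0" using h by simp_all
    then show False using h(1) assms(1,2) \<open>v = 0\<close> by simp
  qed
  let ?x = "range (\<lambda>k. k *s v)"
  let ?L1 = "{v. \<exists>k. cmat P1 *v v = k *s a}" and ?L2 = "{v. \<exists>k. cmat P2 *v v = k *s b}"
  have "?x \<in> proj_points" using v unfolding proj_point_iff by blast
  moreover have "?x \<subseteq> ?L1" "?x \<subseteq> ?L2" by (auto simp: vec.scale h)
  ultimately have "(?x, ?L1, ?L2) \<in> blowup (center P1) (center P2)"
    using camera_line_preimage(1,2)[OF camera1 kernel1 assms(1)]
      camera_line_preimage(1,2)[OF camera2 kernel2 assms(2)]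
    unfolding blowup_def by simp
  then show ?thesis
    using that camera_line_preimage(3)[OF camera1 kernel1 assms(1)]
      camera_line_preimage(3)[OF camera2 kernel2 assms(2)]
    by (simp add: joint_camera_map_def)
qed

lemma center1_eq: "center P1 = range (\<lambda>k. k *s cvec u1)"
  by (rule center_kernel_vector[OF camera1 kernel1])

lemma center2_eq: "center P2 = range (\<lambda>k. k *s cvec u2)"
  by (rule center_kernel_vector[OF camera2 kernel2])

lemma u1_in_center: "cvec u1 \<in> center P1" and u2_in_center: "cvec u2 \<in> center P2"
  by (simp_all add: center_def cP1_u1 cP2_u2)

lemma P2_u1: "cmat P2 *v cvec u1 \<noteq> 0" and cP1_u2: "cmat P1 *v cvec u2 \<noteq> 0"
proof -
  show "cmat P2 *v cvec u1 \<noteq> 0"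
    using joint_kernel_trivial[of "cvec u1"] cP1_u1 u1_nonzero by auto
  show "cmat P1 *v cvec u2 \<noteq> 0"
    using joint_kernel_trivial[of "cvec u2"] cP2_u2 u2_nonzero by auto
qed

text \<open>Away from the centers the two image points are represented by the images of the base
  point itself, and \<open>g\<close> there is the quadratic form. At the first center its own image
  is zero and \<open>L1\<close> supplies the first image point instead; the vanishing of
  \<open>g\<close> then says that \<open>L1\<close> is tangent. The second center is
  symmetric.\<close>

lemma strict_transform_iff_form_vanishes:
  assumes g: "bilin g"
    and S: "\<And>v w. 2 * polar_form S v w = g (cmat P1 *v v) (cmat P2 *v w) + g (cmat P1 *v w) (cmat P2 *v v)"
    and \<xi>: "(x, L1, L2) \<in> blowup (center P1) (center P2)"
  shows "(x, L1, L2) \<in> strict_transform (center P1) (center P2) S \<longleftrightarrow>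
    (\<forall>a \<in> (*v) (cmat P1) ` L1. \<forall>b \<in> (*v) (cmat P2) ` L2. g a b = 0)"
proof -
  have x: "x \<in> proj_points" "x \<subseteq> L1" "x \<subseteq> L2"
    and L1: "L1 \<in> proj_lines" "center P1 \<subseteq> L1" and L2: "L2 \<in> proj_lines" "center P2 \<subseteq> L2"
    using \<xi> by (auto simp: blowup_def)
  obtain v0 where v0: "v0 \<noteq> 0" "x = range (\<lambda>k. k *s v0)"
    using x(1) unfolding proj_point_iff by blast
  have v0x: "v0 \<in> x" by (simp only: v0(2) range_scale_self)
  then have v0L: "v0 \<in> L1" "v0 \<in> L2" using x by blast+
  obtain v1 where v1: "v1 \<in> L1" "(*v) (cmat P1) ` L1 = range (\<lambda>k. k *s (cmat P1 *v v1))"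
    and m1: "\<And>x. x \<in> L1 \<Longrightarrow> \<exists>k. cmat P1 *v x = k *s (cmat P1 *v v1)"
    by (rule camera_line_image[OF camera1 kernel1 L1]) blast
  obtain v2 where v2: "v2 \<in> L2" "(*v) (cmat P2) ` L2 = range (\<lambda>k. k *s (cmat P2 *v v2))"
    and m2: "\<And>x. x \<in> L2 \<Longrightarrow> \<exists>k. cmat P2 *v x = k *s (cmat P2 *v v2)"
    by (rule camera_line_image[OF camera2 kernel2 L2]) blast
  \<comment> \<open>At a center one of the two summands drops out, which turns tangency there into
    the vanishing of \<open>g\<close> against the image of that center under the other
    camera.\<close>
  have polar_u1: "2 * polar_form S (cvec u1) w = g (cmat P1 *v w) (cmat P2 *v cvec u1)" for w
    by (simp add: S cP1_u1 bilinD(5)[OF g])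
  have polar_u2: "2 * polar_form S (cvec u2) w = g (cmat P1 *v cvec u2) (cmat P2 *v w)" for w
    by (simp add: S cP2_u2 bilinD(6)[OF g])
  show ?thesis
  proof
    assume st: "(x, L1, L2) \<in> strict_transform (center P1) (center P2) S"
    \<comment> \<open>Both images are points, so it suffices to test one nonzero representative of
      each.\<close>
    have vanish: "\<forall>a \<in> (*v) (cmat P1) ` L1. \<forall>b \<in> (*v) (cmat P2) ` L2. g a b = 0"
      if w: "w1 \<in> L1" "w2 \<in> L2" "cmat P1 *v w1 \<noteq> 0" "cmat P2 *v w2 \<noteq> 0"
        and 0: "g (cmat P1 *v w1) (cmat P2 *v w2) = 0" for w1 w2
    proof (intro ballI)
      fix a b assume ab: "a \<in> (*v) (cmat P1) ` L1" "b \<in> (*v) (cmat P2) ` L2"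
      obtain s where s: "cmat P1 *v w1 = s *s (cmat P1 *v v1)" using m1[OF w(1)] by blast
      obtain t where t: "cmat P2 *v w2 = t *s (cmat P2 *v v2)" using m2[OF w(2)] by blast
      have "s \<noteq> 0" "t \<noteq> 0" using w s t by auto
      then have "g (cmat P1 *v v1) (cmat P2 *v v2) = 0"
        using 0 unfolding s t by (simp add: bilinD(2,4)[OF g])
      then show "g a b = 0" using ab unfolding v1(2) v2(2) by (auto simp: bilinD(2,4)[OF g])
    qed
    show "\<forall>a \<in> (*v) (cmat P1) ` L1. \<forall>b \<in> (*v) (cmat P2) ` L2. g a b = 0"
    proof (cases "x = center P1")
      case True
      then have "tangent_line_at S (center P1) L1" using st by (auto simp: strict_transform_def)
      then have tan: "polar_form S (cvec u1) v = 0" if "v \<in> L1" for v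
        using that u1_in_center unfolding tangent_line_at_def by blast
      have u1: "cvec u1 \<in> L2" using x(3) True u1_in_center by blast
      show ?thesis
      proof (intro ballI)
        fix a b assume ab: "a \<in> (*v) (cmat P1) ` L1" "b \<in> (*v) (cmat P2) ` L2"
        obtain v where v: "v \<in> L1" "a = cmat P1 *v v" using ab(1) by blast
        obtain t where t: "cmat P2 *v cvec u1 = t *s (cmat P2 *v v2)" using m2[OF u1] by blast
        obtain m where m: "b = m *s (cmat P2 *v v2)" using ab(2) unfolding v2(2) by blast
        have "t \<noteq> 0" using t P2_u1 by auto
        have "g a (cmat P2 *v cvec u1) = 0" using polar_u1[of v] tan[OF v(1)] v(2) by simp
        then have "g a (cmat P2 *v v2) = 0"
          using \<open>t \<noteq> 0\<close> unfolding t by (simp add: bilinD(4)[OF g])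
        then show "g a b = 0" by (simp add: m bilinD(4)[OF g])
      qed
    next
      case n1: False
      show ?thesis
      proof (cases "x = center P2")
        case True
        then have "tangent_line_at S (center P2) L2" using st by (auto simp: strict_transform_def)
        then have tan: "polar_form S (cvec u2) v = 0" if "v \<in> L2" for v
          using that u2_in_center unfolding tangent_line_at_def by blast
        have u2: "cvec u2 \<in> L1" using x(2) True u2_in_center by blast
        show ?thesis
        proof (intro ballI)
          fix a b assume ab: "a \<in> (*v) (cmat P1) ` L1" "b \<in> (*v) (cmat P2) ` L2"
          obtain v where v: "v \<in> L2" "b = cmat P2 *v v" using ab(2) by blast
          obtain t where t: "cmat P1 *v cvec u2 = t *s (cmat P1 *v v1)" using m1[OF u2] by blast
          obtain m where m: "a = m *s (cmat P1 *v v1)" using ab(1) unfolding v1(2) by blast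
          have "t \<noteq> 0" using t cP1_u2 by auto
          have "g (cmat P1 *v cvec u2) b = 0" using polar_u2[of v] tan[OF v(1)] v(2) by simp
          then have "g (cmat P1 *v v1) b = 0"
            using \<open>t \<noteq> 0\<close> unfolding t by (simp add: bilinD(2)[OF g])
          then show "g a b = 0" by (simp add: m bilinD(2)[OF g])
        qed
      next
        case n2: False
        have "v0 \<in> surface S" using st v0x by (auto simp: strict_transform_def)
        then have "g (cmat P1 *v v0) (cmat P2 *v v0) = 0" using S[of v0 v0] by (simp add: surface_def)
        moreover have "cmat P1 *v v0 \<noteq> 0"
        proof
          assume "cmat P1 *v v0 = 0"
          then obtain k where k: "v0 = k *s cvec u1" by (rule camera_kernel_complex[OF camera1 kernel1])
          then have "k \<noteq> 0" using v0 by auto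
          then have "x = center P1" unfolding v0(2) k center1_eq by (rule range_scale_eq)
          then show False using n1 by blast
        qed
        moreover have "cmat P2 *v v0 \<noteq> 0"
        proof
          assume "cmat P2 *v v0 = 0"
          then obtain k where k: "v0 = k *s cvec u2" by (rule camera_kernel_complex[OF camera2 kernel2])
          then have "k \<noteq> 0" using v0 by auto
          then have "x = center P2" unfolding v0(2) k center2_eq by (rule range_scale_eq)
          then show False using n2 by blast
        qed
        ultimately show ?thesis using vanish v0L by blast
      qed
    qed
  next
    assume v: "\<forall>a \<in> (*v) (cmat P1) ` L1. \<forall>b \<in> (*v) (cmat P2) ` L2. g a b = 0"
    then have van: "g (cmat P1 *v v) (cmat P2 *v w) = 0" if "v \<in> L1" "w \<in> L2" for v w
      using that by blast
    have "x \<subseteq> surface S"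
    proof
      fix w assume "w \<in> x"
      then have "w \<in> L1" "w \<in> L2" using x by blast+
      then show "w \<in> surface S" using S[of w w] van by (simp add: surface_def)
    qed
    moreover have "tangent_line_at S (center P1) L1" if "x = center P1"
      unfolding tangent_line_at_def
    proof (intro ballI)
      fix u v assume uv: "u \<in> center P1" "v \<in> L1"
      then have "u \<in> L2" "cmat P1 *v u = 0" using x that by (auto simp: center_def)
      then show "polar_form S u v = 0" using S[of u v] van[OF uv(2)] by (simp add: bilinD(5)[OF g])
    qed
    moreover have "tangent_line_at S (center P2) L2" if "x = center P2"
      unfolding tangent_line_at_def
    proof (intro ballI)
      fix u v assume uv: "u \<in> center P2" "v \<in> L2"
      then have "u \<in> L1" "cmat P2 *v u = 0" using x that by (auto simp: center_def)
      then show "polar_form S u v = 0" using S[of u v] van[OF _ uv(2)] by (simp add: bilinD(6)[OF g])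
    qed
    ultimately show "(x, L1, L2) \<in> strict_transform (center P1) (center P2) S"
      using \<xi> by (auto simp: strict_transform_def)
  qed
qed

end

section \<open>Real quadrics over the complex numbers\<close>

lemma sym_dot:
  fixes S :: "real^'n^'n"
  assumes "transpose S = S"
  shows "x \<bullet> (S *v y) = y \<bullet> (S *v x)"
  by (metis assms dot_lmul_matrix inner_commute transpose_matrix_vector)

lemma sum_prod_dotc:
  "(\<Sum>i\<in>UNIV. \<Sum>j\<in>UNIV. complex_of_real (a $ i * b $ j) * v $ i * w $ j) = dotc a v * dotc b w"
  by (simp add: dotc_def sum_product mult_ac)

lemma polar_form_add_left: "polar_form S (u + v) w = polar_form S u w + polar_form S v w"
  by (simp add: polar_form_def algebra_simps sum.distrib)

lemma polar_form_add_right: "polar_form S u (v + w) = polar_form S u v + polar_form S u w"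
  by (simp add: polar_form_def algebra_simps sum.distrib)

lemma polar_form_scale_left: "polar_form S (k *s u) w = k * polar_form S u w"
  by (simp add: polar_form_def mult_ac sum_distrib_left)

lemma polar_form_scale_right: "polar_form S u (k *s w) = k * polar_form S u w"
  by (simp add: polar_form_def mult_ac sum_distrib_left)

lemmas polar_form_linear = polar_form_add_left polar_form_add_right polar_form_scale_left polar_form_scale_right

lemma polar_form_cvec: "polar_form S (cvec x) (cvec y) = complex_of_real (x \<bullet> (S *v y))"
  by (simp add: polar_form_def cvec_def inner_vec_def matrix_vector_mult_def sum_distrib_left mult_ac)

lemma polar_form_sym:
  assumes "transpose S = S"
  shows "polar_form S u v = polar_form S v u"
proof -
  have "transpose S $ i $ j = S $ j $ i" for i j
    by (simp add: transpose_def)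
  then have "S $ i $ j = S $ j $ i" for i j
    unfolding assms .
  then show ?thesis
    unfolding polar_form_def by (subst sum.swap) (intro sum.cong refl, simp add: mult_ac)
qed

lemma polar_form_cmat: "polar_form S u v = (\<Sum>i\<in>UNIV. u $ i * (cmat S *v v) $ i)"
  by (simp add: polar_form_def cmat_mult_component dotc_def sum_distrib_left mult_ac)

lemma cmat_eq_0_iff_polar: "cmat S *v v = 0 \<longleftrightarrow> (\<forall>u. polar_form S u v = 0)"
proof
  assume h: "\<forall>u. polar_form S u v = 0"
  have "(cmat S *v v) $ i = 0" for i
  proof -
    have "polar_form S (axis i 1) v = (cmat S *v v) $ i"
      by (simp add: polar_form_cmat axis_def if_distrib[of "\<lambda>x. x * _"] cong: if_cong)
    then show ?thesis using h by simp
  qed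
  then show "cmat S *v v = 0" by (simp add: vec_eq_iff)
qed (simp add: polar_form_cmat)

lemma surface_scale: "v \<in> surface S \<Longrightarrow> k *s v \<in> surface S"
  by (simp add: surface_def polar_form_linear)

lemma surface_cvec: "cvec u \<in> surface S \<longleftrightarrow> u \<bullet> (S *v u) = 0"
  by (simp add: surface_def polar_form_cvec)

lemma real_point_subset_surface: "range (\<lambda>k. k *s cvec u) \<subseteq> surface S \<longleftrightarrow> u \<bullet> (S *v u) = 0"
  using surface_scale[of "cvec u" S] range_scale_self[of "cvec u"] surface_cvec[of u S] by blast

lemma singular_point_iff:
  "singular_point S x \<longleftrightarrow> x \<in> proj_points \<and> (\<forall>v\<in>x. cmat S *v v = 0)"
  by (auto simp: singular_point_def surface_def cmat_eq_0_iff_polar)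

lemma singular_real_point:
  assumes "u \<noteq> 0"
  shows "singular_point S (range (\<lambda>k. k *s cvec u)) \<longleftrightarrow> S *v u = 0"
proof -
  have p: "range (\<lambda>k. k *s cvec u) \<in> proj_points"
    using assms proj_point_iff by (metis cvec_eq_0)
  have "(\<forall>v\<in>range (\<lambda>k. k *s cvec u). cmat S *v v = 0) \<longleftrightarrow> S *v u = 0"
  proof
    assume "\<forall>v\<in>range (\<lambda>k. k *s cvec u). cmat S *v v = 0"
    then have "cmat S *v cvec u = 0" using range_scale_self by blast
    then show "S *v u = 0" by (simp add: cmat_cvec)
  qed (auto simp: vec.scale cmat_cvec)
  then show ?thesis by (simp only: singular_point_iff p simp_thms)
qed

text \<open>A nonzero complex kernel vector has a nonzero real or imaginary part, again in the
  kernel, so real vectors suffice.\<close>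

lemma smooth_quadric_iff: "smooth_quadric S \<longleftrightarrow> (\<forall>v. S *v v = 0 \<longrightarrow> v = 0)"
proof
  assume "smooth_quadric S"
  then show "\<forall>v. S *v v = 0 \<longrightarrow> v = 0"
    unfolding smooth_quadric_def using singular_real_point by blast
next
  assume h: "\<forall>v. S *v v = 0 \<longrightarrow> v = 0"
  show "smooth_quadric S"
    unfolding smooth_quadric_def
  proof (intro allI notI)
    fix x assume "singular_point S x"
    then obtain v where "v \<noteq> 0" "cmat S *v v = 0"
      unfolding singular_point_iff proj_point_iff using range_scale_self by blast
    then show False using h re_im_vec_eq_0 unfolding cmat_eq_0_iff by blast
  qed
qed

text \<open>The vertex is real, since the real or imaginary part of a representative represents a
  singular point too. Its uniqueness then makes the real kernel one-dimensional.\<close>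

lemma quadric_coneE:
  assumes "quadric_cone S"
  obtains z where "z \<noteq> 0" "S *v z = 0" "\<And>v. S *v v = 0 \<Longrightarrow> \<exists>k. v = k *\<^sub>R z"
proof -
  obtain x where x: "singular_point S x" and uniq: "\<And>y. singular_point S y \<Longrightarrow> y = x"
    using assms unfolding quadric_cone_def by blast
  obtain v where v: "v \<noteq> 0" "cmat S *v v = 0"
    using x range_scale_self unfolding singular_point_iff proj_point_iff by blast
  then obtain z where z: "z \<noteq> 0" "S *v z = 0"
    using re_im_vec_eq_0 unfolding cmat_eq_0_iff by blast
  have "\<exists>k. w = k *\<^sub>R z" if w: "S *v w = 0" for w
  proof (cases "w = 0")
    case True
    then show ?thesis by (intro exI[of _ 0]) simp
  next
    case False
    have "range (\<lambda>k. k *s cvec w) = range (\<lambda>k. k *s cvec z)"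
      using uniq singular_real_point[OF False] singular_real_point[OF z(1)] w z(2) by metis
    then obtain k where k: "cvec w = k *s cvec z" using range_scale_self[of "cvec w"] by blast
    have "w = Re k *\<^sub>R z"
    proof (rule vec_eq_iff[THEN iffD2], intro allI)
      fix i
      have "(cvec w) $ i = (k *s cvec z) $ i" using k by simp
      then have "Re (complex_of_real (w $ i)) = Re (k * complex_of_real (z $ i))" by (simp add: cvec_def)
      then show "w $ i = (Re k *\<^sub>R z) $ i" by simp
    qed
    then show ?thesis by blast
  qed
  then show ?thesis using that z by blast
qed

lemma quadric_coneI:
  assumes z: "z \<noteq> 0" "S *v z = 0" and uniq: "\<And>v. S *v v = 0 \<Longrightarrow> \<exists>k. v = k *\<^sub>R z"
  shows "quadric_cone S"
  unfolding quadric_cone_def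
proof (rule ex1I)
  show "singular_point S (range (\<lambda>k. k *s cvec z))" using singular_real_point z by blast
next
  fix x assume x: "singular_point S x"
  then obtain a where a: "a \<noteq> 0" "x = range (\<lambda>k. k *s a)"
    unfolding singular_point_iff proj_point_iff by blast
  have "a \<in> x" by (simp only: a(2) range_scale_self)
  then have "cmat S *v a = 0" using x by (auto simp: singular_point_iff)
  then obtain r t where rt: "re_vec a = r *\<^sub>R z" "im_vec a = t *\<^sub>R z"
    using uniq unfolding cmat_eq_0_iff by metis
  then have e: "a = (complex_of_real r + \<i> * complex_of_real t) *s cvec z"
    by (subst complex_vec_split) (simp add: cvec_scale vec.scale_left_distrib)
  have "complex_of_real r + \<i> * complex_of_real t \<noteq> 0"
  proof
    assume 0: "complex_of_real r + \<i> * complex_of_real t = 0"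
    have "a = 0 *s cvec z" using e unfolding 0 .
    then show False using a(1) by simp
  qed
  then show "x = range (\<lambda>k. k *s cvec z)" unfolding a(2) e by (rule range_scale_eq)
qed

lemma vertex_real_point_iff:
  assumes "quadric_cone S" and "u \<noteq> 0"
  shows "range (\<lambda>k. k *s cvec u) = vertex S \<longleftrightarrow> S *v u = 0"
proof -
  have v: "singular_point S (vertex S)"
    using theI'[OF assms(1)[unfolded quadric_cone_def]] by (simp add: vertex_def)
  show ?thesis
  proof
    assume "range (\<lambda>k. k *s cvec u) = vertex S"
    then show "S *v u = 0" using v singular_real_point[OF assms(2)] by metis
  next
    assume "S *v u = 0"
    then have "singular_point S (range (\<lambda>k. k *s cvec u))" using singular_real_point[OF assms(2)] by blast
    then show "range (\<lambda>k. k *s cvec u) = vertex S"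
      using v assms(1) unfolding quadric_cone_def by blast
  qed
qed

lemma cvec_not_in_range:
  assumes "indep2 u1 u2"
  shows "cvec u2 \<notin> range (\<lambda>k. k *s cvec u1)"
proof
  assume "cvec u2 \<in> range (\<lambda>k. k *s cvec u1)"
  then obtain k where k: "cvec u2 = k *s cvec u1" by blast
  have "Re k *\<^sub>R u1 + (-1) *\<^sub>R u2 = 0"
  proof (rule vec_eq_iff[THEN iffD2], intro allI)
    fix i
    have "(cvec u2) $ i = (k *s cvec u1) $ i" using k by simp
    then have "Re (complex_of_real (u2 $ i)) = Re (k * complex_of_real (u1 $ i))" by (simp add: cvec_def)
    then show "(Re k *\<^sub>R u1 + (-1) *\<^sub>R u2) $ i = 0 $ i" by simp
  qed
  then show False using indep2D(2)[OF assms] by fastforce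
qed

text \<open>The line joining the two points is forced, and on it the quadratic form is
  \<open>2 s t\<close> times the polar value of the two points.\<close>

lemma on_common_line_iff:
  assumes S: "transpose S = S" and ind: "indep2 u1 u2"
    and q: "u1 \<bullet> (S *v u1) = 0" "u2 \<bullet> (S *v u2) = 0"
  shows "on_common_line S (range (\<lambda>k. k *s cvec u1)) (range (\<lambda>k. k *s cvec u2)) \<longleftrightarrow> u1 \<bullet> (S *v u2) = 0"
proof
  assume "on_common_line S (range (\<lambda>k. k *s cvec u1)) (range (\<lambda>k. k *s cvec u2))"
  then obtain L where L: "L \<in> proj_lines" "L \<subseteq> surface S"
    "range (\<lambda>k. k *s cvec u1) \<subseteq> L" "range (\<lambda>k. k *s cvec u2) \<subseteq> L"
    unfolding on_common_line_def by blast
  have "cvec u1 \<in> L" by (rule subsetD[OF L(3) range_scale_self])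
  moreover have "cvec u2 \<in> L" by (rule subsetD[OF L(4) range_scale_self])
  ultimately have "cvec (u1 + u2) \<in> surface S" 
    unfolding cvec_add by (intro subsetD[OF L(2)] proj_line_add L(1))
  then have "(u1 + u2) \<bullet> (S *v (u1 + u2)) = 0" by (simp only: surface_cvec)
  then show "u1 \<bullet> (S *v u2) = 0"
    using q sym_dot[OF S, of u2 u1] by (simp add: matrix_vector_right_distrib inner_add_left inner_add_right)
next
  assume 0: "u1 \<bullet> (S *v u2) = 0"
  let ?L = "vec.span {cvec u1, cvec u2}"
  have "?L \<in> proj_lines"
    by (rule span_pair_proj_line) (use indep2_nonzero[OF ind] cvec_not_in_range[OF ind] in auto)
  moreover have "?L \<subseteq> surface S"
  proof
    fix x assume "x \<in> ?L"
    then obtain s t where "x = s *s cvec u1 + t *s cvec u2" unfolding span_pair_iff by blast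
    then show "x \<in> surface S"
      using 0 q sym_dot[OF S, of u2 u1] by (simp add: surface_def polar_form_linear polar_form_cvec)
  qed
  moreover have "range (\<lambda>k. k *s cvec u1) \<subseteq> ?L" "range (\<lambda>k. k *s cvec u2) \<subseteq> ?L"
    by (auto intro!: vec.span_scale intro: vec.span_base)
  ultimately show "on_common_line S (range (\<lambda>k. k *s cvec u1)) (range (\<lambda>k. k *s cvec u2))"
    unfolding on_common_line_def by blast
qed

text \<open>Stated for an arbitrary linear map instead of \<open>dotc\<close>, since complex
  conjugate planes have equations with complex coefficients. Adding a vector \<open>y\<close>
  outside the kernel already spans the whole space.\<close>

lemma kernel_proj_plane:
  fixes \<phi> :: "complex^4 \<Rightarrow> complex"
  assumes add: "\<And>v w. \<phi> (v + w) = \<phi> v + \<phi> w" and scale: "\<And>k v. \<phi> (k *s v) = k * \<phi> v"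
    and y: "\<phi> y \<noteq> 0"
  shows "{v. \<phi> v = 0} \<in> proj_planes"
proof -
  let ?W = "{v. \<phi> v = 0}"
  have 0: "\<phi> 0 = 0" using scale[of 0 0] by simp
  have W: "vec.subspace ?W" by (rule vec.subspaceI) (simp_all add: 0 add scale)
  then have spanW: "vec.span ?W = ?W" by simp
  have "x \<in> vec.span (insert y ?W)" for x
  proof -
    have "x - (\<phi> x / \<phi> y) *s y \<in> ?W"
    proof -
      have "\<phi> x = \<phi> ((x - (\<phi> x / \<phi> y) *s y) + (\<phi> x / \<phi> y) *s y)" by simp
      also have "\<dots> = \<phi> (x - (\<phi> x / \<phi> y) *s y) + \<phi> x" unfolding add scale using y by simp
      finally show ?thesis by simp
    qed
    then show ?thesis unfolding vec.span_breakdown_eq spanW by blast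
  qed
  then have "vec.span (insert y ?W) = UNIV" by blast
  then have "vec.dim (vec.span (insert y ?W)) = vec.dim (UNIV :: (complex^4) set)" by simp
  then have "vec.dim (insert y ?W) = 4" unfolding vec.dim_span vec_dim_card by simp
  moreover have "y \<notin> vec.span ?W" unfolding spanW using y by simp
  ultimately have "vec.dim ?W = 3" by (simp add: vec.dim_insert)
  then show ?thesis using W by (simp add: proj_planes_def)
qed

lemma real_plane:
  fixes w :: "real^4"
  assumes "w \<noteq> 0"
  shows "{v. dotc w v = 0} \<in> proj_planes"
  by (rule kernel_proj_plane[where \<phi> = "dotc w" and y = "cvec w"]) (simp_all add: assms)

lemma real_subspace_kernel: "real_subspace {v. dotc w v = 0}"
  unfolding real_subspace_def
proof (rule exI[of _ "{u. w \<bullet> u = 0}"], rule set_eqI)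
  fix v
  show "v \<in> {v. dotc w v = 0} \<longleftrightarrow> v \<in> vec.span (cvec ` {u. w \<bullet> u = 0})"
  proof
    assume "v \<in> {v. dotc w v = 0}"
    then have "w \<bullet> re_vec v = 0" "w \<bullet> im_vec v = 0" by (simp_all add: dotc_eq_0_iff)
    then have "cvec (re_vec v) + \<i> *s cvec (im_vec v) \<in> vec.span (cvec ` {u. w \<bullet> u = 0})"
      by (intro vec.span_add vec.span_scale vec.span_base) auto
    then show "v \<in> vec.span (cvec ` {u. w \<bullet> u = 0})" by (metis complex_vec_split)
  next
    assume "v \<in> vec.span (cvec ` {u. w \<bullet> u = 0})"
    moreover have "vec.span (cvec ` {u. w \<bullet> u = 0}) \<subseteq> {v. dotc w v = 0}"
      by (rule vec.span_minimal) (auto intro!: vec.subspaceI)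
    ultimately show "v \<in> {v. dotc w v = 0}" by blast
  qed
qed

lemma real_point_subset_kernel: "range (\<lambda>k. k *s cvec u) \<subseteq> {v. dotc w v = 0} \<longleftrightarrow> w \<bullet> u = 0"
  using range_scale_self[of "cvec u"] by auto

text \<open>The quadric is the pullback of the bilinear form \<open>c1 d1 + c2 d2\<close> when \<open>l1, l2\<close> are the pullbacks of
  \<open>c1, c2\<close> along the first camera and \<open>m1, m2\<close> those of \<open>d1, d2\<close> along the second.\<close>

definition split_form :: "real^4^4 \<Rightarrow> real^4 \<Rightarrow> real^4 \<Rightarrow> real^4 \<Rightarrow> real^4 \<Rightarrow> bool" where
  "split_form S l1 m1 l2 m2 \<longleftrightarrow> (\<forall>x. x \<bullet> (S *v x) = (l1 \<bullet> x) * (m1 \<bullet> x) + (l2 \<bullet> x) * (m2 \<bullet> x))"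

lemma split_form_polar_real:
  assumes S: "transpose S = S" and sp: "split_form S l1 m1 l2 m2"
  shows "2 * (x \<bullet> (S *v y)) = (l1 \<bullet> x) * (m1 \<bullet> y) + (m1 \<bullet> x) * (l1 \<bullet> y)
    + (l2 \<bullet> x) * (m2 \<bullet> y) + (m2 \<bullet> x) * (l2 \<bullet> y)"
proof -
  have q: "z \<bullet> (S *v z) = (l1 \<bullet> z) * (m1 \<bullet> z) + (l2 \<bullet> z) * (m2 \<bullet> z)" for z
    using sp by (simp add: split_form_def)
  have "(x + y) \<bullet> (S *v (x + y)) = x \<bullet> (S *v x) + 2 * (x \<bullet> (S *v y)) + y \<bullet> (S *v y)"
    using sym_dot[OF S, of x y] by (simp add: matrix_vector_right_distrib inner_add_left inner_add_right)
  then show ?thesis unfolding q by (simp add: inner_add_right algebra_simps)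
qed

text \<open>The real polar identity, evaluated on coordinate vectors, determines the entries of
  \<open>S\<close>; the complex identity is then a sum over these entries.\<close>

lemma split_form_polar:
  assumes S: "transpose S = S" and sp: "split_form S l1 m1 l2 m2"
  shows "2 * polar_form S v w = dotc l1 v * dotc m1 w + dotc m1 v * dotc l1 w
    + dotc l2 v * dotc m2 w + dotc m2 v * dotc l2 w"
proof -
  have e: "2 * S $ i $ j = l1 $ i * m1 $ j + m1 $ i * l1 $ j + l2 $ i * m2 $ j + m2 $ i * l2 $ j" for i j
  proof -
    have "axis i 1 \<bullet> (S *v axis j 1) = S $ i $ j"
      by (simp add: vec_axis_inner matrix_vector_mult_basis column_def)
    then show ?thesis
      using split_form_polar_real[OF assms, of "axis i 1" "axis j 1"] by (simp add: inner_axis)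
  qed
  have "2 * polar_form S v w = (\<Sum>i\<in>UNIV. \<Sum>j\<in>UNIV. complex_of_real (2 * S $ i $ j) * v $ i * w $ j)"
    by (simp add: polar_form_def sum_distrib_left mult_ac)
  also have "\<dots> = (\<Sum>i\<in>UNIV. \<Sum>j\<in>UNIV. complex_of_real (l1 $ i * m1 $ j) * v $ i * w $ j)
      + (\<Sum>i\<in>UNIV. \<Sum>j\<in>UNIV. complex_of_real (m1 $ i * l1 $ j) * v $ i * w $ j)
      + (\<Sum>i\<in>UNIV. \<Sum>j\<in>UNIV. complex_of_real (l2 $ i * m2 $ j) * v $ i * w $ j)
      + (\<Sum>i\<in>UNIV. \<Sum>j\<in>UNIV. complex_of_real (m2 $ i * l2 $ j) * v $ i * w $ j)"
    unfolding e sum.distrib[symmetric] by (simp add: algebra_simps)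
  finally show ?thesis unfolding sum_prod_dotc .
qed

lemma split_form_surface:
  assumes S: "transpose S = S" and sp: "split_form S l1 m1 l2 m2"
  shows "v \<in> surface S \<longleftrightarrow> dotc l1 v * dotc m1 v + dotc l2 v * dotc m2 v = 0"
proof -
  have "2 * polar_form S v v = 2 * (dotc l1 v * dotc m1 v + dotc l2 v * dotc m2 v)"
    unfolding split_form_polar[OF assms] by (simp add: algebra_simps)
  then have "polar_form S v v = dotc l1 v * dotc m1 v + dotc l2 v * dotc m2 v"
    by (subst (asm) mult_cancel_left) simp
  then show ?thesis by (simp add: surface_def)
qed

text \<open>By polarization: a vanishing quadratic form splits with all four linear forms equal to
  zero.\<close>

lemma quadric_zeroI:
  fixes S :: "real^4^4"
  assumes S: "transpose S = S" and 0: "\<And>x. x \<bullet> (S *v x) = 0"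
  shows "S = 0"
proof -
  have "split_form S 0 0 0 0" using 0 by (simp add: split_form_def)
  then have "x \<bullet> (S *v y) = 0" for x y using split_form_polar_real[OF S] by fastforce
  then have "S *v y = 0" for y by (metis inner_eq_zero_iff)
  then show ?thesis by (simp add: matrix_eq)
qed

section \<open>Quadrics that split are of critical type\<close>

definition critical_quadric :: "(complex^4) set \<Rightarrow> (complex^4) set \<Rightarrow> real^4^4 \<Rightarrow> bool" where
  "critical_quadric p1 p2 S \<longleftrightarrow>
       ((smooth_quadric S \<and> ruled S \<and> \<not> on_common_line S p1 p2) \<or>
        (smooth_quadric S \<and> ruled S \<and> on_common_line S p1 p2) \<or>
        (quadric_cone S \<and> p1 \<noteq> vertex S \<and> p2 \<noteq> vertex S \<and> \<not> on_common_line S p1 p2) \<or>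
        (quadric_cone S \<and> ((p1 = vertex S \<and> p2 \<noteq> vertex S) \<or> (p1 \<noteq> vertex S \<and> p2 = vertex S))) \<or>
        (\<exists>H K. union_of_planes S H K \<and> real_subspace H \<and> real_subspace K \<and>
           p1 \<subseteq> H \<and> p2 \<subseteq> H \<and> \<not> p1 \<subseteq> H \<inter> K \<and> \<not> p2 \<subseteq> H \<inter> K) \<or>
        (\<exists>H K. union_of_planes S H K \<and> real_subspace H \<and> real_subspace K \<and>
           ((p1 \<subseteq> H \<inter> K \<and> \<not> p2 \<subseteq> H \<inter> K) \<or> (\<not> p1 \<subseteq> H \<inter> K \<and> p2 \<subseteq> H \<inter> K))) \<or>
        (\<exists>H K. union_of_planes S H K \<and> p1 \<subseteq> H \<inter> K \<and> p2 \<subseteq> H \<inter> K) \<or>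
        (double_plane S \<and> p1 \<subseteq> surface S \<and> p2 \<subseteq> surface S))"

abbreviation real_point :: "real^4 \<Rightarrow> (complex^4) set" where
  "real_point u \<equiv> range (\<lambda>k. k *s cvec u)"

text \<open>Both centers lie on the plane \<open>w\<close>, so only their position relative to the
  plane \<open>n\<close> remains: neither on it, one on it or both on it are three of the listed
  types. If \<open>n\<close> is proportional to \<open>w\<close>, the plane is double.\<close>

lemma critical_product:
  assumes S: "transpose S = S" and sp: "split_form S w n 0 0"
    and wn: "w \<noteq> 0" "n \<noteq> 0" and u: "w \<bullet> u1 = 0" "w \<bullet> u2 = 0"
  shows "critical_quadric (real_point u1) (real_point u2) S"
proof -
  let ?H = "{v. dotc w v = 0}" and ?K = "{v. dotc n v = 0}"
  have surf: "surface S = ?H \<union> ?K"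
    using split_form_surface[OF S sp] by auto
  have p: "real_point u1 \<subseteq> ?H" "real_point u2 \<subseteq> ?H"
    unfolding real_point_subset_kernel by (rule u)+
  show ?thesis
  proof (cases "indep2 w n")
    case False
    then obtain k where k: "n = k *\<^sub>R w" using not_indep2E wn(1) by metis
    then have "k \<noteq> 0" using wn(2) by auto
    then have "?K = ?H" unfolding k dotc_scale_left by simp
    then have "surface S = ?H" using surf by blast
    then have "double_plane S \<and> real_point u1 \<subseteq> surface S \<and> real_point u2 \<subseteq> surface S"
      unfolding double_plane_def using real_plane[OF wn(1)] p by simp
    then show ?thesis unfolding critical_quadric_def by blast
  next
    case True
    then obtain b f where b: "dual_bases b f" "b 1 = w" "b 2 = n"
      using dual_bases_extend_two by blast
    have "w \<bullet> f 1 = 1" "n \<bullet> f 1 = 0"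
      using dual_basesD[OF dual_bases_commute[OF b(1)], of 1 1] dual_basesD[OF dual_bases_commute[OF b(1)], of 2 1]
      by (simp_all add: b)
    then have "cvec (f 1) \<in> ?K" "cvec (f 1) \<notin> ?H" by simp_all
    then have "?H \<noteq> ?K" by blast
    then have un: "union_of_planes S ?H ?K"
      unfolding union_of_planes_def using real_plane[OF wn(1)] real_plane[OF wn(2)] surf by simp
    have re: "real_subspace ?H" "real_subspace ?K" by (rule real_subspace_kernel)+
    consider "\<not> real_point u1 \<subseteq> ?H \<inter> ?K" "\<not> real_point u2 \<subseteq> ?H \<inter> ?K"
      | "(real_point u1 \<subseteq> ?H \<inter> ?K \<and> \<not> real_point u2 \<subseteq> ?H \<inter> ?K) \<or>
         (\<not> real_point u1 \<subseteq> ?H \<inter> ?K \<and> real_point u2 \<subseteq> ?H \<inter> ?K)"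
      | "real_point u1 \<subseteq> ?H \<inter> ?K" "real_point u2 \<subseteq> ?H \<inter> ?K" by argo
    then show ?thesis
    proof cases
      case 1
      then have "\<exists>H K. union_of_planes S H K \<and> real_subspace H \<and> real_subspace K \<and>
           real_point u1 \<subseteq> H \<and> real_point u2 \<subseteq> H \<and> \<not> real_point u1 \<subseteq> H \<inter> K \<and> \<not> real_point u2 \<subseteq> H \<inter> K"
        using un re p by (intro exI[of _ ?H] exI[of _ ?K] conjI)
      then show ?thesis unfolding critical_quadric_def by argo
    next
      case 2
      then have "\<exists>H K. union_of_planes S H K \<and> real_subspace H \<and> real_subspace K \<and>
           ((real_point u1 \<subseteq> H \<inter> K \<and> \<not> real_point u2 \<subseteq> H \<inter> K) \<or> (\<not> real_point u1 \<subseteq> H \<inter> K \<and> real_point u2 \<subseteq> H \<inter> K))"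
        using un re by (intro exI[of _ ?H] exI[of _ ?K] conjI)
      then show ?thesis unfolding critical_quadric_def by argo
    next
      case 3
      then have "\<exists>H K. union_of_planes S H K \<and> real_point u1 \<subseteq> H \<inter> K \<and> real_point u2 \<subseteq> H \<inter> K"
        using un by (intro exI[of _ ?H] exI[of _ ?K] conjI)
      then show ?thesis unfolding critical_quadric_def by argo
    qed
  qed
qed

text \<open>The roots may be complex, which is how complex conjugate planes arise. Since the
  coefficient \<open>b\<close> of the square of \<open>Y\<close> is nonzero, no root lies at
  infinity.\<close>

lemma complex_quadratic_factor:
  fixes a b c :: complex
  assumes "b \<noteq> 0"
  obtains r s where "\<And>X Y. c * X * X + a * X * Y + b * Y * Y = b * (Y - r * X) * (Y - s * X)"
proof -
  define d where "d = csqrt (a\<^sup>2 - 4 * b * c)"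
  have d: "d * d = a * a - 4 * b * c"
    using power2_csqrt[of "a\<^sup>2 - 4 * b * c"] by (simp add: d_def power2_eq_square)
  define r s where "r = (- a + d) / (2 * b)" and "s = (- a - d) / (2 * b)"
  have rs: "b * (r + s) = - a"
    using assms by (simp add: r_def s_def field_simps)
  have "4 * b * (b * (r * s)) = (- a + d) * (- a - d)"
    using assms by (simp add: r_def s_def field_simps)
  also have "\<dots> = 4 * b * c" using d by (simp add: algebra_simps)
  finally have rs': "b * (r * s) = c" using assms by simp
  have "c * X * X + a * X * Y + b * Y * Y = b * (Y - r * X) * (Y - s * X)" for X Y
  proof -
    have "b * (Y - r * X) * (Y - s * X) = b * Y * Y - (b * (r + s)) * X * Y + (b * (r * s)) * X * X"
      by (simp add: algebra_simps)
    then show ?thesis unfolding rs rs' by (simp add: algebra_simps)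
  qed
  then show ?thesis using that by blast
qed

text \<open>The quadratic form is a binary form in \<open>w\<close> and \<open>l\<close>. It factors
  over the complex numbers into two planes through the line \<open>w = l = 0\<close>, which contains
  both centers; a double root gives a double plane.\<close>

lemma critical_binary:
  assumes S: "transpose S = S" and sp: "split_form S w (c *\<^sub>R w + a *\<^sub>R l) l (b *\<^sub>R l)"
    and wl: "indep2 w l" and b: "b \<noteq> 0"
    and u: "w \<bullet> u1 = 0" "w \<bullet> u2 = 0" "l \<bullet> u1 = 0" "l \<bullet> u2 = 0"
  shows "critical_quadric (real_point u1) (real_point u2) S"
proof -
  obtain r s where rs: "\<And>X Y. complex_of_real c * X * X + complex_of_real a * X * Y + complex_of_real b * Y * Y
      = complex_of_real b * (Y - r * X) * (Y - s * X)"
    using complex_quadratic_factor[of "complex_of_real b" "complex_of_real c" "complex_of_real a"] b by auto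
  let ?f = "\<lambda>t v. dotc l v - t * dotc w v"
  let ?H = "{v. ?f r v = 0}" and ?K = "{v. ?f s v = 0}"
  have surf: "surface S = ?H \<union> ?K"
  proof (rule set_eqI)
    fix v
    have "dotc w v * dotc (c *\<^sub>R w + a *\<^sub>R l) v + dotc l v * dotc (b *\<^sub>R l) v
        = complex_of_real b * ?f r v * ?f s v"
      unfolding rs[symmetric] dotc_add_left dotc_scale_left by (simp add: algebra_simps)
    then show "v \<in> surface S \<longleftrightarrow> v \<in> ?H \<union> ?K"
      unfolding split_form_surface[OF S sp] using b by simp
  qed
  obtain e f where e: "dual_bases e f" "e 1 = w" "e 2 = l"
    using dual_bases_extend_two[OF wl] by blast
  have f: "w \<bullet> f 1 = 1" "l \<bullet> f 1 = 0" "w \<bullet> f 2 = 0" "l \<bullet> f 2 = 1"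
    using dual_basesD[OF dual_bases_commute[OF e(1)], of 1 1] dual_basesD[OF dual_bases_commute[OF e(1)], of 2 1]
      dual_basesD[OF dual_bases_commute[OF e(1)], of 1 2] dual_basesD[OF dual_bases_commute[OF e(1)], of 2 2]
    by (simp_all add: e)
  have plane: "{v. ?f t v = 0} \<in> proj_planes" for t
    by (rule kernel_proj_plane[where \<phi> = "?f t" and y = "cvec (f 2)"]) (simp_all add: algebra_simps f)
  have p: "real_point u1 \<subseteq> {v. ?f t v = 0}" "real_point u2 \<subseteq> {v. ?f t v = 0}" for t
    by (auto simp: u)
  show ?thesis
  proof (cases "r = s")
    case True
    then have "surface S = ?H" using surf by simp
    then have "double_plane S \<and> real_point u1 \<subseteq> surface S \<and> real_point u2 \<subseteq> surface S"
      unfolding double_plane_def using plane p by simp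
    then show ?thesis unfolding critical_quadric_def by argo
  next
    case False
    let ?v = "cvec (f 1) + r *s cvec (f 2)"
    have "?v \<in> ?H" "?v \<notin> ?K" using False by (simp_all add: f)
    then have "?H \<noteq> ?K" by blast
    then have "union_of_planes S ?H ?K" unfolding union_of_planes_def using plane surf by simp
    then have "\<exists>H K. union_of_planes S H K \<and> real_point u1 \<subseteq> H \<inter> K \<and> real_point u2 \<subseteq> H \<inter> K"
      by (intro exI[of _ ?H] exI[of _ ?K] conjI Int_greatest p)
    then show ?thesis unfolding critical_quadric_def by argo
  qed
qed

text \<open>If \<open>w\<close>, \<open>l\<close>, \<open>m\<close> are dependent, then
  \<open>m\<close> is a combination of the other two and the form becomes binary. Otherwise their
  common zero is the vertex of a cone.\<close>

lemma critical_cone: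
  assumes S: "transpose S = S" and sp: "split_form S w (c *\<^sub>R w) l m" and c: "c \<noteq> 0"
    and wl: "indep2 w l" and wm: "indep2 w m" and ind: "indep2 u1 u2"
    and u: "w \<bullet> u1 = 0" "w \<bullet> u2 = 0" "l \<bullet> u1 = 0" "m \<bullet> u2 = 0"
  shows "critical_quadric (real_point u1) (real_point u2) S"
proof (cases "\<exists>s t r. s *\<^sub>R w + t *\<^sub>R l + r *\<^sub>R m = 0 \<and> \<not> (s = 0 \<and> t = 0 \<and> r = 0)")
  case True
  then obtain s t r where str: "s *\<^sub>R w + t *\<^sub>R l + r *\<^sub>R m = 0" "\<not> (s = 0 \<and> t = 0 \<and> r = 0)" by blast
  have r: "r \<noteq> 0" using str indep2D[OF wl, of s t] by auto
  have "r *\<^sub>R m = - (s *\<^sub>R w + t *\<^sub>R l)" by (rule minus_unique[OF str(1), symmetric])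
  then have "(1/r) *\<^sub>R (r *\<^sub>R m) = (1/r) *\<^sub>R (- (s *\<^sub>R w + t *\<^sub>R l))" by (rule arg_cong)
  moreover have "(1/r) *\<^sub>R (r *\<^sub>R m) = m" using r by simp
  ultimately have m: "m = (- s / r) *\<^sub>R w + (- t / r) *\<^sub>R l"
    by (simp add: algebra_simps)
  define a b where "a = - s / r" and "b = - t / r"
  have m: "m = a *\<^sub>R w + b *\<^sub>R l" unfolding m a_def b_def ..
  have b: "b \<noteq> 0"
  proof
    assume "b = 0"
    then have "a *\<^sub>R w + (-1) *\<^sub>R m = 0" by (simp add: m)
    then show False using indep2D(2)[OF wm] by fastforce
  qed
  have "l \<bullet> u2 = 0" using u b unfolding m by (simp add: inner_add_left)
  moreover have "split_form S w (c *\<^sub>R w + a *\<^sub>R l) l (b *\<^sub>R l)"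
    using sp unfolding split_form_def m by (simp add: inner_add_left algebra_simps)
  ultimately show ?thesis using critical_binary[OF S _ wl b] u by blast
next
  case False
  then have "\<And>s t r. s *\<^sub>R w + t *\<^sub>R l + r *\<^sub>R m = 0 \<Longrightarrow> s = 0 \<and> t = 0 \<and> r = 0" by blast
  then obtain e f where e: "dual_bases e f" "e 1 = w" "e 2 = l" "e 3 = m"
    using dual_bases_extend_three by blast
  have D: "e i \<bullet> f j = (if i = j then 1 else 0)" for i j
    using dual_basesD[OF dual_bases_commute[OF e(1)], of i j] .
  have fw: "w \<bullet> f 1 = 1" "w \<bullet> f 2 = 0" "w \<bullet> f 3 = 0" "w \<bullet> f 4 = 0"
    and fl: "l \<bullet> f 1 = 0" "l \<bullet> f 2 = 1" "l \<bullet> f 3 = 0" "l \<bullet> f 4 = 0"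
    and fm: "m \<bullet> f 1 = 0" "m \<bullet> f 2 = 0" "m \<bullet> f 3 = 1" "m \<bullet> f 4 = 0"
    unfolding e(2-4)[symmetric] D by simp_all
  have pol: "2 * (x \<bullet> (S *v y)) = 2 * c * (w \<bullet> x) * (w \<bullet> y) + (l \<bullet> x) * (m \<bullet> y) + (m \<bullet> x) * (l \<bullet> y)" for x y
    using split_form_polar_real[OF S sp, of x y] by (simp add: algebra_simps)
  have sing: "S *v v = 0 \<longleftrightarrow> w \<bullet> v = 0 \<and> l \<bullet> v = 0 \<and> m \<bullet> v = 0" for v
  proof
    assume "S *v v = 0"
    then show "w \<bullet> v = 0 \<and> l \<bullet> v = 0 \<and> m \<bullet> v = 0"
      using pol[of "f 1" v] pol[of "f 2" v] pol[of "f 3" v] c by (simp add: fw fl fm)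
  next
    assume "w \<bullet> v = 0 \<and> l \<bullet> v = 0 \<and> m \<bullet> v = 0"
    then have "2 * ((S *v v) \<bullet> (S *v v)) = 0" using pol by simp
    then show "S *v v = 0" by simp
  qed
  have cone: "quadric_cone S"
  proof (rule quadric_coneI)
    show "f 4 \<noteq> 0" using D[of 4 4] by auto
    show "S *v f 4 = 0" by (simp add: sing fw fl fm)
    fix v assume "S *v v = 0"
    then have "v = (e 4 \<bullet> v) *\<^sub>R f 4"
      using dual_bases_expand_functional[OF e(1), of v] by (simp add: sing sum_4 e)
    then show "\<exists>k. v = k *\<^sub>R f 4" by blast
  qed
  have u0: "u1 \<noteq> 0" "u2 \<noteq> 0" using indep2_nonzero[OF ind] .
  note vert = vertex_real_point_iff[OF cone u0(1)] vertex_real_point_iff[OF cone u0(2)]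
  have q: "u1 \<bullet> (S *v u1) = 0" "u2 \<bullet> (S *v u2) = 0"
    using pol[of u1 u1] pol[of u2 u2] u by simp_all
  consider "S *v u1 = 0" "S *v u2 = 0" | "S *v u1 = 0" "S *v u2 \<noteq> 0" | "S *v u1 \<noteq> 0" "S *v u2 = 0"
    | "S *v u1 \<noteq> 0" "S *v u2 \<noteq> 0" by blast
  then show ?thesis
  proof cases
    case 1
    \<comment> \<open>Both centers would lie in the one-dimensional kernel of \<open>S\<close>,
      against their independence.\<close>
    obtain k1 k2 where k: "u1 = k1 *\<^sub>R f 4" "u2 = k2 *\<^sub>R f 4"
      using 1 dual_bases_expand_functional[OF e(1), of u1] dual_bases_expand_functional[OF e(1), of u2]
      by (simp add: sing sum_4 e)
    have "k2 *\<^sub>R u1 + (- k1) *\<^sub>R u2 = 0" by (simp add: k)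
    then have "k1 = 0" using indep2D(2)[OF ind] by fastforce
    then show ?thesis using u0 k by simp
  next
    case 2
    then show ?thesis using cone unfolding critical_quadric_def vert by blast
  next
    case 3
    then show ?thesis using cone unfolding critical_quadric_def vert by blast
  next
    case 4
    \<comment> \<open>As \<open>w\<close> vanishes at both centers, \<open>l\<close> at the first
      and \<open>m\<close> at the second, twice the polar value is the product of \<open>m\<close>
      at \<open>u1\<close> and \<open>l\<close> at \<open>u2\<close>. A zero factor would make a
      center the vertex.\<close>
    then have "m \<bullet> u1 \<noteq> 0" "l \<bullet> u2 \<noteq> 0" using u by (auto simp: sing)
    then have "u1 \<bullet> (S *v u2) \<noteq> 0" using pol[of u1 u2] u by auto
    then have "\<not> on_common_line S (real_point u1) (real_point u2)"
      using on_common_line_iff[OF S ind q] by blast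
    then show ?thesis using cone 4 unfolding critical_quadric_def vert by blast
  qed
qed

text \<open>Taken as coordinates, the four forms put the quadric into the standard hyperbolic shape,
  where kernel and lines can be read off from the dual basis \<open>f\<close>.\<close>

lemma critical_smooth:
  assumes S: "transpose S = S" and sp: "split_form S l1 m1 l2 m2"
    and ind: "\<And>a1 a2 b1 b2. a1 *\<^sub>R l1 + a2 *\<^sub>R l2 + b1 *\<^sub>R m1 + b2 *\<^sub>R m2 = 0
      \<Longrightarrow> a1 = 0 \<and> a2 = 0 \<and> b1 = 0 \<and> b2 = 0"
  shows "smooth_quadric S \<and> ruled S"
proof -
  let ?e = "(\<lambda>i::4. if i = 1 then l1 else if i = 2 then l2 else if i = 3 then m1 else m2)"
  have "\<exists>f. dual_bases ?e f"
  proof (rule dual_bases_exists)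
    fix k :: "4 \<Rightarrow> real"
    assume "(\<Sum>i\<in>UNIV. k i *\<^sub>R ?e i) = 0"
    then have "k 1 *\<^sub>R l1 + k 2 *\<^sub>R l2 + k 3 *\<^sub>R m1 + k 4 *\<^sub>R m2 = 0"
      by (simp add: sum_4)
    then have "\<forall>i. k i = 0" unfolding forall_4 by (rule ind)
    then show "k = (\<lambda>_. 0)" by auto
  qed
  then obtain f where e: "dual_bases ?e f" by blast
  have D: "?e i \<bullet> f j = (if i = j then 1 else 0)" for i j
    using dual_basesD[OF dual_bases_commute[OF e], of i j] .
  have d: "l1 \<bullet> f j = (if 1 = j then 1 else 0)" "l2 \<bullet> f j = (if 2 = j then 1 else 0)"
    "m1 \<bullet> f j = (if 3 = j then 1 else 0)" "m2 \<bullet> f j = (if 4 = j then 1 else 0)" for j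
    using D[of 1 j] D[of 2 j] D[of 3 j] D[of 4 j] by simp_all
  have pol: "2 * (x \<bullet> (S *v y)) = (l1 \<bullet> x) * (m1 \<bullet> y) + (m1 \<bullet> x) * (l1 \<bullet> y)
    + (l2 \<bullet> x) * (m2 \<bullet> y) + (m2 \<bullet> x) * (l2 \<bullet> y)" for x y
    by (rule split_form_polar_real[OF S sp])
  have "smooth_quadric S"
    unfolding smooth_quadric_iff
  proof (intro allI impI)
    fix v assume v: "S *v v = 0"
    have "m1 \<bullet> v = 0" "m2 \<bullet> v = 0" "l1 \<bullet> v = 0" "l2 \<bullet> v = 0"
      using pol[of "f 1" v] pol[of "f 2" v] pol[of "f 3" v] pol[of "f 4" v] v by (simp_all add: d)
    then show "v = 0" using dual_bases_expand_functional[OF e, of v] by (simp add: sum_4)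
  qed
  moreover have "ruled S"
  proof -
    let ?L = "vec.span {cvec (f 3), cvec (f 4)}"
    have nz: "cvec (f 3) \<noteq> 0" using d(3)[of 3] by auto
    have "cvec (f 4) \<notin> range (\<lambda>k. k *s cvec (f 3))"
    proof
      assume "cvec (f 4) \<in> range (\<lambda>k. k *s cvec (f 3))"
      then obtain k where "cvec (f 4) = k *s cvec (f 3)" by blast
      then have "dotc m2 (cvec (f 4)) = dotc m2 (k *s cvec (f 3))" by simp
      then show False by (simp add: d)
    qed
    then have "?L \<in> proj_lines" using span_pair_proj_line[OF nz] by blast
    moreover have "real_subspace ?L"
      unfolding real_subspace_def by (rule exI[of _ "{f 3, f 4}"]) simp
    moreover have "?L \<subseteq> surface S"
    proof
      fix v assume "v \<in> ?L"
      then obtain s t where "v = s *s cvec (f 3) + t *s cvec (f 4)" unfolding span_pair_iff by blast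
      then show "v \<in> surface S" unfolding split_form_surface[OF S sp] by (simp add: d)
    qed
    ultimately show ?thesis unfolding ruled_def by blast
  qed
  ultimately show ?thesis ..
qed

text \<open>Here \<open>w\<close> lies in both pencils.\<close>

lemma critical_common_functional:
  assumes S: "transpose S = S" "S \<noteq> 0" and ind: "indep2 u1 u2"
    and sp: "split_form S w m1 l2 m2"
    and lm: "indep2 w l2" "indep2 m1 m2"
    and u: "w \<bullet> u1 = 0" "l2 \<bullet> u1 = 0" "m1 \<bullet> u2 = 0" "m2 \<bullet> u2 = 0"
    and w: "w = b1 *\<^sub>R m1 + b2 *\<^sub>R m2"
  shows "critical_quadric (real_point u1) (real_point u2) S"
proof -
  have w0: "w \<noteq> 0" using indep2_nonzero[OF lm(1)] by simp
  have wu2: "w \<bullet> u2 = 0" using u by (simp add: w inner_add_left)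
  show ?thesis
  proof (cases "b1 = 0")
    case False
    \<comment> \<open>The relation \<open>w = b1 m1 + b2 m2\<close> eliminates \<open>m1\<close>;
      the resulting term with \<open>m2\<close> is absorbed into \<open>l2\<close>.\<close>
    let ?l = "l2 - (b2 / b1) *\<^sub>R w"
    have "split_form S w ((1 / b1) *\<^sub>R w) ?l m2"
      unfolding split_form_def
    proof
      fix x
      have q: "x \<bullet> (S *v x) = (w \<bullet> x) * (m1 \<bullet> x) + (l2 \<bullet> x) * (m2 \<bullet> x)"
        using sp by (simp add: split_form_def)
      have m: "m1 \<bullet> x = (1 / b1) * (w \<bullet> x) - (b2 / b1) * (m2 \<bullet> x)"
        using False by (simp add: w inner_add_left field_simps)
      show "x \<bullet> (S *v x) = (w \<bullet> x) * ((1 / b1) *\<^sub>R w \<bullet> x) + (?l \<bullet> x) * (m2 \<bullet> x)"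
        unfolding q m by (simp add: inner_diff_left algebra_simps)
    qed
    moreover have "indep2 w ?l"
      unfolding indep2_def
    proof (intro allI impI)
      fix s t assume "s *\<^sub>R w + t *\<^sub>R ?l = 0"
      then have "(s - t * (b2 / b1)) *\<^sub>R w + t *\<^sub>R l2 = 0" by (simp add: algebra_simps)
      from indep2D[OF lm(1) this] show "s = 0 \<and> t = 0" by simp
    qed
    moreover have "indep2 w m2"
      unfolding indep2_def
    proof (intro allI impI)
      fix s t assume "s *\<^sub>R w + t *\<^sub>R m2 = 0"
      then have "(s * b1) *\<^sub>R m1 + (s * b2 + t) *\<^sub>R m2 = 0" by (simp add: w algebra_simps)
      from indep2D[OF lm(2) this] show "s = 0 \<and> t = 0" using False by simp
    qed
    ultimately show ?thesis
      using critical_cone[OF S(1), of w "1 / b1" ?l m2] False ind u wu2 by (simp add: inner_diff_left)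
  next
    case True
    then have b2: "b2 \<noteq> 0" using w w0 by auto
    \<comment> \<open>Now \<open>m2\<close> is a multiple of \<open>w\<close>, so \<open>w\<close>
      divides the whole quadratic form.\<close>
    let ?n = "m1 + (1 / b2) *\<^sub>R l2"
    have sp': "split_form S w ?n 0 0"
      using sp b2 True unfolding split_form_def w by (simp add: inner_add_left algebra_simps)
    have "?n \<noteq> 0"
    proof
      assume n: "?n = 0"
      have "x \<bullet> (S *v x) = 0" for x using sp' unfolding split_form_def n by simp
      then show False using quadric_zeroI S by blast
    qed
    then show ?thesis using critical_product[OF S(1) sp' w0] u wu2 by blast
  qed
qed

lemma split_form_swap: "split_form S l1 m1 l2 m2 \<longleftrightarrow> split_form S l2 m2 l1 m1"
  by (simp add: split_form_def add.commute)

text \<open>\<open>w\<close> replaces \<open>l1\<close> in the first pencil, which is possible as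
  \<open>a1\<close> is nonzero. The second pair changes contragrediently, so the sum of products
  stays the same.\<close>

lemma critical_common_combination:
  assumes S: "transpose S = S" "S \<noteq> 0" and ind: "indep2 u1 u2"
    and sp: "split_form S l1 m1 l2 m2"
    and lm: "indep2 l1 l2" "indep2 m1 m2"
    and u: "l1 \<bullet> u1 = 0" "l2 \<bullet> u1 = 0" "m1 \<bullet> u2 = 0" "m2 \<bullet> u2 = 0"
    and a: "a1 *\<^sub>R l1 + a2 *\<^sub>R l2 = b1 *\<^sub>R m1 + b2 *\<^sub>R m2" "a1 \<noteq> 0"
  shows "critical_quadric (real_point u1) (real_point u2) S"
proof -
  define w where "w = a1 *\<^sub>R l1 + a2 *\<^sub>R l2"
  let ?m1 = "(1 / a1) *\<^sub>R m1" and ?m2 = "m2 - (a2 / a1) *\<^sub>R m1"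
  have sp': "split_form S w ?m1 l2 ?m2"
    using sp a(2) unfolding split_form_def w_def
    by (simp add: inner_add_left inner_diff_left field_simps)
  have wl: "indep2 w l2"
    unfolding indep2_def
  proof (intro allI impI)
    fix s t assume "s *\<^sub>R w + t *\<^sub>R l2 = 0"
    then have "(s * a1) *\<^sub>R l1 + (s * a2 + t) *\<^sub>R l2 = 0" by (simp add: w_def algebra_simps)
    from indep2D[OF lm(1) this] show "s = 0 \<and> t = 0" using a(2) by simp
  qed
  have mm: "indep2 ?m1 ?m2"
    unfolding indep2_def
  proof (intro allI impI)
    fix s t assume "s *\<^sub>R ?m1 + t *\<^sub>R ?m2 = 0"
    then have "(s / a1 - t * (a2 / a1)) *\<^sub>R m1 + t *\<^sub>R m2 = 0" by (simp add: algebra_simps)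
    from indep2D[OF lm(2) this] show "s = 0 \<and> t = 0" using a(2) by simp
  qed
  have w: "w = (b1 * a1 + b2 * a2) *\<^sub>R ?m1 + b2 *\<^sub>R ?m2"
    unfolding w_def a(1) using a(2) by (simp add: algebra_simps add_divide_distrib)
  show ?thesis
    by (rule critical_common_functional[OF S ind sp' wl mm _ _ _ _ w])
       (simp_all add: w_def u inner_add_left inner_diff_left)
qed

theorem split_form_critical:
  assumes S: "transpose S = S" "S \<noteq> 0" and ind: "indep2 u1 u2"
    and sp: "split_form S l1 m1 l2 m2"
    and lm: "indep2 l1 l2" "indep2 m1 m2"
    and u: "l1 \<bullet> u1 = 0" "l2 \<bullet> u1 = 0" "m1 \<bullet> u2 = 0" "m2 \<bullet> u2 = 0"
  shows "critical_quadric (real_point u1) (real_point u2) S"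
proof (cases "\<exists>a1 a2 b1 b2. a1 *\<^sub>R l1 + a2 *\<^sub>R l2 + b1 *\<^sub>R m1 + b2 *\<^sub>R m2 = 0
      \<and> \<not> (a1 = 0 \<and> a2 = 0 \<and> b1 = 0 \<and> b2 = 0)")
  case False
  then have "smooth_quadric S \<and> ruled S" by (intro critical_smooth[OF S(1) sp]) blast
  then show ?thesis unfolding critical_quadric_def by blast
next
  case True
  then obtain a1 a2 b1 b2 where e: "a1 *\<^sub>R l1 + a2 *\<^sub>R l2 + b1 *\<^sub>R m1 + b2 *\<^sub>R m2 = 0"
    and nz: "\<not> (a1 = 0 \<and> a2 = 0 \<and> b1 = 0 \<and> b2 = 0)" by blast
  have e': "a1 *\<^sub>R l1 + a2 *\<^sub>R l2 = (- b1) *\<^sub>R m1 + (- b2) *\<^sub>R m2"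
  proof -
    have "(a1 *\<^sub>R l1 + a2 *\<^sub>R l2) + (b1 *\<^sub>R m1 + b2 *\<^sub>R m2) = 0" using e by (simp add: add.assoc)
    then have "a1 *\<^sub>R l1 + a2 *\<^sub>R l2 = - (b1 *\<^sub>R m1 + b2 *\<^sub>R m2)" unfolding eq_neg_iff_add_eq_0 .
    then show ?thesis by simp
  qed
  show ?thesis
  proof (cases "a1 = 0")
    case False
    show ?thesis by (rule critical_common_combination[OF S ind sp lm u e' False])
  next
    case True
    \<comment> \<open>The dependence cannot involve \<open>m1\<close> and \<open>m2\<close> alone;
      so after exchanging the two summands its leading coefficient is nonzero.\<close>
    have "a2 \<noteq> 0"
    proof
      assume "a2 = 0"
      then have "b1 *\<^sub>R m1 + b2 *\<^sub>R m2 = 0" using e True by simp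
      from indep2D[OF lm(2) this] show False using nz True \<open>a2 = 0\<close> by simp
    qed
    moreover have "a2 *\<^sub>R l2 + a1 *\<^sub>R l1 = (- b2) *\<^sub>R m2 + (- b1) *\<^sub>R m1"
      using e' by (simp only: add.commute)
    ultimately show ?thesis
      using critical_common_combination[OF S ind] sp lm u
      unfolding split_form_swap[of S l1] indep2_commute[of l1] indep2_commute[of m1] by blast
  qed
qed

section \<open>Quadrics of critical type split\<close>

definition splits :: "real^4^4 \<Rightarrow> real^4 \<Rightarrow> real^4 \<Rightarrow> bool" where
  "splits S u1 u2 \<longleftrightarrow> (\<exists>l1 m1 l2 m2. split_form S l1 m1 l2 m2 \<and> indep2 l1 l2 \<and> indep2 m1 m2 \<and>
     l1 \<bullet> u1 = 0 \<and> l2 \<bullet> u1 = 0 \<and> m1 \<bullet> u2 = 0 \<and> m2 \<bullet> u2 = 0)"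

lemma splitsI:
  assumes "\<And>x. x \<bullet> (S *v x) = (l1 \<bullet> x) * (m1 \<bullet> x) + (l2 \<bullet> x) * (m2 \<bullet> x)"
    and "indep2 l1 l2" "indep2 m1 m2"
    and "l1 \<bullet> u1 = 0" "l2 \<bullet> u1 = 0" "m1 \<bullet> u2 = 0" "m2 \<bullet> u2 = 0"
  shows "splits S u1 u2"
  using assms unfolding splits_def split_form_def by blast

lemma splits_commute: "splits S u1 u2 \<Longrightarrow> splits S u2 u1"
  unfolding splits_def split_form_def by (metis mult.commute)

lemma quad_expand:
  fixes S :: "real^4^4"
  assumes d: "dual_bases b f"
  shows "x \<bullet> (S *v x) = (\<Sum>i\<in>UNIV. \<Sum>j\<in>UNIV. (f i \<bullet> x) * (f j \<bullet> x) * (b i \<bullet> (S *v b j)))"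
proof -
  have "S *v x = (\<Sum>j\<in>UNIV. (f j \<bullet> x) *\<^sub>R (S *v b j))"
    by (subst dual_bases_expand[OF d, of x]) (simp add: linear_sum[OF matrix_vector_mul_linear] matrix_vector_mult_scaleR)
  then have right: "y \<bullet> (S *v x) = (\<Sum>j\<in>UNIV. (f j \<bullet> x) * (y \<bullet> (S *v b j)))" for y
    by (simp add: inner_sum_right)
  have left: "x \<bullet> z = (\<Sum>i\<in>UNIV. (f i \<bullet> x) * (b i \<bullet> z))" for z
    by (subst dual_bases_expand[OF d, of x]) (simp add: inner_sum_left)
  show ?thesis by (subst left) (simp add: right sum_distrib_left mult_ac)
qed

lemma kernel_by_basis:
  fixes S :: "real^4^4"
  assumes d: "dual_bases b f" and 0: "\<And>i. b i \<bullet> (S *v v) = 0"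
  shows "S *v v = 0"
  using dual_bases_expand_functional[OF d, of "S *v v"] 0 by simp

text \<open>The coefficient of the mixed term \<open>f 3 * f 4\<close> can be distributed freely between the two summands;
  \<open>s\<close> is chosen so that the two left factors become independent.\<close>

lemma splits_singular:
  assumes S: "transpose S = S" and ind: "indep2 u1 u2" and u1: "S *v u1 = 0" and q2: "u2 \<bullet> (S *v u2) = 0"
  shows "splits S u1 u2"
proof -
  obtain b f where b: "dual_bases b f" "b 1 = u1" "b 2 = u2" using dual_bases_extend_two[OF ind] .
  note D = dual_basesD[OF b(1)]
  define B where "B i j = b i \<bullet> (S *v b j)" for i j
  have Bs: "B i j = B j i" for i j unfolding B_def by (rule sym_dot[OF S])
  have B1: "B i 1 = 0" for i by (simp add: B_def b u1)
  have B1': "B 1 i = 0" for i using B1 Bs by metis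
  have B2: "B 2 2 = 0" by (simp add: B_def b q2)
  define k p where "k = B 3 3 * B 4 4" and "p = 2 * B 3 4"
  \<comment> \<open>\<open>k + s (p + s)\<close> is the determinant of the coefficients of
    \<open>f 3\<close> and \<open>f 4\<close> in \<open>?l1\<close> and \<open>?l2\<close>. It is a
    monic quadratic in \<open>s\<close>, so one of 0, 1, 2 is not a root.\<close>
  obtain s where s: "k + s * (p + s) \<noteq> 0"
  proof (cases "k = 0 \<and> k + 1 * (p + 1) = 0")
    case True
    then have "k = 0" "p = - 1" by auto
    then have "k + 2 * (p + 2) \<noteq> 0" by simp
    then show ?thesis by (rule that)
  next
    case False
    then have "k + 0 * (p + 0) \<noteq> 0 \<or> k + 1 * (p + 1) \<noteq> 0" by simp
    then show ?thesis using that by blast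
  qed
  \<comment> \<open>No \<open>f 1\<close> occurs because \<open>S\<close> kills \<open>u1\<close>,
    and no square of \<open>f 2\<close> because \<open>u2\<close> lies on the quadric. Hence every
    term contains \<open>f 3\<close> or \<open>f 4\<close>, and both of these vanish at
    \<open>u2\<close>.\<close>
  let ?l1 = "B 3 3 *\<^sub>R f 3 + (p + s) *\<^sub>R f 4 + (2 * B 2 3) *\<^sub>R f 2"
  let ?l2 = "(- s) *\<^sub>R f 3 + B 4 4 *\<^sub>R f 4 + (2 * B 2 4) *\<^sub>R f 2"
  show ?thesis
  proof (rule splitsI)
    fix x
    show "x \<bullet> (S *v x) = (?l1 \<bullet> x) * (f 3 \<bullet> x) + (?l2 \<bullet> x) * (f 4 \<bullet> x)"
      unfolding quad_expand[OF b(1)] B_def[symmetric] sum_4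
      by (simp add: B1 B1' B2 p_def Bs[of 3 2] Bs[of 4 2] Bs[of 4 3] inner_add_left inner_diff_left algebra_simps)
    show "indep2 ?l1 ?l2"
      unfolding indep2_def
    proof (intro allI impI)
      fix \<sigma> \<tau> assume e: "\<sigma> *\<^sub>R ?l1 + \<tau> *\<^sub>R ?l2 = 0"
      have e3: "\<sigma> * B 3 3 - \<tau> * s = 0"
        using arg_cong[OF e, of "\<lambda>z. z \<bullet> b 3"] by (simp add: inner_add_left inner_diff_left D)
      have e4: "\<sigma> * (p + s) + \<tau> * B 4 4 = 0"
        using arg_cong[OF e, of "\<lambda>z. z \<bullet> b 4"] by (simp add: inner_add_left inner_diff_left D)
      have \<sigma>: "\<sigma> * (k + s * (p + s)) = B 4 4 * (\<sigma> * B 3 3 - \<tau> * s) + s * (\<sigma> * (p + s) + \<tau> * B 4 4)"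
        by (simp add: k_def algebra_simps)
      have \<tau>: "\<tau> * (k + s * (p + s)) = B 3 3 * (\<sigma> * (p + s) + \<tau> * B 4 4) - (p + s) * (\<sigma> * B 3 3 - \<tau> * s)"
        by (simp add: k_def algebra_simps)
      have "\<sigma> * (k + s * (p + s)) = 0" "\<tau> * (k + s * (p + s)) = 0"
        unfolding \<sigma> \<tau> e3 e4 by simp_all
      then show "\<sigma> = 0 \<and> \<tau> = 0" using s by simp
    qed
    show "indep2 (f 3) (f 4)"
    proof (rule indep2_by_dots)
      show "f 3 \<bullet> b 4 = 0" "f 4 \<bullet> b 4 \<noteq> 0" by (simp_all add: D)
      show "f 3 \<noteq> 0" using D[of 3 3] by auto
    qed
    show "?l1 \<bullet> u1 = 0" "?l2 \<bullet> u1 = 0" "f 3 \<bullet> u2 = 0" "f 4 \<bullet> u2 = 0"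
      unfolding b(2,3)[symmetric] by (simp_all add: inner_add_left inner_diff_left D)
  qed
qed

text \<open>The factor \<open>n\<close> is divided into \<open>?m\<close>, which vanishes at
  \<open>u2\<close>, and \<open>n - ?m\<close>, which vanishes at \<open>u1\<close>. Then
  \<open>w n = w ?m + (n - ?m) w\<close> has the required shape, and the nonzero values of
  \<open>n\<close> at the centers give the independence.\<close>

lemma splits_product:
  assumes sp: "split_form S w n 0 0" and ind: "indep2 u1 u2"
    and w: "w \<noteq> 0" "w \<bullet> u1 = 0" "w \<bullet> u2 = 0" and n: "n \<bullet> u1 \<noteq> 0" "n \<bullet> u2 \<noteq> 0"
  shows "splits S u1 u2"
proof -
  obtain b f where b: "dual_bases b f" "b 1 = u1" "b 2 = u2" using dual_bases_extend_two[OF ind] .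
  have D: "f 1 \<bullet> u1 = 1" "f 1 \<bullet> u2 = 0"
    using dual_basesD[OF b(1), of 1 1] dual_basesD[OF b(1), of 1 2] by (simp_all add: b)
  let ?m = "(n \<bullet> u1) *\<^sub>R f 1"
  show ?thesis
  proof (rule splitsI)
    show "x \<bullet> (S *v x) = (w \<bullet> x) * (?m \<bullet> x) + ((n - ?m) \<bullet> x) * (w \<bullet> x)" for x
      using sp unfolding split_form_def by (simp add: inner_diff_left algebra_simps)
    show "indep2 w (n - ?m)"
      by (rule indep2_by_dots[OF w(3) _ w(1)]) (simp add: inner_diff_left D n)
    have "indep2 w ?m" by (rule indep2_by_dots[OF w(2) _ w(1)]) (simp add: D n)
    then show "indep2 ?m w" by (simp only: indep2_commute)
  qed (simp_all add: w D inner_diff_left)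
qed

text \<open>Since the polar value of the centers is nonzero, they and the vertex \<open>z\<close>
  are independent and span a plane. Its equation \<open>f 4\<close> is the form common to both
  pencils.\<close>

lemma splits_cone:
  assumes S: "transpose S = S" and ind: "indep2 u1 u2"
    and q: "u1 \<bullet> (S *v u1) = 0" "u2 \<bullet> (S *v u2) = 0" and \<gamma>: "u1 \<bullet> (S *v u2) \<noteq> 0"
    and cone: "quadric_cone S"
  shows "splits S u1 u2"
proof -
  obtain z where z: "z \<noteq> 0" "S *v z = 0" "\<And>v. S *v v = 0 \<Longrightarrow> \<exists>k. v = k *\<^sub>R z"
    using quadric_coneE[OF cone] by blast
  have zS: "z \<bullet> (S *v v) = 0" for v using sym_dot[OF S, of z v] z(2) by simp
  have \<gamma>': "u2 \<bullet> (S *v u1) = u1 \<bullet> (S *v u2)" by (rule sym_dot[OF S])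
  have "s = 0 \<and> t = 0 \<and> r = 0" if e: "s *\<^sub>R u1 + t *\<^sub>R u2 + r *\<^sub>R z = 0" for s t r
  proof -
    have "s = 0"
      using arg_cong[OF e, of "\<lambda>v. v \<bullet> (S *v u2)"] \<gamma> by (simp add: inner_add_left q zS)
    moreover have "t = 0"
      using arg_cong[OF e, of "\<lambda>v. v \<bullet> (S *v u1)"] \<gamma> by (simp add: inner_add_left q zS \<gamma>')
    ultimately show ?thesis using e z(1) by simp
  qed
  then obtain b f where b: "dual_bases b f" "b 1 = u1" "b 2 = u2" "b 3 = z"
    using dual_bases_extend_three by blast
  note D = dual_basesD[OF b(1)]
  define B where "B i j = b i \<bullet> (S *v b j)" for i j
  have Bs: "B i j = B j i" for i j unfolding B_def by (rule sym_dot[OF S])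
  have B3: "B i 3 = 0" "B 3 i = 0" for i using zS by (simp_all add: B_def b z)
  have Bq: "B 1 1 = 0" "B 2 2 = 0" by (simp_all add: B_def b q)
  \<comment> \<open>Chosen so that the polar forms of \<open>u1\<close> and \<open>u2\<close> are
    \<open>g\<close> times \<open>f 2 + \<beta>1 f 4\<close> and \<open>g\<close> times
    \<open>f 1 + \<beta>2 f 4\<close>.\<close>
  define g \<beta>1 \<beta>2 where "g = B 1 2" and "\<beta>1 = B 1 4 / g" and "\<beta>2 = B 2 4 / g"
  have g: "g \<noteq> 0" using \<gamma> by (simp add: g_def B_def b)
  have B14: "B 1 4 = g * \<beta>1" "B 2 4 = g * \<beta>2" using g by (simp_all add: \<beta>1_def \<beta>2_def)
  define c where "c = B 4 4 - 2 * g * \<beta>1 * \<beta>2"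
  have c: "c \<noteq> 0"
  proof
    assume c0: "c = 0"
    \<comment> \<open>This is \<open>b 4\<close> made orthogonal to \<open>u1\<close> and
      \<open>u2\<close> with respect to \<open>S\<close>, and its product with \<open>b 4\<close> is
      \<open>c\<close>. For \<open>c = 0\<close> it would be a kernel direction besides
      \<open>z\<close>.\<close>
    let ?y = "b 4 - \<beta>2 *\<^sub>R u1 - \<beta>1 *\<^sub>R u2"
    have y: "b i \<bullet> (S *v ?y) = B i 4 - \<beta>2 * B i 1 - \<beta>1 * B i 2" for i
      by (simp add: B_def b matrix_vector_mult_diff_distrib matrix_vector_mult_scaleR inner_diff_right)
    have "\<forall>i. b i \<bullet> (S *v ?y) = 0"
      unfolding y forall_4 using c0
      by (simp add: B14 B3 Bq Bs[of 2 1] Bs[of 4 1] Bs[of 4 2] c_def flip: g_def)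
    then have "S *v ?y = 0" by (intro kernel_by_basis[OF b(1)]) blast
    then obtain k where "?y = k *\<^sub>R z" using z(3) by blast
    then have "f 4 \<bullet> ?y = k * (f 4 \<bullet> z)" by simp
    then have "f 4 \<bullet> b 4 - \<beta>2 * (f 4 \<bullet> b 1) - \<beta>1 * (f 4 \<bullet> b 2) = k * (f 4 \<bullet> b 3)"
      by (simp add: inner_diff_right b)
    then show False by (simp add: D)
  qed
  \<comment> \<open>\<open>?l\<close> and \<open>?m\<close> are multiples of the tangent planes at \<open>u1\<close> and \<open>u2\<close>; subtracting their product
     leaves a form with kernel \<open>u1, u2, z\<close>.\<close>
  let ?l = "(2 * g) *\<^sub>R (f 2 + \<beta>1 *\<^sub>R f 4)" and ?m = "f 1 + \<beta>2 *\<^sub>R f 4"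
  have f4: "f 4 \<noteq> 0" using D[of 4 4] by auto
  show ?thesis
  proof (rule splitsI)
    show "x \<bullet> (S *v x) = (f 4 \<bullet> x) * (c *\<^sub>R f 4 \<bullet> x) + (?l \<bullet> x) * (?m \<bullet> x)" for x
      unfolding quad_expand[OF b(1)] B_def[symmetric] sum_4
      by (simp add: B14 B3 Bq Bs[of 2 1] Bs[of 4 1] Bs[of 4 2] c_def inner_add_left algebra_simps flip: g_def)
    show "indep2 (f 4) ?l"
      by (rule indep2_by_dots[of _ "b 2"]) (simp_all add: D inner_add_left g f4)
    show "indep2 (c *\<^sub>R f 4) ?m"
      by (rule indep2_by_dots[of _ "b 1"]) (simp_all add: D inner_add_left c f4)
    show "f 4 \<bullet> u1 = 0" "?l \<bullet> u1 = 0" "(c *\<^sub>R f 4) \<bullet> u2 = 0" "?m \<bullet> u2 = 0"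
      unfolding b(2,3)[symmetric] by (simp_all add: inner_add_left D)
  qed
qed

section \<open>Smooth ruled quadrics as determinants of real linear forms\<close>

lemma perpendicular_pair:
  fixes a b s1 s2 :: real
  assumes "s1 \<noteq> 0 \<or> s2 \<noteq> 0" and "s1 * a + s2 * b = 0"
  obtains p where "a = - s2 * p" "b = s1 * p"
proof (cases "s1 = 0")
  case True
  then have "s2 \<noteq> 0" "b = 0" using assms by auto
  then show ?thesis using that[of "- a / s2"] True by simp
next
  case False
  have "s1 * a = - s2 * b" using assms(2) by simp
  then have "a = - s2 * (b / s1)" using False by (simp add: field_simps)
  then show ?thesis using that[of "b / s1"] False by simp
qed

text \<open>A nonzero column \<open>(x, y)\<close> is annihilated by \<open>(y, - x)\<close>, and
  the vanishing determinant makes this annihilate the other column too.\<close>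

lemma singular_two_by_two:
  fixes a b c d :: real
  assumes "a * d - b * c = 0"
  obtains s t where "s \<noteq> 0 \<or> t \<noteq> 0" "s * a + t * c = 0" "s * b + t * d = 0"
proof -
  consider "a \<noteq> 0 \<or> c \<noteq> 0" | "a = 0" "c = 0" "b \<noteq> 0 \<or> d \<noteq> 0" | "a = 0" "b = 0" "c = 0" "d = 0" by blast
  then show ?thesis
  proof cases
    case 1
    then show ?thesis using that[of c "- a"] assms by (auto simp: algebra_simps)
  next
    case 2
    then show ?thesis using that[of d "- b"] by (auto simp: algebra_simps)
  next
    case 3
    then show ?thesis using that[of 1 0] by simp
  qed
qed

text \<open>The quadratic form is the determinant of the matrix with rows \<open>(N1, - K2)\<close> and \<open>(N2, K1)\<close>.  The two
  rulings of the quadric are given by the left and the right kernels of this matrix; here the rows are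
  combined with the left kernels at the two points.\<close>

lemma splits_determinant:
  assumes q: "\<And>x. x \<bullet> (S *v x) = (N1 \<bullet> x) * (K1 \<bullet> x) + (N2 \<bullet> x) * (K2 \<bullet> x)"
    and ker: "\<And>x. N1 \<bullet> x = 0 \<Longrightarrow> N2 \<bullet> x = 0 \<Longrightarrow> K1 \<bullet> x = 0 \<Longrightarrow> K2 \<bullet> x = 0 \<Longrightarrow> x = 0"
    and st: "s1 * t2 - s2 * t1 \<noteq> 0"
    and u1: "(s1 *\<^sub>R N1 + s2 *\<^sub>R N2) \<bullet> u1 = 0" "(s2 *\<^sub>R K1 - s1 *\<^sub>R K2) \<bullet> u1 = 0"
    and u2: "(t1 *\<^sub>R N1 + t2 *\<^sub>R N2) \<bullet> u2 = 0" "(t2 *\<^sub>R K1 - t1 *\<^sub>R K2) \<bullet> u2 = 0"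
  shows "splits S u1 u2"
proof -
  let ?g = "\<lambda>i::4. if i = 1 then N1 else if i = 2 then N2 else if i = 3 then K1 else K2"
  have "\<exists>b. dual_bases b ?g"
  proof (rule dual_bases_exists_kernel)
    fix x :: "real^4" assume h: "\<And>i. ?g i \<bullet> x = 0"
    show "x = 0" using h[of 1] h[of 2] h[of 3] h[of 4] by (intro ker) simp_all
  qed
  then obtain b where b: "dual_bases b ?g" by blast
  have d: "N1 \<bullet> b j = (if 1 = j then 1 else 0)" "N2 \<bullet> b j = (if 2 = j then 1 else 0)"
    "K1 \<bullet> b j = (if 3 = j then 1 else 0)" "K2 \<bullet> b j = (if 4 = j then 1 else 0)" for j
    using dual_basesD[OF b, of 1 j] dual_basesD[OF b, of 2 j] dual_basesD[OF b, of 3 j] dual_basesD[OF b, of 4 j]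
    by simp_all
  have ind: "indep2 (r *\<^sub>R N1 + r' *\<^sub>R N2) (r' *\<^sub>R K1 - r *\<^sub>R K2)" if "r \<noteq> 0 \<or> r' \<noteq> 0" for r r'
    unfolding indep2_def
  proof (intro allI impI)
    fix \<sigma> \<tau> assume e: "\<sigma> *\<^sub>R (r *\<^sub>R N1 + r' *\<^sub>R N2) + \<tau> *\<^sub>R (r' *\<^sub>R K1 - r *\<^sub>R K2) = 0"
    have "(\<sigma> *\<^sub>R (r *\<^sub>R N1 + r' *\<^sub>R N2) + \<tau> *\<^sub>R (r' *\<^sub>R K1 - r *\<^sub>R K2)) \<bullet> b j = 0" for j
      unfolding e by simp
    from this[of 1] this[of 2] this[of 3] this[of 4]
    show "\<sigma> = 0 \<and> \<tau> = 0" using that by (auto simp: inner_add_left inner_diff_left d)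
  qed
  define \<delta> where "\<delta> = s1 * t2 - s2 * t1"
  have \<delta>: "\<delta> \<noteq> 0" using st by (simp add: \<delta>_def)
  let ?l1 = "s1 *\<^sub>R N1 + s2 *\<^sub>R N2" and ?l2 = "s2 *\<^sub>R K1 - s1 *\<^sub>R K2"
  let ?x = "t1 *\<^sub>R N1 + t2 *\<^sub>R N2" and ?y = "t2 *\<^sub>R K1 - t1 *\<^sub>R K2"
  show ?thesis
  proof (rule splitsI)
    fix x
    \<comment> \<open>Replacing the rows by their combinations with coefficients
      \<open>s1, s2\<close> and \<open>t1, t2\<close> multiplies the determinant by
      \<open>\<delta>\<close>.\<close>
    have "(?l1 \<bullet> x) * (?y \<bullet> x) - (?l2 \<bullet> x) * (?x \<bullet> x) = \<delta> * (x \<bullet> (S *v x))"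
      unfolding q \<delta>_def by (simp add: inner_add_left inner_diff_left algebra_simps)
    then show "x \<bullet> (S *v x) = (?l1 \<bullet> x) * ((1 / \<delta>) *\<^sub>R ?y \<bullet> x) + (?l2 \<bullet> x) * ((- 1 / \<delta>) *\<^sub>R ?x \<bullet> x)"
      using \<delta> unfolding inner_scaleR_left by (simp add: divide_simps)
    show "indep2 ?l1 ?l2" using st by (intro ind) auto
    have xy: "indep2 ?x ?y" using st by (intro ind) auto
    show "indep2 ((1 / \<delta>) *\<^sub>R ?y) ((- 1 / \<delta>) *\<^sub>R ?x)"
      unfolding indep2_def
    proof (intro allI impI)
      fix \<sigma> \<tau> assume "\<sigma> *\<^sub>R (1 / \<delta>) *\<^sub>R ?y + \<tau> *\<^sub>R (- 1 / \<delta>) *\<^sub>R ?x = 0"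
      then have "(\<tau> * (- 1 / \<delta>)) *\<^sub>R ?x + (\<sigma> * (1 / \<delta>)) *\<^sub>R ?y = 0"
        by (simp only: scaleR_scaleR add.commute)
      from indep2D[OF xy this] show "\<sigma> = 0 \<and> \<tau> = 0" using \<delta> by simp
    qed
    show "?l1 \<bullet> u1 = 0" "?l2 \<bullet> u1 = 0" by (fact u1)+
    show "((1 / \<delta>) *\<^sub>R ?y) \<bullet> u2 = 0" "((- 1 / \<delta>) *\<^sub>R ?x) \<bullet> u2 = 0"
      unfolding inner_scaleR_left u2 by simp_all
  qed
qed

lemma proportional_pair:
  fixes s1 s2 t1 t2 :: real
  assumes "t1 \<noteq> 0 \<or> t2 \<noteq> 0" and "s1 * t2 - s2 * t1 = 0"
  obtains k where "s1 = k * t1" "s2 = k * t2"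
proof -
  have "t2 \<noteq> 0 \<or> - t1 \<noteq> 0" "t2 * s1 + (- t1) * s2 = 0" using assms by (auto simp: algebra_simps)
  then obtain k where "s1 = - (- t1) * k" "s2 = t2 * k" by (rule perpendicular_pair)
  then show ?thesis using that[of k] by (simp add: mult.commute)
qed

text \<open>If the left kernels at the two points agree, the right kernels are used instead, which amounts to
  transposing the matrix.  If both agree, then the matrices at the two points are proportional.\<close>

lemma splits_four_forms:
  assumes ind: "indep2 u1 u2"
    and q: "\<And>x. x \<bullet> (S *v x) = (N1 \<bullet> x) * (K1 \<bullet> x) + (N2 \<bullet> x) * (K2 \<bullet> x)"
    and ker: "\<And>x. N1 \<bullet> x = 0 \<Longrightarrow> N2 \<bullet> x = 0 \<Longrightarrow> K1 \<bullet> x = 0 \<Longrightarrow> K2 \<bullet> x = 0 \<Longrightarrow> x = 0"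
    and u: "u1 \<bullet> (S *v u1) = 0" "u2 \<bullet> (S *v u2) = 0"
  shows "splits S u1 u2"
proof -
  define n1 n2 k1 k2 where "n1 x = N1 \<bullet> x" and "n2 x = N2 \<bullet> x" and "k1 x = K1 \<bullet> x" and "k2 x = K2 \<bullet> x" for x
  note defs = n1_def n2_def k1_def k2_def
  have rows: "\<exists>s t. (s \<noteq> 0 \<or> t \<noteq> 0) \<and> s * n1 v + t * n2 v = 0 \<and> t * k1 v - s * k2 v = 0"
    and cols: "\<exists>s t. (s \<noteq> 0 \<or> t \<noteq> 0) \<and> s * n1 v - t * k2 v = 0 \<and> s * n2 v + t * k1 v = 0"
    if "v \<bullet> (S *v v) = 0" for v
  proof -
    have "n1 v * k1 v - (- k2 v) * n2 v = 0" using that unfolding q defs by (simp add: algebra_simps)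
    then obtain s t where "s \<noteq> 0 \<or> t \<noteq> 0" "s * n1 v + t * n2 v = 0" "s * (- k2 v) + t * k1 v = 0"
      by (rule singular_two_by_two)
    then show "\<exists>s t. (s \<noteq> 0 \<or> t \<noteq> 0) \<and> s * n1 v + t * n2 v = 0 \<and> t * k1 v - s * k2 v = 0"
      by (intro exI[of _ s] exI[of _ t]) (simp add: algebra_simps)
    have "n1 v * k1 v - n2 v * (- k2 v) = 0" using that unfolding q defs by (simp add: algebra_simps)
    then obtain s t where "s \<noteq> 0 \<or> t \<noteq> 0" "s * n1 v + t * (- k2 v) = 0" "s * n2 v + t * k1 v = 0"
      by (rule singular_two_by_two)
    then show "\<exists>s t. (s \<noteq> 0 \<or> t \<noteq> 0) \<and> s * n1 v - t * k2 v = 0 \<and> s * n2 v + t * k1 v = 0"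
      by (intro exI[of _ s] exI[of _ t]) (simp add: algebra_simps)
  qed
  obtain s1 s2 where s: "s1 \<noteq> 0 \<or> s2 \<noteq> 0" "s1 * n1 u1 + s2 * n2 u1 = 0" "s2 * k1 u1 - s1 * k2 u1 = 0"
    using rows[OF u(1)] by blast
  obtain s1' s2' where s': "s1' \<noteq> 0 \<or> s2' \<noteq> 0" "s1' * n1 u2 + s2' * n2 u2 = 0" "s2' * k1 u2 - s1' * k2 u2 = 0"
    using rows[OF u(2)] by blast
  obtain t1 t2 where t: "t1 \<noteq> 0 \<or> t2 \<noteq> 0" "t1 * n1 u1 - t2 * k2 u1 = 0" "t1 * n2 u1 + t2 * k1 u1 = 0"
    using cols[OF u(1)] by blast
  obtain t1' t2' where t': "t1' \<noteq> 0 \<or> t2' \<noteq> 0" "t1' * n1 u2 - t2' * k2 u2 = 0" "t1' * n2 u2 + t2' * k1 u2 = 0"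
    using cols[OF u(2)] by blast
  consider "s1 * s2' - s2 * s1' \<noteq> 0" | "t1 * t2' - t2 * t1' \<noteq> 0"
    | "s1 * s2' - s2 * s1' = 0" "t1 * t2' - t2 * t1' = 0" by blast
  then show ?thesis
  proof cases
    case 1
    show ?thesis
    proof (rule splits_determinant[OF q ker 1])
      show "(s1 *\<^sub>R N1 + s2 *\<^sub>R N2) \<bullet> u1 = 0" "(s2 *\<^sub>R K1 - s1 *\<^sub>R K2) \<bullet> u1 = 0"
        using s by (simp_all add: defs inner_add_left inner_diff_left)
      show "(s1' *\<^sub>R N1 + s2' *\<^sub>R N2) \<bullet> u2 = 0" "(s2' *\<^sub>R K1 - s1' *\<^sub>R K2) \<bullet> u2 = 0"
        using s' by (simp_all add: defs inner_add_left inner_diff_left)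
    qed
  next
    case 2
    show ?thesis
    proof (rule splits_determinant[of S N1 K1 "- K2" "- N2" t1 t2' t2 t1'])
      show "x \<bullet> (S *v x) = (N1 \<bullet> x) * (K1 \<bullet> x) + (- K2 \<bullet> x) * (- N2 \<bullet> x)" for x
        unfolding q by (simp add: mult.commute)
      show "x = 0" if "N1 \<bullet> x = 0" "- K2 \<bullet> x = 0" "K1 \<bullet> x = 0" "- N2 \<bullet> x = 0" for x
        using that by (intro ker) simp_all
      show "t1 * t2' - t2 * t1' \<noteq> 0" by (fact 2)
      show "(t1 *\<^sub>R N1 + t2 *\<^sub>R - K2) \<bullet> u1 = 0" "(t2 *\<^sub>R K1 - t1 *\<^sub>R - N2) \<bullet> u1 = 0"
        using t by (simp_all add: defs inner_add_left inner_diff_left)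
      show "(t1' *\<^sub>R N1 + t2' *\<^sub>R - K2) \<bullet> u2 = 0" "(t2' *\<^sub>R K1 - t1' *\<^sub>R - N2) \<bullet> u2 = 0"
        using t' by (simp_all add: defs inner_add_left inner_diff_left)
    qed
  next
    case 3
    \<comment> \<open>Prescribed left and right kernels determine a singular two by two matrix up to
      the factor \<open>c\<close>.\<close>
    have scale: "\<exists>c. n1 v = s2 * t2 * c \<and> n2 v = - s1 * t2 * c \<and> k2 v = s2 * t1 * c \<and> k1 v = s1 * t1 * c"
      if v: "s1 * n1 v + s2 * n2 v = 0" "s2 * k1 v - s1 * k2 v = 0"
        "t1 * n1 v - t2 * k2 v = 0" "t1 * n2 v + t2 * k1 v = 0" for v
    proof -
      obtain p where p: "n1 v = - s2 * p" "n2 v = s1 * p" using perpendicular_pair[OF s(1) v(1)] .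
      have "s1 * (- k2 v) + s2 * k1 v = 0" using v(2) by (simp add: algebra_simps)
      then obtain r where r: "- k2 v = - s2 * r" "k1 v = s1 * r" using perpendicular_pair[OF s(1)] by blast
      have k2: "k2 v = s2 * r" using r(1) by simp
      have "s2 * (t1 * p + t2 * r) = 0" "s1 * (t1 * p + t2 * r) = 0"
        using v(3,4) unfolding p r(2) k2 by (simp_all add: algebra_simps)
      then have "t1 * p + t2 * r = 0" using s(1) by auto
      then obtain c where "p = - t2 * c" "r = t1 * c" using perpendicular_pair[OF t(1)] by blast
      then show ?thesis unfolding p r(2) k2 by (intro exI[of _ c]) simp
    qed
    obtain c where c: "n1 u1 = s2 * t2 * c" "n2 u1 = - s1 * t2 * c" "k2 u1 = s2 * t1 * c" "k1 u1 = s1 * t1 * c"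
      using scale[OF s(2,3) t(2,3)] by blast
    obtain k where k: "s1 = k * s1'" "s2 = k * s2'" using proportional_pair[OF s'(1) 3(1)] .
    obtain m where m: "t1 = m * t1'" "t2 = m * t2'" using proportional_pair[OF t'(1) 3(2)] .
    have "s1 * n1 u2 + s2 * n2 u2 = k * (s1' * n1 u2 + s2' * n2 u2)"
      "s2 * k1 u2 - s1 * k2 u2 = k * (s2' * k1 u2 - s1' * k2 u2)"
      "t1 * n1 u2 - t2 * k2 u2 = m * (t1' * n1 u2 - t2' * k2 u2)"
      "t1 * n2 u2 + t2 * k1 u2 = m * (t1' * n2 u2 + t2' * k1 u2)"
      unfolding k m by (simp_all add: algebra_simps)
    then obtain d where d: "n1 u2 = s2 * t2 * d" "n2 u2 = - s1 * t2 * d" "k2 u2 = s2 * t1 * d" "k1 u2 = s1 * t1 * d"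
      using scale[of u2] unfolding s'(2,3) t'(2,3) by auto
    \<comment> \<open>The values of the four forms at the two points are \<open>c\<close> and
      \<open>d\<close> times the same quadruple, so this combination is a common zero.\<close>
    have z: "d *\<^sub>R u1 + (- c) *\<^sub>R u2 = 0"
      by (rule ker) (use c d in \<open>simp_all add: defs inner_add_right inner_diff_right\<close>)
    have "c = 0" using indep2D(2)[OF ind z] by simp
    then have "u1 = 0" using c by (intro ker) (simp_all add: defs)
    then show ?thesis using indep2_nonzero[OF ind] by blast
  qed
qed

text \<open>A real line is spanned by real vectors, and two of them must be independent for
  dimension reasons. The quadratic form at their sum gives the polar condition.\<close>

lemma ruled_isotropic:
  assumes S: "transpose S = S" and "ruled S"
  obtains a b where "indep2 a b" "a \<bullet> (S *v a) = 0" "b \<bullet> (S *v b) = 0" "a \<bullet> (S *v b) = 0"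
proof -
  obtain L U where L: "L \<in> proj_lines" "L \<subseteq> surface S" "L = vec.span (cvec ` U)"
    using assms(2) unfolding ruled_def real_subspace_def by blast
  have not_small: "\<not> cvec ` U \<subseteq> vec.span {c}" for c
  proof
    assume "cvec ` U \<subseteq> vec.span {c}"
    then have "L \<subseteq> vec.span {c}" unfolding L(3) by (intro vec.span_minimal) simp_all
    then have "vec.dim L \<le> card {c}" by (rule vec.dim_le_card) simp
    then show False using L(1) by (simp add: proj_lines_def)
  qed
  obtain a where a: "a \<in> U" "cvec a \<notin> vec.span {0}" using not_small[of 0] by blast
  have a0: "a \<noteq> 0"
  proof
    assume "a = 0"
    then have "cvec a \<in> vec.span {0}" using vec.span_zero by simp
    then show False using a(2) by blast
  qed
  obtain b where b: "b \<in> U" "cvec b \<notin> vec.span {cvec a}" using not_small[of "cvec a"] by blast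
  have ind: "indep2 a b"
  proof (rule ccontr)
    assume "\<not> indep2 a b"
    then obtain k where k: "b = k *\<^sub>R a" using not_indep2E a0 by metis
    have "cvec b \<in> vec.span {cvec a}" unfolding k cvec_scale by (intro vec.span_scale vec.span_base) simp
    then show False using b(2) by blast
  qed
  have aL: "cvec a \<in> L" and bL: "cvec b \<in> L" unfolding L(3) using a b by (auto intro: vec.span_base)
  then have "cvec (a + b) \<in> L" unfolding cvec_add by (rule proj_line_add[OF L(1)])
  then have ab: "(a + b) \<bullet> (S *v (a + b)) = 0" using L(2) surface_cvec by blast
  have q: "a \<bullet> (S *v a) = 0" "b \<bullet> (S *v b) = 0" using aL bL L(2) surface_cvec by blast+
  have "a \<bullet> (S *v b) = 0"
    using ab q sym_dot[OF S, of b a] by (simp add: matrix_vector_right_distrib inner_add_left inner_add_right)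
  then show ?thesis using that ind q by blast
qed

text \<open>With \<open>b 1\<close> and \<open>b 2\<close> spanning a real line on the quadric,
  every term of the quadratic form has a factor \<open>f 3\<close> or \<open>f 4\<close>. Collecting
  the cofactors gives the four forms, and smoothness excludes a common zero.\<close>

lemma splits_smooth:
  assumes S: "transpose S = S" and ind: "indep2 u1 u2"
    and u: "u1 \<bullet> (S *v u1) = 0" "u2 \<bullet> (S *v u2) = 0"
    and smooth: "smooth_quadric S" and ruled: "ruled S"
  shows "splits S u1 u2"
proof -
  obtain a c where ac: "indep2 a c" "a \<bullet> (S *v a) = 0" "c \<bullet> (S *v c) = 0" "a \<bullet> (S *v c) = 0"
    using ruled_isotropic[OF S ruled] .
  obtain b f where b: "dual_bases b f" "b 1 = a" "b 2 = c" using dual_bases_extend_two[OF ac(1)] .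
  define B where "B i j = b i \<bullet> (S *v b j)" for i j
  have Bs: "B i j = B j i" for i j unfolding B_def by (rule sym_dot[OF S])
  have B0: "B 1 1 = 0" "B 2 2 = 0" "B 1 2 = 0" "B 2 1 = 0"
    using Bs[of 1 2] by (simp_all add: B_def b ac)
  let ?K1 = "(2 * B 1 3) *\<^sub>R f 1 + (2 * B 2 3) *\<^sub>R f 2 + B 3 3 *\<^sub>R f 3 + (2 * B 3 4) *\<^sub>R f 4"
  let ?K2 = "(2 * B 1 4) *\<^sub>R f 1 + (2 * B 2 4) *\<^sub>R f 2 + B 4 4 *\<^sub>R f 4"
  show ?thesis
  proof (rule splits_four_forms[OF ind _ _ u])
    show "x \<bullet> (S *v x) = (f 3 \<bullet> x) * (?K1 \<bullet> x) + (f 4 \<bullet> x) * (?K2 \<bullet> x)" for x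
      unfolding quad_expand[OF b(1)] B_def[symmetric] sum_4
      by (simp add: B0 Bs[of 3 1] Bs[of 3 2] Bs[of 4 1] Bs[of 4 2] Bs[of 4 3] inner_add_left algebra_simps)
    \<comment> \<open>Such an \<open>x\<close> lies on the chosen line, where \<open>?K1\<close> and
      \<open>?K2\<close> are twice the products of \<open>b 3\<close> and \<open>b 4\<close> with
      \<open>S *v x\<close>; hence \<open>x\<close> is in the kernel of \<open>S\<close>.\<close>
    fix x assume h: "f 3 \<bullet> x = 0" "f 4 \<bullet> x = 0" "?K1 \<bullet> x = 0" "?K2 \<bullet> x = 0"
    have x: "x = (f 1 \<bullet> x) *\<^sub>R b 1 + (f 2 \<bullet> x) *\<^sub>R b 2"
      using dual_bases_expand[OF b(1), of x] h(1,2) by (simp add: sum_4)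
    have bx: "b i \<bullet> (S *v x) = (f 1 \<bullet> x) * B i 1 + (f 2 \<bullet> x) * B i 2" for i
      by (subst x) (simp add: B_def matrix_vector_right_distrib matrix_vector_mult_scaleR inner_add_right)
    have "\<forall>i. b i \<bullet> (S *v x) = 0"
      unfolding forall_4 bx
      using h by (simp add: B0 Bs[of 3 1] Bs[of 3 2] Bs[of 4 1] Bs[of 4 2] inner_add_left algebra_simps)
    then have "S *v x = 0" by (intro kernel_by_basis[OF b(1)]) blast
    then show "x = 0" using smooth unfolding smooth_quadric_iff by blast
  qed
qed

text \<open>Translation by multiples of \<open>u\<close> preserves both planes, hence the surface.
  But along \<open>x + t u\<close> the quadratic form is affine in \<open>t\<close>, and a nonzero
  slope would give exactly one zero. \<open>H\<close> and \<open>K\<close> may coincide, which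
  covers double planes.\<close>

lemma plane_union_singular:
  assumes S: "transpose S = S" and surf: "surface S = H \<union> K" and sub: "vec.subspace H" "vec.subspace K"
    and u: "cvec u \<in> H" "cvec u \<in> K"
  shows "S *v u = 0"
proof -
  have q: "polar_form S (cvec u) (cvec u) = 0" using surf u by (auto simp: surface_def)
  have expand: "polar_form S (x + t *s cvec u) (x + t *s cvec u) = polar_form S x x + 2 * t * polar_form S x (cvec u)" for x t
    using polar_form_sym[OF S, of "cvec u" x] by (simp add: polar_form_linear q)
  have move: "x \<in> surface S" if "x + t *s cvec u \<in> surface S" for x t
  proof -
    have "x = (x + t *s cvec u) - t *s cvec u" by simp
    moreover have "t *s cvec u \<in> H" "t *s cvec u \<in> K" using sub u vec.subspace_scale by blast+
    ultimately show ?thesis using that sub vec.subspace_diff unfolding surf by (metis Un_iff)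
  qed
  have "polar_form S x (cvec u) = 0" for x
  proof (rule ccontr)
    assume n: "polar_form S x (cvec u) \<noteq> 0"
    have "x + (- polar_form S x x / (2 * polar_form S x (cvec u))) *s cvec u \<in> surface S"
      unfolding surface_def mem_Collect_eq expand using n by simp
    then have x: "x \<in> surface S" by (rule move)
    have "(x + 1 *s cvec u) + (-1) *s cvec u \<in> surface S" using x by simp
    then have "x + 1 *s cvec u \<in> surface S" by (rule move)
    then show False using x n unfolding surface_def mem_Collect_eq expand by simp
  qed
  then have "cmat S *v cvec u = 0" unfolding cmat_eq_0_iff_polar by blast
  then show ?thesis by (simp add: cmat_cvec)
qed

lemma plane_scale: "H \<in> proj_planes \<Longrightarrow> v \<in> H \<Longrightarrow> k *s v \<in> H"
  by (auto simp: proj_planes_def intro: vec.subspace_scale)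

lemma real_point_subset_plane:
  assumes "H \<in> proj_planes"
  shows "real_point u \<subseteq> H \<longleftrightarrow> cvec u \<in> H"
  using plane_scale[OF assms, of "cvec u"] subsetD[OF _ range_scale_self[of "cvec u"], of H] by auto

text \<open>The planes are known only as sets, so their equations must be recovered from
  \<open>S\<close>: the polar form of \<open>u1\<close> cuts out \<open>H\<close>, and dividing by
  it yields the second factor.\<close>

lemma splits_one_plane:
  assumes S: "transpose S = S" and ind: "indep2 u1 u2"
    and un: "union_of_planes S H K"
    and H: "cvec u1 \<in> H" "cvec u2 \<in> H" and K: "cvec u1 \<notin> K" "cvec u2 \<notin> K"
  shows "splits S u1 u2"
proof -
  have planes: "H \<in> proj_planes" "K \<in> proj_planes" "H \<noteq> K" and surf: "surface S = H \<union> K"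
    using un by (auto simp: union_of_planes_def)
  have subH: "vec.subspace H" "vec.dim H = 3" and subK: "vec.subspace K" "vec.dim K = 3"
    using planes by (auto simp: proj_planes_def)
  have "\<not> K \<subseteq> H"
  proof
    assume "K \<subseteq> H"
    then have "K = H" using subH subK by (intro vec.subspace_dim_equal) auto
    then show False using planes by simp
  qed
  then obtain y where y: "y \<in> K" "y \<notin> H" by blast
  \<comment> \<open>If \<open>u\<close> were singular, adding it to a point \<open>y\<close> of
    \<open>K\<close> outside \<open>H\<close> would stay on the surface, although the sum lies in
    neither plane.\<close>
  have nonsing: "S *v u \<noteq> 0" if "cvec u \<in> H" "cvec u \<notin> K" for u
  proof
    assume "S *v u = 0"
    then have z: "polar_form S x (cvec u) = 0" for x
      using cmat_eq_0_iff_polar[of S "cvec u"] by (simp add: cmat_cvec)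
    have "y \<in> surface S" using y surf by blast
    then have "y + cvec u \<in> surface S"
      using z polar_form_sym[OF S, of "cvec u"] by (simp add: surface_def polar_form_linear)
    then consider "y + cvec u \<in> H" | "y + cvec u \<in> K" using surf by blast
    then show False
    proof cases
      case 1
      then have "(y + cvec u) - cvec u \<in> H" using subH(1) that(1) by (intro vec.subspace_diff)
      then show False using y by simp
    next
      case 2
      then have "(y + cvec u) - y \<in> K" using subK(1) y(1) by (intro vec.subspace_diff)
      then show False using that by simp
    qed
  qed
  define w where "w = S *v u1"
  have w0: "w \<noteq> 0" using nonsing[OF H(1) K(1)] by (simp add: w_def)
  have dotw: "dotc w v = polar_form S v (cvec u1)" for v
    unfolding w_def polar_form_cmat cmat_cvec by (simp add: dotc_def cvec_def mult.commute)
  have q1: "u1 \<bullet> (S *v u1) = 0" using H(1) surf surface_cvec by blast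
  \<comment> \<open>\<open>w\<close> is the tangent plane at \<open>u1\<close>; it contains
    \<open>H\<close>, because \<open>H\<close> lies on the quadric and passes through
    \<open>u1\<close>. Equality follows by dimension.\<close>
  have sub: "H \<subseteq> {v. dotc w v = 0}"
  proof
    fix h assume h: "h \<in> H"
    then have "h + cvec u1 \<in> H" using H(1) subH(1) by (intro vec.subspace_add)
    then have "h + cvec u1 \<in> surface S" "h \<in> surface S" using surf h by blast+
    then have "2 * polar_form S h (cvec u1) = 0"
      using q1 polar_form_sym[OF S, of "cvec u1" h] by (simp add: surface_def polar_form_linear polar_form_cvec)
    then show "h \<in> {v. dotc w v = 0}" by (simp add: dotw)
  qed
  have Hw: "H = {v. dotc w v = 0}"
    using sub subH real_plane[OF w0] by (intro vec.subspace_dim_equal) (auto simp: proj_planes_def)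
  define x0 where "x0 = (1 / (w \<bullet> w)) *\<^sub>R w"
  have x0: "w \<bullet> x0 = 1" using w0 by (simp add: x0_def)
  \<comment> \<open>Found by writing \<open>x\<close> as \<open>h\<close> plus the multiple
    \<open>w \<bullet> x\<close> of \<open>x0\<close>, with \<open>h\<close> in \<open>H\<close>,
    and expanding the quadratic form, which vanishes at \<open>h\<close>.\<close>
  define n where "n = 2 *\<^sub>R (S *v x0) - (x0 \<bullet> (S *v x0)) *\<^sub>R w"
  have sp: "split_form S w n 0 0"
    unfolding split_form_def
  proof
    fix x
    define h where "h = x - (w \<bullet> x) *\<^sub>R x0"
    have "w \<bullet> h = 0" using x0 by (simp add: h_def inner_diff_right)
    then have "cvec h \<in> H" by (simp add: Hw)
    then have h: "h \<bullet> (S *v h) = 0" using surf surface_cvec by blast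
    show "x \<bullet> (S *v x) = (w \<bullet> x) * (n \<bullet> x) + (0 \<bullet> x) * (0 \<bullet> x)"
      using h sym_dot[OF S, of x0 x] inner_commute[of "S *v x0" x] unfolding h_def n_def
      by (simp add: matrix_vector_mult_diff_distrib matrix_vector_mult_scaleR inner_diff_left inner_diff_right
          algebra_simps)
  qed
  have wu: "w \<bullet> u1 = 0" "w \<bullet> u2 = 0" using H unfolding Hw by simp_all
  have n_at: "n \<bullet> u \<noteq> 0" if "w \<bullet> u = 0" "S *v u \<noteq> 0" for u
  proof
    assume "n \<bullet> u = 0"
    then have "y \<bullet> (S *v u) = 0" for y
      using split_form_polar_real[OF S sp, of y u] that(1) by simp
    then have "S *v u = 0" by (metis inner_eq_zero_iff)
    then show False using that(2) by blast
  qed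
  show ?thesis
    using splits_product[OF sp ind w0 wu] n_at wu nonsing H K by blast
qed

text \<open>A center at a singular point is settled by one construction for all such quadrics:
  vertex of a cone, intersection line of two planes, double plane. The remaining types each have
  their own splitting.\<close>

theorem critical_quadric_splits:
  assumes S: "transpose S = S" and ind: "indep2 u1 u2"
    and q: "u1 \<bullet> (S *v u1) = 0" "u2 \<bullet> (S *v u2) = 0"
    and crit: "critical_quadric (real_point u1) (real_point u2) S"
  shows "splits S u1 u2"
proof -
  note u0 = indep2_nonzero[OF ind]
  have ind': "indep2 u2 u1" using ind by (simp only: indep2_commute)
  have singular1: "splits S u1 u2" if "S *v u1 = 0" by (rule splits_singular[OF S ind that q(2)])
  have singular2: "splits S u1 u2" if "S *v u2 = 0"
    by (rule splits_commute[OF splits_singular[OF S ind' that q(1)]])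
  have meet: "S *v u = 0" if "union_of_planes S H K" "real_point u \<subseteq> H \<inter> K" for u H K
  proof (rule plane_union_singular[OF S])
    show "surface S = H \<union> K" "vec.subspace H" "vec.subspace K"
      using that(1) by (auto simp: union_of_planes_def proj_planes_def)
    have "cvec u \<in> H \<inter> K" by (rule subsetD[OF that(2) range_scale_self])
    then show "cvec u \<in> H" "cvec u \<in> K" by blast+
  qed
  from crit consider
      (smooth) "smooth_quadric S" "ruled S"
    | (cone) "quadric_cone S" "\<not> on_common_line S (real_point u1) (real_point u2)"
    | (vertex) "quadric_cone S" "real_point u1 = vertex S \<or> real_point u2 = vertex S"
    | (one_plane) H K where "union_of_planes S H K" "real_point u1 \<subseteq> H" "real_point u2 \<subseteq> H"
        "\<not> real_point u1 \<subseteq> H \<inter> K" "\<not> real_point u2 \<subseteq> H \<inter> K"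
    | (meet) H K where "union_of_planes S H K" "real_point u1 \<subseteq> H \<inter> K \<or> real_point u2 \<subseteq> H \<inter> K"
    | (double) "double_plane S" "real_point u1 \<subseteq> surface S"
    unfolding critical_quadric_def by (elim disjE exE conjE) metis+
  then show ?thesis
  proof cases
    case smooth
    then show ?thesis using splits_smooth[OF S ind q] by blast
  next
    case cone
    then have "u1 \<bullet> (S *v u2) \<noteq> 0" using on_common_line_iff[OF S ind q] by blast
    then show ?thesis using splits_cone[OF S ind q] cone by blast
  next
    case vertex
    then show ?thesis
      using vertex_real_point_iff[OF vertex(1) u0(1)] vertex_real_point_iff[OF vertex(1) u0(2)]
        singular1 singular2 by blast
  next
    case one_plane
    then have pl: "H \<in> proj_planes" "K \<in> proj_planes" by (auto simp: union_of_planes_def)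
    have "cvec u1 \<in> H" "cvec u2 \<in> H" "cvec u1 \<notin> K" "cvec u2 \<notin> K"
      using one_plane(2-5) unfolding Int_subset_iff real_point_subset_plane[OF pl(1)] real_point_subset_plane[OF pl(2)] le_inf_iff
      by blast+
    then show ?thesis using splits_one_plane[OF S ind one_plane(1)] by blast
  next
    case meet
    then show ?thesis using \<open>\<And>u H K. union_of_planes S H K \<Longrightarrow> real_point u \<subseteq> H \<inter> K \<Longrightarrow> S *v u = 0\<close>
      singular1 singular2 by blast
  next
    case double
    have "S *v u1 = 0"
    proof (rule plane_union_singular[OF S])
      show "surface S = surface S \<union> surface S" by simp
      show "vec.subspace (surface S)" "vec.subspace (surface S)"
        using double(1) by (auto simp: double_plane_def proj_planes_def)
      show "cvec u1 \<in> surface S" "cvec u1 \<in> surface S" by (rule subsetD[OF double(2) range_scale_self])+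
    qed
    then show ?thesis by (rule singular1)
  qed
qed

section \<open>Critical configurations\<close>

lemma transpose_mult_inner:
  fixes P :: "real^'n^'m"
  shows "(transpose P *v c) \<bullet> x = c \<bullet> (P *v x)"
  by (metis dot_lmul_matrix transpose_matrix_vector)

text \<open>Pulling back forms along a surjective map is injective.\<close>

lemma indep2_transpose:
  assumes "camera P"
  shows "indep2 (transpose P *v c1) (transpose P *v c2) \<longleftrightarrow> indep2 c1 c2"
proof -
  have comb: "s *\<^sub>R (transpose P *v c1) + t *\<^sub>R (transpose P *v c2) = transpose P *v (s *\<^sub>R c1 + t *\<^sub>R c2)" for s t
    by (simp only: matrix_vector_right_distrib matrix_vector_mult_scaleR)
  have "transpose P *v c = 0 \<longleftrightarrow> c = 0" for c
  proof
    assume c: "transpose P *v c = 0"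
    obtain x where "P *v x = c" using assms unfolding camera_surj by (metis surjD)
    then have "c \<bullet> c = 0" using transpose_mult_inner[of P c x] c by simp
    then show "c = 0" by simp
  qed simp
  then show ?thesis unfolding indep2_def comb by simp
qed

definition rank2_form :: "real^3 \<Rightarrow> real^3 \<Rightarrow> real^3 \<Rightarrow> real^3 \<Rightarrow> complex^3 \<Rightarrow> complex^3 \<Rightarrow> complex" where
  "rank2_form c1 d1 c2 d2 x y = dotc c1 x * dotc d1 y + dotc c2 x * dotc d2 y"

lemma bilin_rank2_form: "bilin (rank2_form c1 d1 c2 d2)"
  by (simp add: bilin_def rank2_form_def algebra_simps)

definition sym_product :: "real^4 \<Rightarrow> real^4 \<Rightarrow> real^4 \<Rightarrow> real^4 \<Rightarrow> real^4^4" where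
  "sym_product l1 m1 l2 m2 =
     (\<chi> i j. (l1 $ i * m1 $ j + m1 $ i * l1 $ j + l2 $ i * m2 $ j + m2 $ i * l2 $ j) / 2)"

lemma transpose_sym_product: "transpose (sym_product l1 m1 l2 m2) = sym_product l1 m1 l2 m2"
  by (simp add: sym_product_def transpose_def vec_eq_iff mult.commute add_ac)

lemma split_form_sym_product: "split_form (sym_product l1 m1 l2 m2) l1 m1 l2 m2"
  unfolding split_form_def
proof
  fix x
  have "sym_product l1 m1 l2 m2 *v x = (1/2) *\<^sub>R
      ((m1 \<bullet> x) *\<^sub>R l1 + (l1 \<bullet> x) *\<^sub>R m1 + (m2 \<bullet> x) *\<^sub>R l2 + (l2 \<bullet> x) *\<^sub>R m2)"
    by (simp add: vec_eq_iff sym_product_def matrix_vector_mult_def inner_vec_def sum_4 field_simps)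
  then show "x \<bullet> (sym_product l1 m1 l2 m2 *v x) = (l1 \<bullet> x) * (m1 \<bullet> x) + (l2 \<bullet> x) * (m2 \<bullet> x)"
    by (simp add: inner_add_right inner_commute[of x])
qed

lemma same_formI:
  assumes "\<And>x y. G x y = k * F x y" and "\<exists>x y. G x y \<noteq> 0"
  shows "same_form F G"
proof -
  have "k \<noteq> 0" using assms by auto
  then show ?thesis unfolding same_form_def
    by (intro exI[of _ "1 / k"]) (simp add: assms(1))
qed

context camera_pair
begin

lemma camera_pair_polar:
  assumes "transpose S = S"
    and "split_form S (transpose P1 *v c1) (transpose P2 *v d1) (transpose P1 *v c2) (transpose P2 *v d2)"
  shows "2 * polar_form S v w = rank2_form c1 d1 c2 d2 (cmat P1 *v v) (cmat P2 *v w)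
    + rank2_form c1 d1 c2 d2 (cmat P1 *v w) (cmat P2 *v v)"
  unfolding split_form_polar[OF assms] dotc_transpose rank2_form_def by (simp add: algebra_simps)

text \<open>Up to a scalar, each \<open>P\<close> maps \<open>v\<close> to where the corresponding
  \<open>Q\<close> maps \<open>A *v v\<close>. So the fundamental form of the second pair vanishes
  on the joint image of the first, and such forms are unique up to scale.\<close>

lemma equivalent_imp_same_form:
  assumes Q: "camera_pair Q1 Q2 w1 w2" and eq: "equivalent_configurations P1 P2 X Q1 Q2 Y"
  shows "same_form (fundamental_form P1 P2) (fundamental_form Q1 Q2)"
proof -
  interpret Q: camera_pair Q1 Q2 w1 w2 by (rule Q)
  obtain A where A: "invertible A" and same: "same_camera (cmat P1 ** matrix_inv A) (cmat Q1)"
      "same_camera (cmat P2 ** matrix_inv A) (cmat Q2)"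
    using eq unfolding equivalent_configurations_def by (elim exE conjE)
  obtain k1 where k1: "cmat P1 ** matrix_inv A = map_matrix ((*) k1) (cmat Q1)"
    using same(1) unfolding same_camera_def by (elim exE conjE)
  obtain k2 where k2: "cmat P2 ** matrix_inv A = map_matrix ((*) k2) (cmat Q2)"
    using same(2) unfolding same_camera_def by (elim exE conjE)
  note k = k1 k2
  have scale: "map_matrix ((*) k) M *v v = k *s (M *v v)" for k and M :: "complex^4^3" and v
    by (simp add: vec_eq_iff map_matrix_def matrix_vector_mult_def sum_distrib_left mult.assoc)
  have "fundamental_form Q1 Q2 (cmat P1 *v v) (cmat P2 *v v) = 0" for v
  proof -
    have "matrix_inv A ** A = mat 1"
      using someI_ex[OF A[unfolded invertible_def]] unfolding matrix_inv_def by blast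
    then have v: "v = matrix_inv A *v (A *v v)" by (simp add: matrix_vector_mul_assoc)
    have "cmat P1 *v v = k1 *s (cmat Q1 *v (A *v v))" "cmat P2 *v v = k2 *s (cmat Q2 *v (A *v v))"
      by (subst v, simp only: matrix_vector_mul_assoc[of _ "matrix_inv A"] k scale)+
    then show ?thesis
      by (simp add: bilinD(2,4)[OF bilin_fundamental_form] Q.fundamental_form_vanishes)
  qed
  then obtain k where "\<And>x y. fundamental_form Q1 Q2 x y = k * fundamental_form P1 P2 x y"
    using vanishing_form_unique[OF bilin_fundamental_form bilin_fundamental_form _
        fundamental_form_vanishes fundamental_form_nonzero] by blast
  then show ?thesis by (rule same_formI) (rule Q.fundamental_form_nonzero)
qed

text \<open>The splitting descends to a rank 2 form on the two image planes, because forms vanishing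
  at a center are pullbacks. Cameras realizing this form provide the conjugate.\<close>

lemma splits_imp_critical:
  assumes S: "transpose S = S" "S \<noteq> 0" and sp: "splits S u1 u2"
    and X: "X \<subseteq> blowup (center P1) (center P2)" "X \<subseteq> strict_transform (center P1) (center P2) S"
  shows "nontrivially_critical P1 P2 X"
proof -
  obtain l1 m1 l2 m2 where lm: "split_form S l1 m1 l2 m2" "indep2 l1 l2" "indep2 m1 m2"
    "l1 \<bullet> u1 = 0" "l2 \<bullet> u1 = 0" "m1 \<bullet> u2 = 0" "m2 \<bullet> u2 = 0"
    using sp unfolding splits_def by blast
  obtain c1 c2 where c: "l1 = transpose P1 *v c1" "l2 = transpose P1 *v c2"
    using camera_functional[OF camera1 kernel1] lm(4,5) by metis
  obtain d1 d2 where d: "m1 = transpose P2 *v d1" "m2 = transpose P2 *v d2"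
    using camera_functional[OF camera2 kernel2] lm(6,7) by metis
  have ind: "indep2 c1 c2" "indep2 d1 d2"
    using lm(2,3) unfolding c d indep2_transpose[OF camera1] indep2_transpose[OF camera2] .
  let ?g = "rank2_form c1 d1 c2 d2"
  note pol = camera_pair_polar[OF S(1) lm(1)[unfolded c d]]
  \<comment> \<open>The pullback of \<open>?g\<close> recovers the nonzero quadratic form of
    \<open>S\<close>; this later separates \<open>?g\<close> from the fundamental form of
    \<open>P1\<close> and \<open>P2\<close>.\<close>
  have g0: "\<exists>v. ?g (cmat P1 *v v) (cmat P2 *v v) \<noteq> 0"
  proof (rule ccontr)
    assume "\<not> ?thesis"
    then have "2 * polar_form S v v = 0" for v unfolding pol by simp
    then have "complex_of_real (x \<bullet> (S *v x)) = 0" for x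
      unfolding polar_form_cvec[symmetric] by simp
    then have "S = 0" by (intro quadric_zeroI[OF S(1)]) simp
    then show False using S(2) by blast
  qed
  obtain Q1 Q2 where Q: "camera Q1" "camera Q2" "center Q1 \<noteq> center Q2"
    and gQ: "\<And>v. ?g (cmat Q1 *v v) (cmat Q2 *v v) = 0"
    using cameras_with_form[OF ind] unfolding rank2_form_def by blast
  obtain w1 where w1: "kernel_vector Q1 w1" using kernel_vector_exists[OF Q(1)] .
  obtain w2 where w2: "kernel_vector Q2 w2" using kernel_vector_exists[OF Q(2)] .
  have pair: "camera_pair Q1 Q2 w1 w2"
    using Q w1 w2 kernel_vectors_indep[OF Q(1,2) w1 w2 Q(3)] by unfold_locales
  interpret Q: camera_pair Q1 Q2 w1 w2 by (rule pair)
  obtain k where k: "\<And>x y. ?g x y = k * fundamental_form Q1 Q2 x y"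
    using Q.vanishing_form_unique[OF bilin_rank2_form bilin_fundamental_form gQ
        Q.fundamental_form_vanishes Q.fundamental_form_nonzero] by blast
  have k0: "k \<noteq> 0" using g0 k by auto
  have not_same: "\<not> same_form (fundamental_form P1 P2) (fundamental_form Q1 Q2)"
  proof
    assume "same_form (fundamental_form P1 P2) (fundamental_form Q1 Q2)"
    then obtain r where r: "r \<noteq> 0" "\<And>x y. fundamental_form P1 P2 x y = r * fundamental_form Q1 Q2 x y"
      unfolding same_form_def by blast
    have "?g (cmat P1 *v v) (cmat P2 *v v) = 0" for v
      using fundamental_form_vanishes[of v] r k by simp
    then show False using g0 by blast
  qed
  \<comment> \<open>The full preimage of the joint image of \<open>X\<close>. It reaches all of that
    image because \<open>?g\<close> vanishes there and the joint map of \<open>Q1\<close> and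
    \<open>Q2\<close> is onto the zero locus.\<close>
  define Y where "Y = {\<eta> \<in> blowup (center Q1) (center Q2). joint_camera_map Q1 Q2 \<eta> \<in> joint_camera_map P1 P2 ` X}"
  have "joint_camera_map P1 P2 \<xi> \<in> joint_camera_map Q1 Q2 ` Y" if \<xi>: "\<xi> \<in> X" for \<xi>
  proof -
    obtain x L1 L2 where e: "\<xi> = (x, L1, L2)" by (cases \<xi>)
    have b: "(x, L1, L2) \<in> blowup (center P1) (center P2)"
      and st: "(x, L1, L2) \<in> strict_transform (center P1) (center P2) S"
      using X \<xi> unfolding e by blast+
    have L: "L1 \<in> proj_lines" "center P1 \<subseteq> L1" "L2 \<in> proj_lines" "center P2 \<subseteq> L2"
      using b by (auto simp: blowup_def)
    obtain v1 where v1: "v1 \<in> L1" "cmat P1 *v v1 \<noteq> 0" "(*v) (cmat P1) ` L1 = range (\<lambda>k. k *s (cmat P1 *v v1))"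
      by (rule camera_line_image[OF camera1 kernel1 L(1,2)]) blast
    obtain v2 where v2: "v2 \<in> L2" "cmat P2 *v v2 \<noteq> 0" "(*v) (cmat P2) ` L2 = range (\<lambda>k. k *s (cmat P2 *v v2))"
      by (rule camera_line_image[OF camera2 kernel2 L(3,4)]) blast
    have "?g (cmat P1 *v v1) (cmat P2 *v v2) = 0"
      using st v1(1) v2(1) unfolding strict_transform_iff_form_vanishes[OF bilin_rank2_form pol b] by blast
    then have "fundamental_form Q1 Q2 (cmat P1 *v v1) (cmat P2 *v v2) = 0" using k k0 by simp
    then obtain \<eta> where \<eta>: "\<eta> \<in> blowup (center Q1) (center Q2)"
      "joint_camera_map Q1 Q2 \<eta> = (range (\<lambda>k. k *s (cmat P1 *v v1)), range (\<lambda>k. k *s (cmat P2 *v v2)))"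
      by (rule Q.joint_map_surj[OF v1(2) v2(2)])
    have "joint_camera_map P1 P2 \<xi> = joint_camera_map Q1 Q2 \<eta>"
      by (simp add: joint_camera_map_def e v1(3) v2(3) \<eta>(2)[unfolded joint_camera_map_def])
    then show ?thesis using \<eta>(1) \<xi> unfolding Y_def by (metis (mono_tags, lifting) image_eqI mem_Collect_eq)
  qed
  then have "joint_camera_map P1 P2 ` X = joint_camera_map Q1 Q2 ` Y" unfolding Y_def by blast
  moreover have "configuration Q1 Q2 Y" unfolding configuration_def Y_def using Q by blast
  moreover have "\<not> equivalent_configurations P1 P2 X Q1 Q2 Y"
    using equivalent_imp_same_form[OF pair] not_same by blast
  ultimately show ?thesis unfolding nontrivially_critical_def conjugate_def using not_same by blast
qed

text \<open>The quadric is the symmetrized pullback of the fundamental form of a conjugate pair.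
  Points of \<open>X\<close> have the same images as points of \<open>Y\<close>, where this form
  vanishes.\<close>

lemma critical_imp_quadric:
  assumes X: "X \<subseteq> blowup (center P1) (center P2)" and crit: "nontrivially_critical P1 P2 X"
  obtains S where "transpose S = S" "S \<noteq> 0" "u1 \<bullet> (S *v u1) = 0" "u2 \<bullet> (S *v u2) = 0"
    "X \<subseteq> strict_transform (center P1) (center P2) S"
    "critical_quadric (real_point u1) (real_point u2) S"
proof -
  obtain Q1 Q2 Y where Q: "camera Q1" "camera Q2" "center Q1 \<noteq> center Q2"
    and Y: "Y \<subseteq> blowup (center Q1) (center Q2)"
    and img: "joint_camera_map P1 P2 ` X = joint_camera_map Q1 Q2 ` Y"
    and not_same: "\<not> same_form (fundamental_form P1 P2) (fundamental_form Q1 Q2)"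
    using crit unfolding nontrivially_critical_def conjugate_def configuration_def by blast
  obtain w1 where w1: "kernel_vector Q1 w1" using kernel_vector_exists[OF Q(1)] .
  obtain w2 where w2: "kernel_vector Q2 w2" using kernel_vector_exists[OF Q(2)] .
  interpret Q: camera_pair Q1 Q2 w1 w2
    using Q w1 w2 kernel_vectors_indep[OF Q(1,2) w1 w2 Q(3)] by unfold_locales
  obtain c1 c2 d1 d2 where cd: "indep2 c1 c2" "indep2 d1 d2"
    and F: "\<And>x y. fundamental_form Q1 Q2 x y = rank2_form c1 d1 c2 d2 x y"
    using Q.fundamental_form_rank2 unfolding rank2_form_def by metis
  let ?l1 = "transpose P1 *v c1" and ?l2 = "transpose P1 *v c2"
  let ?m1 = "transpose P2 *v d1" and ?m2 = "transpose P2 *v d2"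
  define S where "S = sym_product ?l1 ?m1 ?l2 ?m2"
  have S: "transpose S = S" unfolding S_def by (rule transpose_sym_product)
  have sp: "split_form S ?l1 ?m1 ?l2 ?m2" unfolding S_def by (rule split_form_sym_product)
  note pol = camera_pair_polar[OF S sp]
  have S0: "S \<noteq> 0"
  proof
    assume "S = 0"
    then have "2 * polar_form S v v = 0" for v by (simp add: polar_form_def)
    then have "fundamental_form Q1 Q2 (cmat P1 *v v) (cmat P2 *v v) = 0" for v
      unfolding F pol by simp
    then obtain k where "\<And>x y. fundamental_form Q1 Q2 x y = k * fundamental_form P1 P2 x y"
      using vanishing_form_unique[OF bilin_fundamental_form bilin_fundamental_form _
          fundamental_form_vanishes fundamental_form_nonzero] by blast
    then have "same_form (fundamental_form P1 P2) (fundamental_form Q1 Q2)"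
      by (rule same_formI) (rule Q.fundamental_form_nonzero)
    then show False using not_same by blast
  qed
  have l: "?l1 \<bullet> u1 = 0" "?l2 \<bullet> u1 = 0" and m: "?m1 \<bullet> u2 = 0" "?m2 \<bullet> u2 = 0"
    unfolding transpose_mult_inner P1_u1 P2_u2 by simp_all
  have q: "u1 \<bullet> (S *v u1) = 0" "u2 \<bullet> (S *v u2) = 0"
    using sp l m unfolding split_form_def by simp_all
  have "X \<subseteq> strict_transform (center P1) (center P2) S"
  proof
    fix \<xi> assume \<xi>: "\<xi> \<in> X"
    obtain x L1 L2 where e: "\<xi> = (x, L1, L2)" by (cases \<xi>)
    have b: "(x, L1, L2) \<in> blowup (center P1) (center P2)" using X \<xi> unfolding e by blast
    have "joint_camera_map P1 P2 \<xi> \<in> joint_camera_map Q1 Q2 ` Y" using \<xi> img by blast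
    then obtain \<eta> where \<eta>: "\<eta> \<in> Y" "joint_camera_map P1 P2 \<xi> = joint_camera_map Q1 Q2 \<eta>" by blast
    obtain y M1 M2 where e': "\<eta> = (y, M1, M2)" by (cases \<eta>)
    have img1: "(*v) (cmat P1) ` L1 = (*v) (cmat Q1) ` M1" and img2: "(*v) (cmat P2) ` L2 = (*v) (cmat Q2) ` M2"
      using \<eta>(2) by (simp_all add: joint_camera_map_def e e')
    have "(y, M1, M2) \<in> blowup (center Q1) (center Q2)" using Y \<eta>(1) unfolding e' by blast
    then have "\<forall>a \<in> (*v) (cmat P1) ` L1. \<forall>b \<in> (*v) (cmat P2) ` L2. rank2_form c1 d1 c2 d2 a b = 0"
      unfolding img1 img2 F[symmetric] using Q.joint_map_on_fundamental_form by blast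
    then show "\<xi> \<in> strict_transform (center P1) (center P2) S"
      unfolding e strict_transform_iff_form_vanishes[OF bilin_rank2_form pol b] .
  qed
  moreover have "critical_quadric (real_point u1) (real_point u2) S"
    using split_form_critical[OF S S0 indep sp _ _ l m] cd
    unfolding indep2_transpose[OF camera1] indep2_transpose[OF camera2] by blast
  ultimately show ?thesis using that S S0 q by blast
qed

end

theorem theorem4p11:
  fixes P1 P2 :: "real^4^3"
    and p1 p2 :: "(complex^4) set"
    and X :: "blowup_point set"
  assumes "camera P1" and "camera P2"
    and "p1 = center P1" and "p2 = center P2"
    and "p1 \<noteq> p2"
    and "X \<subseteq> blowup p1 p2"
  shows "nontrivially_critical P1 P2 X \<longleftrightarrow>
    (\<exists>S :: real^4^4. real_quadric S \<and> p1 \<subseteq> surface S \<and> p2 \<subseteq> surface S \<and>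
       X \<subseteq> strict_transform p1 p2 S \<and>
       ((smooth_quadric S \<and> ruled S \<and> \<not> on_common_line S p1 p2) \<or>
        (smooth_quadric S \<and> ruled S \<and> on_common_line S p1 p2) \<or>
        (quadric_cone S \<and> p1 \<noteq> vertex S \<and> p2 \<noteq> vertex S \<and> \<not> on_common_line S p1 p2) \<or>
        (quadric_cone S \<and> ((p1 = vertex S \<and> p2 \<noteq> vertex S) \<or> (p1 \<noteq> vertex S \<and> p2 = vertex S))) \<or>
        (\<exists>H K. union_of_planes S H K \<and> real_subspace H \<and> real_subspace K \<and>
           p1 \<subseteq> H \<and> p2 \<subseteq> H \<and> \<not> p1 \<subseteq> H \<inter> K \<and> \<not> p2 \<subseteq> H \<inter> K) \<or>
        (\<exists>H K. union_of_planes S H K \<and> real_subspace H \<and> real_subspace K \<and>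
           ((p1 \<subseteq> H \<inter> K \<and> \<not> p2 \<subseteq> H \<inter> K) \<or> (\<not> p1 \<subseteq> H \<inter> K \<and> p2 \<subseteq> H \<inter> K))) \<or>
        (\<exists>H K. union_of_planes S H K \<and> p1 \<subseteq> H \<inter> K \<and> p2 \<subseteq> H \<inter> K) \<or>
        (double_plane S \<and> p1 \<subseteq> surface S \<and> p2 \<subseteq> surface S)))"
proof -
  obtain u1 where u1: "kernel_vector P1 u1" using kernel_vector_exists[OF assms(1)] .
  obtain u2 where u2: "kernel_vector P2 u2" using kernel_vector_exists[OF assms(2)] .
  have neq: "center P1 \<noteq> center P2" using assms(3-5) by simp
  interpret camera_pair P1 P2 u1 u2
    using assms(1,2) u1 u2 kernel_vectors_indep[OF assms(1,2) u1 u2 neq] by unfold_locales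
  have p: "p1 = real_point u1" "p2 = real_point u2"
    using assms(3,4) center1_eq center2_eq by simp_all
  have surf: "p1 \<subseteq> surface S \<longleftrightarrow> u1 \<bullet> (S *v u1) = 0" "p2 \<subseteq> surface S \<longleftrightarrow> u2 \<bullet> (S *v u2) = 0" for S
    unfolding p by (rule real_point_subset_surface)+
  have X: "X \<subseteq> blowup (center P1) (center P2)" using assms(3,4,6) by simp
  have "nontrivially_critical P1 P2 X \<longleftrightarrow>
    (\<exists>S. real_quadric S \<and> p1 \<subseteq> surface S \<and> p2 \<subseteq> surface S \<and> X \<subseteq> strict_transform p1 p2 S \<and>
      critical_quadric p1 p2 S)"
  proof
    assume "nontrivially_critical P1 P2 X"
    then obtain S where "transpose S = S" "S \<noteq> 0" "u1 \<bullet> (S *v u1) = 0" "u2 \<bullet> (S *v u2) = 0"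
      "X \<subseteq> strict_transform (center P1) (center P2) S"
      "critical_quadric (real_point u1) (real_point u2) S"
      by (rule critical_imp_quadric[OF X])
    then have "real_quadric S \<and> p1 \<subseteq> surface S \<and> p2 \<subseteq> surface S \<and> X \<subseteq> strict_transform p1 p2 S \<and>
      critical_quadric p1 p2 S"
      unfolding surf real_quadric_def assms(3,4)[symmetric] p[symmetric] by simp
    then show "\<exists>S. real_quadric S \<and> p1 \<subseteq> surface S \<and> p2 \<subseteq> surface S \<and> X \<subseteq> strict_transform p1 p2 S \<and>
      critical_quadric p1 p2 S" ..
  next
    assume "\<exists>S. real_quadric S \<and> p1 \<subseteq> surface S \<and> p2 \<subseteq> surface S \<and> X \<subseteq> strict_transform p1 p2 S \<and>
      critical_quadric p1 p2 S"
    then obtain S where S: "transpose S = S" "S \<noteq> 0"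
      and q: "u1 \<bullet> (S *v u1) = 0" "u2 \<bullet> (S *v u2) = 0"
      and XS: "X \<subseteq> strict_transform p1 p2 S" and crit: "critical_quadric p1 p2 S"
      unfolding surf real_quadric_def by blast
    have "splits S u1 u2"
      using critical_quadric_splits[OF S(1) indep q] crit unfolding p .
    then show "nontrivially_critical P1 P2 X"
      using splits_imp_critical[OF S _ X] XS unfolding assms(3,4) by blast
  qed
  then show ?thesis unfolding critical_quadric_def .
qed

end
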